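(* Let $\mathcal C,\mathcal D$ be symmetric monoidal categories satisfying the standing assumptions in the context, and let $(F,J,\epsilon):\mathcal C\to\mathcal D$ be a (lax) symmetric monoidal functor that preserves filtered colimits. Let $(V,|0\rangle,T,Y(z)=\sum_n\cdot_nz^{-n-1})$ be a vertex algebra in $\mathcal C$. Define $V_F=F(V)$, $|0\rangle_F=F(|0\rangle)\circ\epsilon$, $T_F=F(T)$, and $Y_F(z)=\sum_{n\in\mathbb Z}z^{-n-1}F(\cdot_n)\circ J_{V,V}$. Then $(V_F,|0\rangle_F,T_F,Y_F(z))$ is a vertex algebra in $\mathcal D$.
   Context: Standing assumptions on $\mathcal C$ (and likewise $\mathcal D$): $(\mathcal C,\otimes,\mathbf 1)$ is a symmetric monoidal category with unit isomorphisms $l_X:\mathbf 1\otimes X\to X$, $r_X:X\otimes\mathbf 1\to X$ and symmetric braiding $\sigma$ (associators are suppressed) such that (i) $\mathcal C\cong\mathrm{Ind}(\mathcal C_0)$ for a symmetric monoidal category $\mathcal C_0$, and $(\mathrm{colim}\,X_a)\otimes(\mathrm{colim}\,Y_b)=\mathrm{colim}(X_a\otimes Y_b)$; (ii) $\mathcal C_0$ is additive, Karoubian (every idempotent splits) and rigid symmetric monoidal; (iii) $\mathbb Q\subset\mathrm{End}_{\mathcal C}(\mathbf 1)$. An object $X$ is compact if $\mathrm{Hom}_{\mathcal C}(X,-)$ preserves filtered colimits. A lax monoidal functor consists of a functor $F$, a morphism $\epsilon:\mathbf 1_{\mathcal D}\to F(\mathbf 1_{\mathcal C})$ and a natural transformation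 $J:F(-)\otimes F(-)\to F(-\otimes-)$ satisfying associativity and unitality ($\epsilon,J$ need not be isomorphisms); it is symmetric if it respects the braidings. A vertex algebra in $\mathcal C$ is an object $V$ with morphisms $|0\rangle\in\mathrm{Hom}_{\mathcal C}(\mathbf 1,V)$, $T\in\mathrm{Hom}_{\mathcal C}(V,V)$, and $\cdot_n\in\mathrm{Hom}_{\mathcal C}(V\otimes V,V)$ for $n\in\mathbb Z$, with $Y(z)=\sum_n\cdot_n z^{-n-1}$, such that for all compact $X,X'$ and $\alpha:X\to V$, $\beta:X'\to V$ there is $K$ with $\cdot_n\circ(\alpha\otimes\beta)=0$ for all $n\ge K$, and satisfying: (Vacuum) $Y(z)\circ(|0\rangle\otimes\mathrm{id}_V)=l_V$; $Y(z)\circ(\mathrm{id}_V\otimes|0\rangle)\in\mathrm{Hom}_{\mathcal C}(V\otimes\mathbf 1,V)[[z]]$ with value $r_V$ at $z=0$. (Translation) $T\circ|0\rangle=0$ and $T\circ Y(z)-Y(z)\circ(\mathrm{id}_V\otimes T)=\partial_zY(z)$. (Locality) for all compact $X,X'$ and $\alpha:X\to V$, $\beta:X'\to V$ there is an integer $K$ with $(z-w)^K\big(Y(w)\circ(\mathrm{id}_V\otimes Y(z))\circ(\alpha\otimes\beta\otimes\mathrm{id}_V)-Y(z)\circ(\mathrm{id}_V\otimes Y(w))\circ(\sigma\otimes\mathrm{id}_V)\circ(\alpha\otimes\beta\otimes\mathrm{id}_V)\big)=0$.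
   Formalization: The functor F is additionally assumed to be additive on morphisms; without this the claim fails, e.g. for the constant functor at the unit object, which is lax symmetric monoidal and preserves filtered colimits but sends T to the identity, so T_F∘|0>_F ≠ 0. *)

theory Defs
  imports Complex_Main "HOL-Algebra.Ring" "HOL-Library.FuncSet"
begin

unbundle cardinal_syntax

section \<open>Categories\<close>

record ('o, 'a) cat =
  Obj :: "'o set"
  Arr :: "'a set"
  Dom :: "'a \<Rightarrow> 'o"
  Cod :: "'a \<Rightarrow> 'o"
  Ident :: "'o \<Rightarrow> 'a"
  Comp :: "'a \<Rightarrow> 'a \<Rightarrow> 'a"  (infixr "\<bullet>\<index>" 70)

definition Hom :: "('o, 'a, 'x) cat_scheme \<Rightarrow> 'o \<Rightarrow> 'o \<Rightarrow> 'a set" where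
  "Hom C X Y = {f \<in> Arr C. Dom C f = X \<and> Cod C f = Y}"

locale category =
  fixes C :: "('o, 'a, 'x) cat_scheme" (structure)
  assumes Dom_Obj: "f \<in> Arr C \<Longrightarrow> Dom C f \<in> Obj C"
    and Cod_Obj: "f \<in> Arr C \<Longrightarrow> Cod C f \<in> Obj C"
    and Ident_Hom: "X \<in> Obj C \<Longrightarrow> Ident C X \<in> Hom C X X"
    and Comp_Hom: "f \<in> Hom C X Y \<Longrightarrow> g \<in> Hom C Y Z \<Longrightarrow> g \<bullet> f \<in> Hom C X Z"
    and Ident_left: "f \<in> Hom C X Y \<Longrightarrow> Ident C Y \<bullet> f = f"
    and Ident_right: "f \<in> Hom C X Y \<Longrightarrow> f \<bullet> Ident C X = f"
    and Comp_assoc: "f \<in> Hom C W X \<Longrightarrow> g \<in> Hom C X Y \<Longrightarrow> h \<in> Hom C Y Z \<Longrightarrow>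
          h \<bullet> (g \<bullet> f) = (h \<bullet> g) \<bullet> f"

definition inverse_arrows :: "('o, 'a, 'x) cat_scheme \<Rightarrow> 'a \<Rightarrow> 'a \<Rightarrow> bool" where
  "inverse_arrows C f g \<longleftrightarrow>
     f \<in> Arr C \<and> g \<in> Hom C (Cod C f) (Dom C f) \<and>
     g \<bullet>\<^bsub>C\<^esub> f = Ident C (Dom C f) \<and> f \<bullet>\<^bsub>C\<^esub> g = Ident C (Cod C f)"

definition iso_arrow :: "('o, 'a, 'x) cat_scheme \<Rightarrow> 'a \<Rightarrow> bool" where
  "iso_arrow C f \<longleftrightarrow> (\<exists>g. inverse_arrows C f g)"

definition op_cat :: "('o, 'a, 'x) cat_scheme \<Rightarrow> ('o, 'a) cat" where
  "op_cat C = \<lparr>Obj = Obj C, Arr = Arr C, Dom = Cod C, Cod = Dom C,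
     Ident = Ident C, Comp = (\<lambda>g f. f \<bullet>\<^bsub>C\<^esub> g)\<rparr>"

definition prod_cat ::
  "('o, 'a, 'x) cat_scheme \<Rightarrow> ('p, 'b, 'y) cat_scheme \<Rightarrow> ('o \<times> 'p, 'a \<times> 'b) cat" where
  "prod_cat A B = \<lparr>Obj = Obj A \<times> Obj B, Arr = Arr A \<times> Arr B,
     Dom = map_prod (Dom A) (Dom B), Cod = map_prod (Cod A) (Cod B),
     Ident = map_prod (Ident A) (Ident B),
     Comp = (\<lambda>g f. (fst g \<bullet>\<^bsub>A\<^esub> fst f, snd g \<bullet>\<^bsub>B\<^esub> snd f))\<rparr>"

definition full_subcat :: "('o, 'a, 'x) cat_scheme \<Rightarrow> 'o set \<Rightarrow> ('o, 'a) cat" where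
  "full_subcat C S = \<lparr>Obj = Obj C \<inter> S,
     Arr = {f \<in> Arr C. Dom C f \<in> S \<and> Cod C f \<in> S},
     Dom = Dom C, Cod = Cod C, Ident = Ident C, Comp = Comp C\<rparr>"

section \<open>Functors and natural transformations\<close>

record ('o, 'a, 'p, 'b) func =
  FO :: "'o \<Rightarrow> 'p"
  FA :: "'a \<Rightarrow> 'b"

locale cat_functor = A: category A + B: category B
  for A :: "('o, 'a, 'x) cat_scheme" and B :: "('p, 'b, 'y) cat_scheme" +
  fixes F :: "('o, 'a, 'p, 'b) func"
  assumes FO_Obj: "X \<in> Obj A \<Longrightarrow> FO F X \<in> Obj B"
    and FA_Hom: "f \<in> Hom A X Y \<Longrightarrow> FA F f \<in> Hom B (FO F X) (FO F Y)"
    and FA_Ident: "X \<in> Obj A \<Longrightarrow> FA F (Ident A X) = Ident B (FO F X)"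
    and FA_Comp: "f \<in> Hom A X Y \<Longrightarrow> g \<in> Hom A Y Z \<Longrightarrow>
          FA F (g \<bullet>\<^bsub>A\<^esub> f) = FA F g \<bullet>\<^bsub>B\<^esub> FA F f"

definition id_func :: "('o, 'a, 'o, 'a) func" where
  "id_func = \<lparr>FO = (\<lambda>X. X), FA = (\<lambda>f. f)\<rparr>"

definition comp_func ::
  "('p, 'b, 'q, 'c) func \<Rightarrow> ('o, 'a, 'p, 'b) func \<Rightarrow> ('o, 'a, 'q, 'c) func" where
  "comp_func G F = \<lparr>FO = FO G \<circ> FO F, FA = FA G \<circ> FA F\<rparr>"

definition nat_trans :: "('o, 'a, 'x) cat_scheme \<Rightarrow> ('p, 'b, 'y) cat_scheme \<Rightarrow>
    ('o, 'a, 'p, 'b) func \<Rightarrow> ('o, 'a, 'p, 'b) func \<Rightarrow> ('o \<Rightarrow> 'b) \<Rightarrow> bool" where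
  "nat_trans A B F G \<eta> \<longleftrightarrow> cat_functor A B F \<and> cat_functor A B G \<and>
     (\<forall>X\<in>Obj A. \<eta> X \<in> Hom B (FO F X) (FO G X)) \<and>
     (\<forall>f\<in>Arr A. FA G f \<bullet>\<^bsub>B\<^esub> \<eta> (Dom A f) = \<eta> (Cod A f) \<bullet>\<^bsub>B\<^esub> FA F f)"

definition nat_iso :: "('o, 'a, 'x) cat_scheme \<Rightarrow> ('p, 'b, 'y) cat_scheme \<Rightarrow>
    ('o, 'a, 'p, 'b) func \<Rightarrow> ('o, 'a, 'p, 'b) func \<Rightarrow> ('o \<Rightarrow> 'b) \<Rightarrow> bool" where
  "nat_iso A B F G \<eta> \<longleftrightarrow> nat_trans A B F G \<eta> \<and> (\<forall>X\<in>Obj A. iso_arrow B (\<eta> X))"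

definition equivalence_functor :: "('o, 'a, 'x) cat_scheme \<Rightarrow> ('p, 'b, 'y) cat_scheme \<Rightarrow>
    ('o, 'a, 'p, 'b) func \<Rightarrow> bool" where
  "equivalence_functor A B F \<longleftrightarrow> cat_functor A B F \<and>
     (\<exists>G \<eta> \<theta>. cat_functor B A G \<and>
        nat_iso A A id_func (comp_func G F) \<eta> \<and> nat_iso B B (comp_func F G) id_func \<theta>)"

text \<open>An arrow of the functor category carries its source and target functor; its components
  are extensional so that equal natural transformations are equal as arrows.\<close>

definition func_cat :: "('o, 'a, 'x) cat_scheme \<Rightarrow> ('p, 'b, 'y) cat_scheme \<Rightarrow>
    (('o, 'a, 'p, 'b) func,
     ('o, 'a, 'p, 'b) func \<times> ('o, 'a, 'p, 'b) func \<times> ('o \<Rightarrow> 'b)) cat" where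
  "func_cat A B = \<lparr>Obj = {F. cat_functor A B F},
     Arr = {(F, G, \<eta>). nat_trans A B F G \<eta> \<and> \<eta> \<in> extensional (Obj A)},
     Dom = fst, Cod = fst \<circ> snd,
     Ident = (\<lambda>F. (F, F, \<lambda>X\<in>Obj A. Ident B (FO F X))),
     Comp = (\<lambda>(F', G', \<theta>) (F, G, \<eta>). (F, G', \<lambda>X\<in>Obj A. \<theta> X \<bullet>\<^bsub>B\<^esub> \<eta> X))\<rparr>"

text \<open>The category of sets with elements in the type \<open>'s\<close>; a map \<open>(A, B, f)\<close> carries its
  source and target.\<close>

definition set_cat :: "('s set, 's set \<times> 's set \<times> ('s \<Rightarrow> 's)) cat" where
  "set_cat = \<lparr>Obj = UNIV, Arr = {(A, B, f). f \<in> A \<rightarrow>\<^sub>E B},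
     Dom = fst, Cod = fst \<circ> snd, Ident = (\<lambda>A. (A, A, \<lambda>x\<in>A. x)),
     Comp = (\<lambda>(A', B', g) (A, B, f). (A, B', compose A g f))\<rparr>"

text \<open>The covariant functor \<open>Hom(X,-)\<close> and the presheaf \<open>Hom(-,X)\<close>.\<close>

definition hom_func :: "('o, 'a, 'x) cat_scheme \<Rightarrow> 'o \<Rightarrow>
    ('o, 'a, 'a set, 'a set \<times> 'a set \<times> ('a \<Rightarrow> 'a)) func" where
  "hom_func C X = \<lparr>FO = (\<lambda>Y. Hom C X Y),
     FA = (\<lambda>f. (Hom C X (Dom C f), Hom C X (Cod C f),
                \<lambda>g\<in>Hom C X (Dom C f). f \<bullet>\<^bsub>C\<^esub> g))\<rparr>"

definition hom_presheaf :: "('o, 'a, 'x) cat_scheme \<Rightarrow> 'o \<Rightarrow>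
    ('o, 'a, 'a set, 'a set \<times> 'a set \<times> ('a \<Rightarrow> 'a)) func" where
  "hom_presheaf C X = \<lparr>FO = (\<lambda>Y. Hom C Y X),
     FA = (\<lambda>f. (Hom C (Cod C f) X, Hom C (Dom C f) X,
                \<lambda>g\<in>Hom C (Cod C f) X. g \<bullet>\<^bsub>C\<^esub> f))\<rparr>"

section \<open>Small filtered colimits\<close>

text \<open>
  A type \<open>'u\<close> plays the role of the universe: a set of elements of \<open>'u\<close> is small if it has
  fewer elements than \<open>'u\<close>. All that is asked of \<open>'u\<close> is that its cardinality is infinite and
  regular; a Grothendieck universe is the case in which it is moreover uncountable and
  a strong limit. Index categories of diagrams have their objects and arrows in \<open>'u\<close>.
\<close>

definition universe :: "'u itself \<Rightarrow> bool" where
  "universe U \<longleftrightarrow> infinite (UNIV :: 'u set) \<and> regularCard |UNIV :: 'u set|"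

definition small :: "'u set \<Rightarrow> bool" where
  "small S \<longleftrightarrow> |S| <o |UNIV :: 'u set|"

definition small_cat :: "('u, 'u, 'x) cat_scheme \<Rightarrow> bool" where
  "small_cat I \<longleftrightarrow> category I \<and> small (Obj I) \<and> small (Arr I)"

definition filtered :: "('i, 'j, 'x) cat_scheme \<Rightarrow> bool" where
  "filtered I \<longleftrightarrow> category I \<and> Obj I \<noteq> {} \<and>
     (\<forall>i\<in>Obj I. \<forall>j\<in>Obj I. \<exists>k\<in>Obj I. Hom I i k \<noteq> {} \<and> Hom I j k \<noteq> {}) \<and>
     (\<forall>i\<in>Obj I. \<forall>j\<in>Obj I. \<forall>u\<in>Hom I i j. \<forall>v\<in>Hom I i j.
        \<exists>k\<in>Obj I. \<exists>w\<in>Hom I j k. w \<bullet>\<^bsub>I\<^esub> u = w \<bullet>\<^bsub>I\<^esub> v)"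

definition cocone :: "('i, 'j, 'y) cat_scheme \<Rightarrow> ('o, 'a, 'x) cat_scheme \<Rightarrow>
    ('i, 'j, 'o, 'a) func \<Rightarrow> 'o \<Rightarrow> ('i \<Rightarrow> 'a) \<Rightarrow> bool" where
  "cocone I C G L \<mu> \<longleftrightarrow> L \<in> Obj C \<and> (\<forall>i\<in>Obj I. \<mu> i \<in> Hom C (FO G i) L) \<and>
     (\<forall>u\<in>Arr I. \<mu> (Cod I u) \<bullet>\<^bsub>C\<^esub> FA G u = \<mu> (Dom I u))"

definition is_colimit :: "('i, 'j, 'y) cat_scheme \<Rightarrow> ('o, 'a, 'x) cat_scheme \<Rightarrow>
    ('i, 'j, 'o, 'a) func \<Rightarrow> 'o \<Rightarrow> ('i \<Rightarrow> 'a) \<Rightarrow> bool" where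
  "is_colimit I C G L \<mu> \<longleftrightarrow> cat_functor I C G \<and> cocone I C G L \<mu> \<and>
     (\<forall>M \<nu>. cocone I C G M \<nu> \<longrightarrow>
        (\<exists>!h. h \<in> Hom C L M \<and> (\<forall>i\<in>Obj I. h \<bullet>\<^bsub>C\<^esub> \<mu> i = \<nu> i)))"

definition preserves_filtered_colimits :: "'u itself \<Rightarrow> ('o, 'a, 'x) cat_scheme \<Rightarrow>
    ('p, 'b, 'y) cat_scheme \<Rightarrow> ('o, 'a, 'p, 'b) func \<Rightarrow> bool" where
  "preserves_filtered_colimits U C D F \<longleftrightarrow>
     (\<forall>(I :: ('u, 'u) cat) G L \<mu>. small_cat I \<longrightarrow> filtered I \<longrightarrow> is_colimit I C G L \<mu> \<longrightarrow>
        is_colimit I D (comp_func F G) (FO F L) (\<lambda>i. FA F (\<mu> i)))"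

definition compact_object :: "'u itself \<Rightarrow> ('o, 'a, 'x) cat_scheme \<Rightarrow> 'o \<Rightarrow> bool" where
  "compact_object U C X \<longleftrightarrow>
     X \<in> Obj C \<and> preserves_filtered_colimits U C set_cat (hom_func C X)"

section \<open>The ind-completion\<close>

text \<open>\<open>Ind(C)\<close> is the full subcategory of presheaves of sets on the small category \<open>C\<close> on the
  colimits of small filtered diagrams of representable presheaves.\<close>

type_synonym 'u presheaf = "('u, 'u, 'u set, 'u set \<times> 'u set \<times> ('u \<Rightarrow> 'u)) func"

type_synonym 'u presheaf_arr =
  "'u presheaf \<times> 'u presheaf \<times> ('u \<Rightarrow> 'u set \<times> 'u set \<times> ('u \<Rightarrow> 'u))"

definition psh_cat :: "('u, 'u, 'x) cat_scheme \<Rightarrow> ('u presheaf, 'u presheaf_arr) cat" where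
  "psh_cat C = func_cat (op_cat C) set_cat"

definition yoneda :: "('u, 'u, 'x) cat_scheme \<Rightarrow>
    ('u, 'u, 'u presheaf, 'u presheaf_arr) func" where
  "yoneda C = \<lparr>FO = hom_presheaf C,
     FA = (\<lambda>f. (hom_presheaf C (Dom C f), hom_presheaf C (Cod C f),
                \<lambda>Y\<in>Obj C. (Hom C Y (Dom C f), Hom C Y (Cod C f),
                            \<lambda>g\<in>Hom C Y (Dom C f). f \<bullet>\<^bsub>C\<^esub> g)))\<rparr>"

definition ind_cat :: "('u, 'u, 'x) cat_scheme \<Rightarrow> ('u presheaf, 'u presheaf_arr) cat" where
  "ind_cat C = full_subcat (psh_cat C)
     {P. \<exists>(I :: ('u, 'u) cat) G \<mu>. small_cat I \<and> filtered I \<and> cat_functor I C G \<and>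
           is_colimit I (psh_cat C) (comp_func (yoneda C) G) P \<mu>}"

section \<open>Additive categories\<close>

record ('o, 'a) ab_cat = "('o, 'a) cat" +
  Zero :: "'o \<Rightarrow> 'o \<Rightarrow> 'a"
  Plus :: "'a \<Rightarrow> 'a \<Rightarrow> 'a"

text \<open>The addition of arrows appears as the multiplication of this group, so differences are
  products with \<open>inv\<close> and integer multiples are powers.\<close>

definition hom_group :: "('o, 'a, 'x) ab_cat_scheme \<Rightarrow> 'o \<Rightarrow> 'o \<Rightarrow> 'a monoid" where
  "hom_group C X Y =
     \<lparr>carrier = Hom C X Y, monoid.mult = Plus C, one = Zero C X Y\<rparr>"

definition arr_minus :: "('o, 'a, 'x) ab_cat_scheme \<Rightarrow> 'o \<Rightarrow> 'o \<Rightarrow> 'a \<Rightarrow> 'a \<Rightarrow> 'a" where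
  "arr_minus C X Y f g = f \<otimes>\<^bsub>hom_group C X Y\<^esub> (inv\<^bsub>hom_group C X Y\<^esub> g)"

definition arr_scale :: "('o, 'a, 'x) ab_cat_scheme \<Rightarrow> 'o \<Rightarrow> 'o \<Rightarrow> int \<Rightarrow> 'a \<Rightarrow> 'a" where
  "arr_scale C X Y k f = f [^]\<^bsub>hom_group C X Y\<^esub> k"

locale preadditive_category = category C
  for C :: "('o, 'a, 'x) ab_cat_scheme" (structure) +
  assumes hom_comm_group: "X \<in> Obj C \<Longrightarrow> Y \<in> Obj C \<Longrightarrow> comm_group (hom_group C X Y)"
    and Comp_Plus_right: "f \<in> Hom C X Y \<Longrightarrow> g \<in> Hom C X Y \<Longrightarrow> h \<in> Hom C Y Z \<Longrightarrow>
          h \<bullet> Plus C f g = Plus C (h \<bullet> f) (h \<bullet> g)"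
    and Comp_Plus_left: "f \<in> Hom C W X \<Longrightarrow> g \<in> Hom C X Y \<Longrightarrow> h \<in> Hom C X Y \<Longrightarrow>
          Plus C g h \<bullet> f = Plus C (g \<bullet> f) (h \<bullet> f)"

definition zero_object :: "('o, 'a, 'x) cat_scheme \<Rightarrow> 'o \<Rightarrow> bool" where
  "zero_object C Z \<longleftrightarrow> Z \<in> Obj C \<and>
     (\<forall>X\<in>Obj C. (\<exists>!f. f \<in> Hom C X Z) \<and> (\<exists>!f. f \<in> Hom C Z X))"

definition biproduct :: "('o, 'a, 'x) ab_cat_scheme \<Rightarrow> 'o \<Rightarrow> 'o \<Rightarrow> 'o \<Rightarrow> bool" where
  "biproduct C X Y P \<longleftrightarrow> P \<in> Obj C \<and>
     (\<exists>i\<in>Hom C X P. \<exists>j\<in>Hom C Y P. \<exists>p\<in>Hom C P X. \<exists>q\<in>Hom C P Y.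
        p \<bullet>\<^bsub>C\<^esub> i = Ident C X \<and> q \<bullet>\<^bsub>C\<^esub> j = Ident C Y \<and>
        q \<bullet>\<^bsub>C\<^esub> i = Zero C X Y \<and> p \<bullet>\<^bsub>C\<^esub> j = Zero C Y X \<and>
        Plus C (i \<bullet>\<^bsub>C\<^esub> p) (j \<bullet>\<^bsub>C\<^esub> q) = Ident C P)"

definition additive_category :: "('o, 'a, 'x) ab_cat_scheme \<Rightarrow> bool" where
  "additive_category C \<longleftrightarrow> preadditive_category C \<and> (\<exists>Z. zero_object C Z) \<and>
     (\<forall>X\<in>Obj C. \<forall>Y\<in>Obj C. \<exists>P. biproduct C X Y P)"

definition karoubian :: "('o, 'a, 'x) cat_scheme \<Rightarrow> bool" where
  "karoubian C \<longleftrightarrow> (\<forall>X\<in>Obj C. \<forall>e\<in>Hom C X X. e \<bullet>\<^bsub>C\<^esub> e = e \<longrightarrow>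
     (\<exists>Y\<in>Obj C. \<exists>r\<in>Hom C X Y. \<exists>s\<in>Hom C Y X.
        s \<bullet>\<^bsub>C\<^esub> r = e \<and> r \<bullet>\<^bsub>C\<^esub> s = Ident C Y))"

text \<open>Additivity does not follow from being lax monoidal and preserving filtered colimits: the
  constant functor at a commutative algebra has both properties.\<close>

definition additive_functor :: "('o, 'a, 'x) ab_cat_scheme \<Rightarrow> ('p, 'b, 'y) ab_cat_scheme \<Rightarrow>
    ('o, 'a, 'p, 'b) func \<Rightarrow> bool" where
  "additive_functor C D F \<longleftrightarrow> cat_functor C D F \<and>
     (\<forall>X\<in>Obj C. \<forall>Y\<in>Obj C. \<forall>f\<in>Hom C X Y. \<forall>g\<in>Hom C X Y.
        FA F (Plus C f g) = Plus D (FA F f) (FA F g))"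

definition end_ring :: "('o, 'a, 'x) ab_cat_scheme \<Rightarrow> 'o \<Rightarrow> 'a ring" where
  "end_ring C X = \<lparr>carrier = Hom C X X, monoid.mult = Comp C, one = Ident C X,
     zero = Zero C X X, add = Plus C\<rparr>"

definition rat_ring :: "rat ring" where
  "rat_ring = \<lparr>carrier = UNIV, monoid.mult = (*), one = 1, zero = 0, add = (+)\<rparr>"

section \<open>Symmetric monoidal categories\<close>

record ('o, 'a) mon_cat = "('o, 'a) ab_cat" +
  Unit :: 'o  ("\<one>\<^sub>o\<index>")
  TenO :: "'o \<Rightarrow> 'o \<Rightarrow> 'o"  (infixl "\<odot>\<index>" 75)
  TenA :: "'a \<Rightarrow> 'a \<Rightarrow> 'a"  (infixl "\<star>\<index>" 75)
  Assoc :: "'o \<Rightarrow> 'o \<Rightarrow> 'o \<Rightarrow> 'a"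
  LUnit :: "'o \<Rightarrow> 'a"
  RUnit :: "'o \<Rightarrow> 'a"
  Braid :: "'o \<Rightarrow> 'o \<Rightarrow> 'a"

text \<open>\<open>\<odot>\<close> is the tensor product of objects and \<open>\<star>\<close> that of arrows; no compatibility with
  \<open>Plus\<close> is required here.\<close>

locale symmetric_monoidal_category = category C
  for C :: "('o, 'a, 'x) mon_cat_scheme" (structure) +
  assumes Unit_Obj: "\<one>\<^sub>o \<in> Obj C"
    and TenO_Obj: "X \<in> Obj C \<Longrightarrow> Y \<in> Obj C \<Longrightarrow> X \<odot> Y \<in> Obj C"
    and TenA_Hom: "f \<in> Hom C X X' \<Longrightarrow> g \<in> Hom C Y Y' \<Longrightarrow> f \<star> g \<in> Hom C (X \<odot> Y) (X' \<odot> Y')"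
    and TenA_Ident: "X \<in> Obj C \<Longrightarrow> Y \<in> Obj C \<Longrightarrow>
          Ident C X \<star> Ident C Y = Ident C (X \<odot> Y)"
    and TenA_Comp: "f \<in> Hom C X X' \<Longrightarrow> f' \<in> Hom C X' X'' \<Longrightarrow>
          g \<in> Hom C Y Y' \<Longrightarrow> g' \<in> Hom C Y' Y'' \<Longrightarrow>
          (f' \<bullet> f) \<star> (g' \<bullet> g) = (f' \<star> g') \<bullet> (f \<star> g)"
    and Assoc_Hom: "X \<in> Obj C \<Longrightarrow> Y \<in> Obj C \<Longrightarrow> Z \<in> Obj C \<Longrightarrow>
          Assoc C X Y Z \<in> Hom C ((X \<odot> Y) \<odot> Z) (X \<odot> (Y \<odot> Z)) \<and> iso_arrow C (Assoc C X Y Z)"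
    and Assoc_natural: "f \<in> Hom C X X' \<Longrightarrow> g \<in> Hom C Y Y' \<Longrightarrow> h \<in> Hom C Z Z' \<Longrightarrow>
          Assoc C X' Y' Z' \<bullet> ((f \<star> g) \<star> h) = (f \<star> (g \<star> h)) \<bullet> Assoc C X Y Z"
    and LUnit_Hom: "X \<in> Obj C \<Longrightarrow> LUnit C X \<in> Hom C (\<one>\<^sub>o \<odot> X) X \<and> iso_arrow C (LUnit C X)"
    and LUnit_natural: "f \<in> Hom C X X' \<Longrightarrow>
          LUnit C X' \<bullet> (Ident C \<one>\<^sub>o \<star> f) = f \<bullet> LUnit C X"
    and RUnit_Hom: "X \<in> Obj C \<Longrightarrow> RUnit C X \<in> Hom C (X \<odot> \<one>\<^sub>o) X \<and> iso_arrow C (RUnit C X)"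
    and RUnit_natural: "f \<in> Hom C X X' \<Longrightarrow>
          RUnit C X' \<bullet> (f \<star> Ident C \<one>\<^sub>o) = f \<bullet> RUnit C X"
    and Braid_Hom: "X \<in> Obj C \<Longrightarrow> Y \<in> Obj C \<Longrightarrow> Braid C X Y \<in> Hom C (X \<odot> Y) (Y \<odot> X)"
    and Braid_natural: "f \<in> Hom C X X' \<Longrightarrow> g \<in> Hom C Y Y' \<Longrightarrow>
          Braid C X' Y' \<bullet> (f \<star> g) = (g \<star> f) \<bullet> Braid C X Y"
    and pentagon: "W \<in> Obj C \<Longrightarrow> X \<in> Obj C \<Longrightarrow> Y \<in> Obj C \<Longrightarrow> Z \<in> Obj C \<Longrightarrow>
          Assoc C W X (Y \<odot> Z) \<bullet> Assoc C (W \<odot> X) Y Z =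
          (Ident C W \<star> Assoc C X Y Z) \<bullet> Assoc C W (X \<odot> Y) Z \<bullet> (Assoc C W X Y \<star> Ident C Z)"
    and triangle: "X \<in> Obj C \<Longrightarrow> Y \<in> Obj C \<Longrightarrow>
          (Ident C X \<star> LUnit C Y) \<bullet> Assoc C X \<one>\<^sub>o Y = RUnit C X \<star> Ident C Y"
    and hexagon: "X \<in> Obj C \<Longrightarrow> Y \<in> Obj C \<Longrightarrow> Z \<in> Obj C \<Longrightarrow>
          (Ident C Y \<star> Braid C X Z) \<bullet> Assoc C Y X Z \<bullet> (Braid C X Y \<star> Ident C Z) =
          Assoc C Y Z X \<bullet> Braid C X (Y \<odot> Z) \<bullet> Assoc C X Y Z"
    and Braid_symmetric: "X \<in> Obj C \<Longrightarrow> Y \<in> Obj C \<Longrightarrow>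
          Braid C Y X \<bullet> Braid C X Y = Ident C (X \<odot> Y)"

definition dual_object :: "('o, 'a, 'x) mon_cat_scheme \<Rightarrow> 'o \<Rightarrow> 'o \<Rightarrow> bool" where
  "dual_object C X X' \<longleftrightarrow> X' \<in> Obj C \<and>
     (\<exists>ev \<in> Hom C (X' \<odot>\<^bsub>C\<^esub> X) \<one>\<^sub>o\<^bsub>C\<^esub>. \<exists>coev \<in> Hom C \<one>\<^sub>o\<^bsub>C\<^esub> (X \<odot>\<^bsub>C\<^esub> X'). \<exists>a.
        inverse_arrows C (Assoc C X' X X') a \<and>
        RUnit C X \<bullet>\<^bsub>C\<^esub> (Ident C X \<star>\<^bsub>C\<^esub> ev) \<bullet>\<^bsub>C\<^esub> Assoc C X X' X \<bullet>\<^bsub>C\<^esub> (coev \<star>\<^bsub>C\<^esub> Ident C X)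
          = LUnit C X \<and>
        LUnit C X' \<bullet>\<^bsub>C\<^esub> (ev \<star>\<^bsub>C\<^esub> Ident C X') \<bullet>\<^bsub>C\<^esub> a \<bullet>\<^bsub>C\<^esub> (Ident C X' \<star>\<^bsub>C\<^esub> coev)
          = RUnit C X')"

definition rigid :: "('o, 'a, 'x) mon_cat_scheme \<Rightarrow> bool" where
  "rigid C \<longleftrightarrow> (\<forall>X\<in>Obj C. \<exists>X'. dual_object C X X')"

locale lax_symmetric_monoidal_functor =
  C: symmetric_monoidal_category C + D: symmetric_monoidal_category D + cat_functor C D F
  for C :: "('o, 'a, 'x) mon_cat_scheme" and D :: "('p, 'b, 'y) mon_cat_scheme"
    and F :: "('o, 'a, 'p, 'b) func" +
  fixes J :: "'o \<Rightarrow> 'o \<Rightarrow> 'b" and e :: 'b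
  assumes e_Hom: "e \<in> Hom D \<one>\<^sub>o\<^bsub>D\<^esub> (FO F \<one>\<^sub>o\<^bsub>C\<^esub>)"
    and J_Hom: "X \<in> Obj C \<Longrightarrow> Y \<in> Obj C \<Longrightarrow>
          J X Y \<in> Hom D (FO F X \<odot>\<^bsub>D\<^esub> FO F Y) (FO F (X \<odot>\<^bsub>C\<^esub> Y))"
    and J_natural: "f \<in> Hom C X X' \<Longrightarrow> g \<in> Hom C Y Y' \<Longrightarrow>
          J X' Y' \<bullet>\<^bsub>D\<^esub> (FA F f \<star>\<^bsub>D\<^esub> FA F g) = FA F (f \<star>\<^bsub>C\<^esub> g) \<bullet>\<^bsub>D\<^esub> J X Y"
    and J_assoc: "X \<in> Obj C \<Longrightarrow> Y \<in> Obj C \<Longrightarrow> Z \<in> Obj C \<Longrightarrow>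
          FA F (Assoc C X Y Z) \<bullet>\<^bsub>D\<^esub> J (X \<odot>\<^bsub>C\<^esub> Y) Z \<bullet>\<^bsub>D\<^esub> (J X Y \<star>\<^bsub>D\<^esub> Ident D (FO F Z)) =
          J X (Y \<odot>\<^bsub>C\<^esub> Z) \<bullet>\<^bsub>D\<^esub> (Ident D (FO F X) \<star>\<^bsub>D\<^esub> J Y Z)
            \<bullet>\<^bsub>D\<^esub> Assoc D (FO F X) (FO F Y) (FO F Z)"
    and J_lunit: "X \<in> Obj C \<Longrightarrow>
          FA F (LUnit C X) \<bullet>\<^bsub>D\<^esub> J \<one>\<^sub>o\<^bsub>C\<^esub> X \<bullet>\<^bsub>D\<^esub> (e \<star>\<^bsub>D\<^esub> Ident D (FO F X)) = LUnit D (FO F X)"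
    and J_runit: "X \<in> Obj C \<Longrightarrow>
          FA F (RUnit C X) \<bullet>\<^bsub>D\<^esub> J X \<one>\<^sub>o\<^bsub>C\<^esub> \<bullet>\<^bsub>D\<^esub> (Ident D (FO F X) \<star>\<^bsub>D\<^esub> e) = RUnit D (FO F X)"
    and J_braid: "X \<in> Obj C \<Longrightarrow> Y \<in> Obj C \<Longrightarrow>
          FA F (Braid C X Y) \<bullet>\<^bsub>D\<^esub> J X Y = J Y X \<bullet>\<^bsub>D\<^esub> Braid D (FO F X) (FO F Y)"

definition strong_symmetric_monoidal_functor :: "('o, 'a, 'x) mon_cat_scheme \<Rightarrow>
    ('p, 'b, 'y) mon_cat_scheme \<Rightarrow> ('o, 'a, 'p, 'b) func \<Rightarrow> ('o \<Rightarrow> 'o \<Rightarrow> 'b) \<Rightarrow> 'b \<Rightarrow> bool"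
  where
  "strong_symmetric_monoidal_functor C D F J e \<longleftrightarrow>
     lax_symmetric_monoidal_functor C D F J e \<and> iso_arrow D e \<and>
     (\<forall>X\<in>Obj C. \<forall>Y\<in>Obj C. iso_arrow D (J X Y))"

definition tensor_func :: "('o, 'a, 'x) mon_cat_scheme \<Rightarrow> ('i, 'j, 'o, 'a) func \<Rightarrow>
    ('k, 'l, 'o, 'a) func \<Rightarrow> ('i \<times> 'k, 'j \<times> 'l, 'o, 'a) func" where
  "tensor_func C G H = \<lparr>FO = (\<lambda>(i, k). FO G i \<odot>\<^bsub>C\<^esub> FO H k),
     FA = (\<lambda>(u, v). FA G u \<star>\<^bsub>C\<^esub> FA H v)\<rparr>"

definition tensor_preserves_filtered_colimits ::
    "'u itself \<Rightarrow> ('o, 'a, 'x) mon_cat_scheme \<Rightarrow> bool" where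
  "tensor_preserves_filtered_colimits U C \<longleftrightarrow>
     (\<forall>(I :: ('u, 'u) cat) (K :: ('u, 'u) cat) G H L M \<mu> \<nu>.
        small_cat I \<longrightarrow> filtered I \<longrightarrow> small_cat K \<longrightarrow> filtered K \<longrightarrow>
        is_colimit I C G L \<mu> \<longrightarrow> is_colimit K C H M \<nu> \<longrightarrow>
        is_colimit (prod_cat I K) C (tensor_func C G H) (L \<odot>\<^bsub>C\<^esub> M) (\<lambda>(i, k). \<mu> i \<star>\<^bsub>C\<^esub> \<nu> k))"

text \<open>
  The standing assumptions on \<open>C\<close>, presented as the ind-completion of \<open>C0\<close>. That the tensor
  product of \<open>C\<close> is the one extended from \<open>C0\<close> means that the embedding of \<open>C0\<close> into \<open>C\<close> is
  symmetric monoidal and that the tensor product of \<open>C\<close> commutes with filtered colimits.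
  The addition of arrows of \<open>C\<close> is no additional datum: \<open>C\<close> has finite biproducts
  because \<open>C0\<close> has, and these determine it.
\<close>

definition standing_assumptions :: "('o, 'a, 'x) mon_cat_scheme \<Rightarrow>
    ('u, 'u, 'y) mon_cat_scheme \<Rightarrow> bool" where
  "standing_assumptions C C0 \<longleftrightarrow>
     symmetric_monoidal_category C \<and> preadditive_category C \<and>
     symmetric_monoidal_category C0 \<and> small_cat C0 \<and>
     (\<exists>E J e. equivalence_functor (ind_cat C0) C E \<and>
        strong_symmetric_monoidal_functor C0 C (comp_func E (yoneda C0)) J e) \<and>
     tensor_preserves_filtered_colimits TYPE('u) C \<and>
     additive_category C0 \<and> karoubian C0 \<and> rigid C0 \<and>
     (\<exists>h. h \<in> ring_hom rat_ring (end_ring C \<one>\<^sub>o\<^bsub>C\<^esub>) \<and> inj h)"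

section \<open>Vertex algebras\<close>

text \<open>
  A formal distribution in \<open>z\<close> is the family of its coefficients, \<open>f k\<close> being the coefficient
  of \<open>z\<^sup>k\<close>; in a distribution in \<open>z, w\<close>, \<open>f i j\<close> is the coefficient of \<open>z\<^sup>i w\<^sup>j\<close>.
\<close>

definition vertex_series :: "(int \<Rightarrow> 'a) \<Rightarrow> int \<Rightarrow> 'a" where
  "vertex_series m k = m (- k - 1)"

definition formal_deriv :: "('o, 'a, 'x) ab_cat_scheme \<Rightarrow> 'o \<Rightarrow> 'o \<Rightarrow>
    (int \<Rightarrow> 'a) \<Rightarrow> int \<Rightarrow> 'a" where
  "formal_deriv C X Y f k = arr_scale C X Y (k + 1) (f (k + 1))"

definition mult_z_minus_w :: "('o, 'a, 'x) ab_cat_scheme \<Rightarrow> 'o \<Rightarrow> 'o \<Rightarrow>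
    (int \<Rightarrow> int \<Rightarrow> 'a) \<Rightarrow> int \<Rightarrow> int \<Rightarrow> 'a" where
  "mult_z_minus_w C X Y f i j = arr_minus C X Y (f (i - 1) j) (f i (j - 1))"

text \<open>
  The two terms of the locality axiom, with the suppressed associator
  \<open>(V \<odot> V) \<odot> V \<rightarrow> V \<odot> (V \<odot> V)\<close> written out.
\<close>

definition locality_commutator :: "('o, 'a, 'x) mon_cat_scheme \<Rightarrow> 'o \<Rightarrow> (int \<Rightarrow> 'a) \<Rightarrow>
    'o \<Rightarrow> 'o \<Rightarrow> 'a \<Rightarrow> 'a \<Rightarrow> int \<Rightarrow> int \<Rightarrow> 'a" where
  "locality_commutator C V m X X' \<alpha> \<beta> i j =
     (let Y = vertex_series m;
          \<gamma> = (\<alpha> \<star>\<^bsub>C\<^esub> \<beta>) \<star>\<^bsub>C\<^esub> Ident C V in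
      arr_minus C ((X \<odot>\<^bsub>C\<^esub> X') \<odot>\<^bsub>C\<^esub> V) V
        (Y j \<bullet>\<^bsub>C\<^esub> (Ident C V \<star>\<^bsub>C\<^esub> Y i) \<bullet>\<^bsub>C\<^esub> Assoc C V V V \<bullet>\<^bsub>C\<^esub> \<gamma>)
        (Y i \<bullet>\<^bsub>C\<^esub> (Ident C V \<star>\<^bsub>C\<^esub> Y j) \<bullet>\<^bsub>C\<^esub> Assoc C V V V
           \<bullet>\<^bsub>C\<^esub> (Braid C V V \<star>\<^bsub>C\<^esub> Ident C V) \<bullet>\<^bsub>C\<^esub> \<gamma>))"

text \<open>The exponent \<open>K\<close> in locality is a natural number: the product of a negative power of
  \<open>z - w\<close> with a distribution that is infinite in all directions is not defined.\<close>

locale vertex_algebra =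
  fixes U :: "'u itself" and C :: "('o, 'a, 'x) mon_cat_scheme" (structure)
    and V :: 'o and vac :: 'a and T :: 'a and m :: "int \<Rightarrow> 'a"
  assumes V_Obj: "V \<in> Obj C"
    and vac_Hom: "vac \<in> Hom C \<one>\<^sub>o V"
    and T_Hom: "T \<in> Hom C V V"
    and m_Hom: "m n \<in> Hom C (V \<odot> V) V"
    and truncation: "compact_object U C X \<Longrightarrow> compact_object U C X' \<Longrightarrow>
          \<alpha> \<in> Hom C X V \<Longrightarrow> \<beta> \<in> Hom C X' V \<Longrightarrow>
          \<exists>K. \<forall>n\<ge>K. m n \<bullet> (\<alpha> \<star> \<beta>) = Zero C (X \<odot> X') V"
    and vacuum_left: "vertex_series m k \<bullet> (vac \<star> Ident C V) =
          (if k = 0 then LUnit C V else Zero C (\<one>\<^sub>o \<odot> V) V)"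
    and vacuum_right: "k < 0 \<Longrightarrow>
          vertex_series m k \<bullet> (Ident C V \<star> vac) = Zero C (V \<odot> \<one>\<^sub>o) V"
    and vacuum_right_0: "vertex_series m 0 \<bullet> (Ident C V \<star> vac) = RUnit C V"
    and translation_vac: "T \<bullet> vac = Zero C \<one>\<^sub>o V"
    and translation: "arr_minus C (V \<odot> V) V
            (T \<bullet> vertex_series m k) (vertex_series m k \<bullet> (Ident C V \<star> T)) =
          formal_deriv C (V \<odot> V) V (vertex_series m) k"
    and locality: "compact_object U C X \<Longrightarrow> compact_object U C X' \<Longrightarrow>
          \<alpha> \<in> Hom C X V \<Longrightarrow> \<beta> \<in> Hom C X' V \<Longrightarrow>
          \<exists>K. \<forall>i j.
            (mult_z_minus_w C ((X \<odot> X') \<odot> V) V ^^ K) (locality_commutator C V m X X' \<alpha> \<beta>) i j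
            = Zero C ((X \<odot> X') \<odot> V) V"

end

theory Submission
  imports Defs
begin

text \<open>
  Truncation and locality are tested on arrows from compact objects, and an arrow from a compact
  object of \<open>D\<close> to \<open>F V\<close> need not come from \<open>C\<close>. But \<open>V\<close> is a filtered colimit of
  compact objects, namely of representables in the ind-completion, and \<open>F\<close> preserves this colimit;
  so such an arrow factors as \<open>F(a) \<circ> \<alpha>'\<close> with \<open>a : X \<rightarrow> V\<close> and \<open>X\<close> compact. By the
  naturality and coherence of \<open>J\<close>, each expression in an axiom for \<open>F V\<close> is then \<open>F\<close> of the
  corresponding expression for \<open>V\<close> composed with a fixed arrow, and this operation is additive.

  That representables are compact in the ind-completion comes down to closure of the ind-completion
  under filtered colimits of presheaves. An ind-object is a presheaf with small values whose category
  of elements is filtered, and both properties pass to small filtered colimits.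
\<close>

section \<open>Categories, functors and colimits\<close>

text \<open>Compactness is defined by colimits in \<open>set_cat\<close>, but the argument crosses
  three categories: the presheaves, the ind-completion inside them, and \<open>C\<close>, which is
  merely equivalent to it. The working form is therefore \<open>hom_colimit\<close>, which speaks
  only of arrows and composition and so passes through full subcategories, isomorphisms of colimits
  and equivalences; \<open>compact_objectI\<close> leads back to the definition. A colimit formed in
  a full subcategory need not be one in the ambient category. Here it is one because the colimit of
  presheaves is again an ind-object and colimits are unique up to isomorphism. Proving this closure
  from diagrams would require a coherent choice of diagrams for all stages; conditions on the
  category of elements require no choice. Size also shapes the constructions. Values of presheaves
  are subsets of \<open>'u\<close>, so a quotient has to be coded inside \<open>'u\<close>; index
  categories have type \<open>('u, 'u) cat\<close>, so the category of elements has to be copied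
  into that type. Elements of a presheaf are mostly handled as arrows out of representables.\<close>

lemma Arr_Hom: "f \<in> Arr C \<Longrightarrow> f \<in> Hom C (Dom C f) (Cod C f)"
  by (simp add: Hom_def)

context category
begin

lemma Hom_Obj:
  assumes "f \<in> Hom C X Y"
  shows "X \<in> Obj C" "Y \<in> Obj C"
  using assms Dom_Obj Cod_Obj by (auto simp: Hom_def)

text \<open>In the \<open>Hom\<close> rules of the locale the middle objects occur only in the
  premises, so the simplifier cannot guess them. With \<open>Dom\<close> and \<open>Cod\<close> the
  side conditions become equations that it can evaluate. Associativity is turned to the right, as
  \<open>\<bullet>\<close> is parsed.\<close>

lemma Comp_seq:
  assumes "f \<in> Arr C" "g \<in> Arr C" "Dom C g = Cod C f"
  shows "g \<bullet> f \<in> Arr C" "Dom C (g \<bullet> f) = Dom C f" "Cod C (g \<bullet> f) = Cod C g"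
  using assms Comp_Hom[of f "Dom C f" "Cod C f" g "Cod C g"] by (auto simp: Hom_def)

lemma Comp_assoc_seq:
  assumes "f \<in> Arr C" "g \<in> Arr C" "h \<in> Arr C" "Dom C g = Cod C f" "Dom C h = Cod C g"
  shows "(h \<bullet> g) \<bullet> f = h \<bullet> (g \<bullet> f)"
  using assms Comp_assoc[of f "Dom C f" "Cod C f" g "Cod C g" h "Cod C h"]
  by (auto simp: Hom_def)

lemma Ident_seq:
  assumes "X \<in> Obj C"
  shows "Ident C X \<in> Arr C" "Dom C (Ident C X) = X" "Cod C (Ident C X) = X"
  using Ident_Hom[OF assms] by (auto simp: Hom_def)

lemma Ident_Comp_seq:
  assumes "f \<in> Arr C"
  shows "Cod C f = X \<Longrightarrow> Ident C X \<bullet> f = f" "Dom C f = X \<Longrightarrow> f \<bullet> Ident C X = f"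
  using assms Ident_left[of f _ X] Ident_right[of f X] by (auto simp: Hom_def)

lemmas seq_simps = Comp_seq Comp_assoc_seq Ident_seq Ident_Comp_seq Dom_Obj Cod_Obj

lemma inverse_arrowsD:
  assumes "inverse_arrows C f g" "f \<in> Hom C X Y"
  shows "g \<in> Hom C Y X" "g \<bullet> f = Ident C X" "f \<bullet> g = Ident C Y"
  using assms by (auto simp: inverse_arrows_def Hom_def)

lemma inverse_arrowsI:
  assumes "f \<in> Hom C X Y" "g \<in> Hom C Y X" "g \<bullet> f = Ident C X" "f \<bullet> g = Ident C Y"
  shows "inverse_arrows C f g"
  using assms by (auto simp: inverse_arrows_def Hom_def)

lemma comp_cancel_right:
  assumes "f \<bullet> e = g \<bullet> e" "e \<bullet> e' = Ident C X"
    and "e' \<in> Hom C X W" "e \<in> Hom C W X" "f \<in> Hom C X Y" "g \<in> Hom C X Y"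
  shows "f = g"
proof -
  have "f = f \<bullet> (e \<bullet> e')" using assms by (auto simp: Hom_def seq_simps)
  also have "\<dots> = (f \<bullet> e) \<bullet> e'" using assms(3-) by (auto simp: Hom_def seq_simps)
  also have "\<dots> = (g \<bullet> e) \<bullet> e'" using assms(1) by simp
  also have "\<dots> = g \<bullet> (e \<bullet> e')" using assms(3-) by (auto simp: Hom_def seq_simps)
  also have "\<dots> = g" using assms by (auto simp: Hom_def seq_simps)
  finally show ?thesis .
qed

lemma comp_cancel_left:
  assumes "e \<bullet> f = e \<bullet> g" "e' \<bullet> e = Ident C X"
    and "e' \<in> Hom C W X" "e \<in> Hom C X W" "f \<in> Hom C Y X" "g \<in> Hom C Y X"
  shows "f = g"
proof -
  have "f = (e' \<bullet> e) \<bullet> f" using assms(2-) by (auto simp: Hom_def Ident_Comp_seq)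
  also have "\<dots> = e' \<bullet> (e \<bullet> f)" using assms(3-) by (auto simp: Hom_def seq_simps)
  also have "\<dots> = e' \<bullet> (e \<bullet> g)" using assms(1) by simp
  also have "\<dots> = (e' \<bullet> e) \<bullet> g" using assms(3-) by (auto simp: Hom_def seq_simps)
  also have "\<dots> = g" using assms(2-) by (auto simp: Hom_def Ident_Comp_seq)
  finally show ?thesis .
qed

end

context cat_functor
begin

lemma FA_seq:
  assumes "f \<in> Arr A"
  shows "FA F f \<in> Arr B" "Dom B (FA F f) = FO F (Dom A f)" "Cod B (FA F f) = FO F (Cod A f)"
  using assms FA_Hom[of f "Dom A f" "Cod A f"] by (auto simp: Hom_def)

lemma FA_Comp_seq:
  assumes "f \<in> Arr A" "g \<in> Arr A" "Dom A g = Cod A f"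
  shows "FA F (g \<bullet>\<^bsub>A\<^esub> f) = FA F g \<bullet>\<^bsub>B\<^esub> FA F f"
  using assms FA_Comp[of f "Dom A f" "Cod A f" g "Cod A g"] by (auto simp: Hom_def)

lemmas functor_simps = FA_seq FA_Comp_seq FO_Obj FA_Ident

end

lemma cat_functor_comp:
  assumes "cat_functor A B F" "cat_functor B C G"
  shows "cat_functor A C (comp_func G F)"
proof -
  interpret F: cat_functor A B F by fact
  interpret G: cat_functor B C G by fact
  show ?thesis
    by unfold_locales
      (auto simp: comp_func_def F.FO_Obj G.FO_Obj F.FA_Ident G.FA_Ident
        F.FA_Comp G.FA_Comp[OF F.FA_Hom F.FA_Hom] intro: F.FA_Hom G.FA_Hom)
qed

lemma comp_func_simps [simp]:
  "FO (comp_func G F) X = FO G (FO F X)" "FA (comp_func G F) f = FA G (FA F f)"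
  by (simp_all add: comp_func_def)

lemma comp_func_assoc: "comp_func H (comp_func G F) = comp_func (comp_func H G) F"
  by (simp add: comp_func_def comp_assoc)

lemma cocone_image:
  assumes "cocone I A G L \<mu>" "cat_functor I A G" "cat_functor A B F"
  shows "cocone I B (comp_func F G) (FO F L) (\<lambda>i. FA F (\<mu> i))"
proof -
  interpret G: cat_functor I A G by fact
  interpret F: cat_functor A B F by fact
  show ?thesis
    unfolding cocone_def
  proof (intro conjI ballI)
    show "FO F L \<in> Obj B" using assms(1) by (simp add: cocone_def F.FO_Obj)
    show "FA F (\<mu> i) \<in> Hom B (FO (comp_func F G) i) (FO F L)" if "i \<in> Obj I" for i
      using assms(1) that F.FA_Hom by (auto simp: cocone_def)
    fix u assume u: "u \<in> Arr I"
    have "\<mu> (Cod I u) \<in> Hom A (FO G (Cod I u)) L" "\<mu> (Cod I u) \<bullet>\<^bsub>A\<^esub> FA G u = \<mu> (Dom I u)"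
      using assms(1) u by (simp_all add: cocone_def G.A.Cod_Obj)
    then show "FA F (\<mu> (Cod I u)) \<bullet>\<^bsub>B\<^esub> FA (comp_func F G) u = FA F (\<mu> (Dom I u))"
      using F.FA_Comp[OF G.FA_Hom[OF Arr_Hom[OF u]]] by simp metis
  qed
qed

context category
begin

lemma cocone_postcomp:
  assumes "cat_functor I C G" "cocone I C G L \<mu>" "h \<in> Hom C L M"
  shows "cocone I C G M (\<lambda>i. h \<bullet> \<mu> i)"
proof -
  interpret G: cat_functor I C G by fact
  show ?thesis
    unfolding cocone_def
  proof (intro conjI ballI)
    show "M \<in> Obj C" using assms(3) Hom_Obj by blast
    show "h \<bullet> \<mu> i \<in> Hom C (FO G i) M" if "i \<in> Obj I" for i
      using that assms by (auto simp: cocone_def intro: Comp_Hom)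
    fix u assume u: "u \<in> Arr I"
    have "\<mu> (Cod I u) \<in> Hom C (FO G (Cod I u)) L"
      using assms(2) u by (simp add: cocone_def G.A.Cod_Obj)
    then have "(h \<bullet> \<mu> (Cod I u)) \<bullet> FA G u = h \<bullet> (\<mu> (Cod I u) \<bullet> FA G u)"
      using u assms(3) by (auto simp: Hom_def seq_simps G.functor_simps)
    then show "(h \<bullet> \<mu> (Cod I u)) \<bullet> FA G u = h \<bullet> \<mu> (Dom I u)"
      using assms(2) u by (simp add: cocone_def)
  qed
qed

lemma is_colimitD:
  assumes "is_colimit I C G L \<mu>"
  shows "cat_functor I C G" "cocone I C G L \<mu>" "L \<in> Obj C" "i \<in> Obj I \<Longrightarrow> \<mu> i \<in> Hom C (FO G i) L"
    "u \<in> Hom I i j \<Longrightarrow> \<mu> j \<bullet> FA G u = \<mu> i"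
  using assms by (auto simp: is_colimit_def cocone_def Hom_def)

text \<open>Both arrows mediate to the single cocone \<open>\<lambda>i. h \<bullet> \<mu> i\<close>,
  and the mediating arrow is unique.\<close>

lemma is_colimit_eq:
  assumes "is_colimit I C G L \<mu>" "h \<in> Hom C L M" "h' \<in> Hom C L M"
    and "\<And>i. i \<in> Obj I \<Longrightarrow> h \<bullet> \<mu> i = h' \<bullet> \<mu> i"
  shows "h = h'"
proof -
  have "cocone I C G M (\<lambda>i. h \<bullet> \<mu> i)"
    using assms cocone_postcomp is_colimitD by blast
  then have "\<exists>!k. k \<in> Hom C L M \<and> (\<forall>i\<in>Obj I. k \<bullet> \<mu> i = h \<bullet> \<mu> i)"
    using assms(1) by (simp add: is_colimit_def)
  then show ?thesis using assms(2-) by metis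
qed

lemma is_colimit_factor:
  assumes "is_colimit I C G L \<mu>" "cocone I C G M \<nu>"
  obtains h where "h \<in> Hom C L M" "\<And>i. i \<in> Obj I \<Longrightarrow> h \<bullet> \<mu> i = \<nu> i"
  using assms unfolding is_colimit_def by metis

text \<open>Uniqueness is requested as joint epimorphy of the \<open>\<mu> i\<close>, which mentions
  no cocone and can be proved apart from the existence of the factorization.\<close>

lemma is_colimitI:
  assumes "cat_functor I C G" "cocone I C G L \<mu>"
    and "\<And>M \<nu>. cocone I C G M \<nu> \<Longrightarrow> \<exists>h\<in>Hom C L M. \<forall>i\<in>Obj I. h \<bullet> \<mu> i = \<nu> i"
    and "\<And>M h h'. \<lbrakk>h \<in> Hom C L M; h' \<in> Hom C L M; \<And>i. i \<in> Obj I \<Longrightarrow> h \<bullet> \<mu> i = h' \<bullet> \<mu> i\<rbrakk> \<Longrightarrow> h = h'"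
  shows "is_colimit I C G L \<mu>"
  unfolding is_colimit_def
proof (intro conjI allI impI)
  fix M \<nu> assume "cocone I C G M \<nu>"
  from assms(3)[OF this] obtain h where h: "h\<in>Hom C L M" "\<forall>i\<in>Obj I. h \<bullet> \<mu> i = \<nu> i" by blast
  show "\<exists>!h. h \<in> Hom C L M \<and> (\<forall>i\<in>Obj I. h \<bullet> \<mu> i = \<nu> i)"
  proof (rule ex1I[of _ h])
    fix k assume "k \<in> Hom C L M \<and> (\<forall>i\<in>Obj I. k \<bullet> \<mu> i = \<nu> i)"
    then show "k = h" using assms(4)[of k M h] h by simp
  qed (use h in blast)
qed (use assms in blast)+

lemma is_colimit_unique:
  assumes L: "is_colimit I C G L \<mu>" and L': "is_colimit I C G L' \<mu>'"
  obtains h k where "h \<in> Hom C L L'" "k \<in> Hom C L' L" "inverse_arrows C h k"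
    "\<And>i. i \<in> Obj I \<Longrightarrow> h \<bullet> \<mu> i = \<mu>' i" "\<And>i. i \<in> Obj I \<Longrightarrow> k \<bullet> \<mu>' i = \<mu> i"
proof -
  obtain h where h: "h \<in> Hom C L L'" "\<And>i. i \<in> Obj I \<Longrightarrow> h \<bullet> \<mu> i = \<mu>' i"
    using is_colimit_factor[OF L is_colimitD(2)[OF L']] by blast
  obtain k where k: "k \<in> Hom C L' L" "\<And>i. i \<in> Obj I \<Longrightarrow> k \<bullet> \<mu>' i = \<mu> i"
    using is_colimit_factor[OF L' is_colimitD(2)[OF L]] by blast
  have "k \<bullet> h = Ident C L"
  proof (rule is_colimit_eq[OF L])
    fix i assume i: "i \<in> Obj I"
    have "(k \<bullet> h) \<bullet> \<mu> i = k \<bullet> (h \<bullet> \<mu> i)"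
      using is_colimitD(4)[OF L i] h(1) k(1) by (auto simp: Hom_def seq_simps)
    also have "\<dots> = Ident C L \<bullet> \<mu> i"
      using is_colimitD(4)[OF L i] by (simp add: h(2) k(2) i Ident_left)
    finally show "(k \<bullet> h) \<bullet> \<mu> i = Ident C L \<bullet> \<mu> i" .
  qed (use h(1) k(1) is_colimitD(3)[OF L] in \<open>auto intro: Comp_Hom Ident_Hom\<close>)
  moreover have "h \<bullet> k = Ident C L'"
  proof (rule is_colimit_eq[OF L'])
    fix i assume i: "i \<in> Obj I"
    have "(h \<bullet> k) \<bullet> \<mu>' i = h \<bullet> (k \<bullet> \<mu>' i)"
      using is_colimitD(4)[OF L' i] h(1) k(1) by (auto simp: Hom_def seq_simps)
    also have "\<dots> = Ident C L' \<bullet> \<mu>' i"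
      using is_colimitD(4)[OF L' i] by (simp add: h(2) k(2) i Ident_left)
    finally show "(h \<bullet> k) \<bullet> \<mu>' i = Ident C L' \<bullet> \<mu>' i" .
  qed (use h(1) k(1) is_colimitD(3)[OF L'] in \<open>auto intro: Comp_Hom Ident_Hom\<close>)
  ultimately show thesis
    using h k inverse_arrowsI that by blast
qed

text \<open>Needed because an equivalence presents an object only up to isomorphism: a colimit with
  vertex \<open>FO E (FO H X)\<close> has to become one with vertex \<open>X\<close>.\<close>

lemma is_colimit_iso:
  assumes L: "is_colimit I C G L \<mu>" and h: "h \<in> Hom C L L'" "inverse_arrows C h k"
  shows "is_colimit I C G L' (\<lambda>i. h \<bullet> \<mu> i)"
proof (rule is_colimitI)
  note k = inverse_arrowsD[OF h(2,1)]
  show "cat_functor I C G" using L is_colimitD by blast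
  show "cocone I C G L' (\<lambda>i. h \<bullet> \<mu> i)"
    using cocone_postcomp[OF is_colimitD(1,2)[OF L] h(1)] .
  have assoc: "(f \<bullet> h) \<bullet> \<mu> i = f \<bullet> (h \<bullet> \<mu> i)" if "i \<in> Obj I" "f \<in> Hom C L' M" for i f M
    using is_colimitD(4)[OF L that(1)] that(2) h(1) by (auto simp: Hom_def seq_simps)
  fix M
  show "\<exists>g\<in>Hom C L' M. \<forall>i\<in>Obj I. g \<bullet> (h \<bullet> \<mu> i) = \<nu> i" if c: "cocone I C G M \<nu>" for \<nu>
  proof -
    obtain g where g: "g \<in> Hom C L M" "\<And>i. i \<in> Obj I \<Longrightarrow> g \<bullet> \<mu> i = \<nu> i"
      using is_colimit_factor[OF L c] by blast
    have gk: "g \<bullet> k \<in> Hom C L' M" using g k Comp_Hom by blast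
    have "(g \<bullet> k) \<bullet> h = g \<bullet> (k \<bullet> h)" using g k(1) h(1) by (auto simp: Hom_def seq_simps)
    also have "\<dots> = g" using g(1) k(2) Ident_right by simp
    finally have "(g \<bullet> k) \<bullet> h = g" .
    then show ?thesis using assoc[OF _ gk] g(2) gk by (intro bexI[of _ "g \<bullet> k"]) auto
  qed
  show "f = g" if fg: "f \<in> Hom C L' M" "g \<in> Hom C L' M"
    and eq: "\<And>i. i \<in> Obj I \<Longrightarrow> f \<bullet> (h \<bullet> \<mu> i) = g \<bullet> (h \<bullet> \<mu> i)" for f g
  proof -
    have "f \<bullet> h = g \<bullet> h"
      by (rule is_colimit_eq[OF L]) (use fg h eq assoc in \<open>auto intro: Comp_Hom\<close>)
    then show ?thesis using comp_cancel_right[OF _ k(3) k(1) h(1) fg] by blast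
  qed
qed

end

section \<open>Full subcategories\<close>

lemma Hom_full_subcat:
  "Hom (full_subcat C S) X Y = (if X \<in> S \<and> Y \<in> S then Hom C X Y else {})"
  by (auto simp: full_subcat_def Hom_def)

lemma full_subcat_sel [simp]:
  "Obj (full_subcat C S) = Obj C \<inter> S" "Ident (full_subcat C S) = Ident C"
  "Dom (full_subcat C S) = Dom C" "Cod (full_subcat C S) = Cod C"
  "Comp (full_subcat C S) = Comp C"
  by (simp_all add: full_subcat_def)

lemma (in category) category_full_subcat: "category (full_subcat C S)"
  by unfold_locales
    (auto simp: full_subcat_def Hom_def Dom_Obj Cod_Obj seq_simps)

lemma cat_functor_from_full_subcat:
  assumes "category A" "cat_functor I (full_subcat A S) G"
  shows "cat_functor I A G"
proof -
  interpret A: category A by fact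
  interpret G: cat_functor I "full_subcat A S" G by fact
  have S: "FO G X \<in> S" if "X \<in> Obj I" for X using G.FO_Obj[OF that] by simp
  show ?thesis
  proof unfold_locales
    show "FA G f \<in> Hom A (FO G X) (FO G Y)" if "f \<in> Hom I X Y" for f X Y
      using G.FA_Hom[OF that] by (auto simp: Hom_full_subcat split: if_splits)
  qed (use G.FO_Obj G.FA_Ident G.FA_Comp in auto)
qed

lemma cat_functor_into_full_subcat:
  assumes "cat_functor I A G" "\<And>i. i \<in> Obj I \<Longrightarrow> FO G i \<in> S"
  shows "cat_functor I (full_subcat A S) G"
proof -
  interpret G: cat_functor I A G by fact
  interpret A: category "full_subcat A S" by (rule G.B.category_full_subcat)
  show ?thesis
  proof unfold_locales
    show "FA G f \<in> Hom (full_subcat A S) (FO G X) (FO G Y)" if "f \<in> Hom I X Y" for f X Y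
      using G.FA_Hom[OF that] assms(2) G.A.Hom_Obj[OF that] by (auto simp: Hom_full_subcat)
  qed (use G.FO_Obj G.FA_Ident G.FA_Comp assms(2) in auto)
qed

text \<open>Cocones in the subcategory are the ambient cocones whose vertex lies in
  \<open>S\<close>, so the universal property is tested against fewer objects.\<close>

lemma is_colimit_full_subcat:
  assumes "category A" "is_colimit I A G L \<mu>" "\<And>i. i \<in> Obj I \<Longrightarrow> FO G i \<in> S" "L \<in> S"
  shows "is_colimit I (full_subcat A S) G L \<mu>"
proof -
  interpret A: category A by fact
  have G: "cat_functor I (full_subcat A S) G"
    using cat_functor_into_full_subcat A.is_colimitD(1) assms by blast
  have c: "cocone I (full_subcat A S) G M \<nu> \<longleftrightarrow> M \<in> S \<and> cocone I A G M \<nu>" for M \<nu>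
    using assms(3) by (auto simp: cocone_def Hom_full_subcat)
  show ?thesis
    using assms(2,4) G by (auto simp: is_colimit_def c Hom_full_subcat)
qed

section \<open>Compact objects\<close>

lemma set_cat_sel [simp]:
  "Obj set_cat = UNIV" "Dom set_cat = fst" "Cod set_cat = fst \<circ> snd"
  "Ident set_cat = (\<lambda>A. (A, A, \<lambda>x\<in>A. x))"
  "Comp set_cat (A', B', g) (A, B, f) = (A, B', compose A g f)"
  by (simp_all add: set_cat_def)

lemma Hom_set_cat: "t \<in> Hom set_cat A B \<longleftrightarrow> (\<exists>f \<in> A \<rightarrow>\<^sub>E B. t = (A, B, f))"
  by (auto simp: Hom_def set_cat_def)

lemma Hom_set_catE:
  assumes "t \<in> Hom set_cat A B"
  obtains f where "f \<in> A \<rightarrow>\<^sub>E B" "t = (A, B, f)"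
  using assms by (auto simp: Hom_set_cat)

lemma category_set_cat: "category set_cat"
proof
  show "f \<in> Arr set_cat \<Longrightarrow> Dom set_cat f \<in> Obj set_cat" for f :: "'a set \<times> 'a set \<times> ('a \<Rightarrow> 'a)"
    by simp
  show "f \<in> Arr set_cat \<Longrightarrow> Cod set_cat f \<in> Obj set_cat" for f :: "'a set \<times> 'a set \<times> ('a \<Rightarrow> 'a)"
    by simp
  show "Ident set_cat A \<in> Hom set_cat A A" for A :: "'a set"
    by (auto simp: Hom_set_cat)
  show "Comp set_cat g f \<in> Hom set_cat A E"
    if f: "f \<in> Hom set_cat A B" and g: "g \<in> Hom set_cat B E" for f g and A B E :: "'a set"
    by (rule Hom_set_catE[OF f], rule Hom_set_catE[OF g])
      (auto simp: Hom_set_cat compose_def PiE_iff)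
  show "Comp set_cat (Ident set_cat B) f = f"
    if f: "f \<in> Hom set_cat A B" for f and A B :: "'a set"
    by (rule Hom_set_catE[OF f]) (auto simp: compose_def fun_eq_iff PiE_iff extensional_def)
  show "Comp set_cat f (Ident set_cat A) = f"
    if f: "f \<in> Hom set_cat A B" for f and A B :: "'a set"
    by (rule Hom_set_catE[OF f]) (auto simp: compose_def fun_eq_iff PiE_iff extensional_def)
  show "Comp set_cat h (Comp set_cat g f) = Comp set_cat (Comp set_cat h g) f"
    if f: "f \<in> Hom set_cat A B" and g: "g \<in> Hom set_cat B E" and h: "h \<in> Hom set_cat E H"
    for f g h and A B E H :: "'a set"
    by (rule Hom_set_catE[OF f], rule Hom_set_catE[OF g], rule Hom_set_catE[OF h])
      (auto simp: compose_def PiE_iff fun_eq_iff)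
qed

text \<open>The elementwise description of a filtered colimit of sets: the canonical map from the
  colimit of the sets \<open>Hom(X, G i)\<close> to \<open>Hom(X, L)\<close> is surjective and injective.\<close>

definition hom_colimit :: "('i, 'j, 'y) cat_scheme \<Rightarrow> ('o, 'a, 'x) cat_scheme \<Rightarrow>
    ('i, 'j, 'o, 'a) func \<Rightarrow> 'o \<Rightarrow> ('i \<Rightarrow> 'a) \<Rightarrow> 'o \<Rightarrow> bool" where
  "hom_colimit I C G L \<mu> X \<longleftrightarrow>
     (\<forall>g\<in>Hom C X L. \<exists>i\<in>Obj I. \<exists>g'\<in>Hom C X (FO G i). g = \<mu> i \<bullet>\<^bsub>C\<^esub> g') \<and>
     (\<forall>i\<in>Obj I. \<forall>g\<in>Hom C X (FO G i). \<forall>g'\<in>Hom C X (FO G i). \<mu> i \<bullet>\<^bsub>C\<^esub> g = \<mu> i \<bullet>\<^bsub>C\<^esub> g' \<longrightarrow>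
        (\<exists>k\<in>Obj I. \<exists>u\<in>Hom I i k. FA G u \<bullet>\<^bsub>C\<^esub> g = FA G u \<bullet>\<^bsub>C\<^esub> g'))"

lemma hom_colimit_factor:
  assumes "hom_colimit I C G L \<mu> X" "g \<in> Hom C X L"
  obtains i g' where "i \<in> Obj I" "g' \<in> Hom C X (FO G i)" "g = \<mu> i \<bullet>\<^bsub>C\<^esub> g'"
  using assms unfolding hom_colimit_def by blast

lemma hom_colimit_eq:
  assumes "hom_colimit I C G L \<mu> X" "i \<in> Obj I"
    and "g \<in> Hom C X (FO G i)" "g' \<in> Hom C X (FO G i)" "\<mu> i \<bullet>\<^bsub>C\<^esub> g = \<mu> i \<bullet>\<^bsub>C\<^esub> g'"
  obtains k u where "k \<in> Obj I" "u \<in> Hom I i k" "FA G u \<bullet>\<^bsub>C\<^esub> g = FA G u \<bullet>\<^bsub>C\<^esub> g'"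
  using assms unfolding hom_colimit_def by blast

lemma filtered_upper:
  assumes "filtered I" "i \<in> Obj I" "j \<in> Obj I"
  obtains k u v where "k \<in> Obj I" "u \<in> Hom I i k" "v \<in> Hom I j k"
  using assms unfolding filtered_def by blast

lemma filtered_coequalize:
  assumes "filtered I" "u \<in> Hom I i j" "v \<in> Hom I i j"
  obtains k w where "k \<in> Obj I" "w \<in> Hom I j k" "w \<bullet>\<^bsub>I\<^esub> u = w \<bullet>\<^bsub>I\<^esub> v"
  using assms category.Hom_Obj unfolding filtered_def by metis

context category
begin

lemma cocone_comp_assoc:
  assumes "cat_functor I C G" "cocone I C G L \<mu>" "u \<in> Hom I i j" "g \<in> Hom C X (FO G i)"
  shows "\<mu> j \<bullet> (FA G u \<bullet> g) = \<mu> i \<bullet> g"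
proof -
  interpret G: cat_functor I C G by fact
  note ij = G.A.Hom_Obj[OF assms(3)]
  have "\<mu> j \<in> Hom C (FO G j) L" using assms(2) ij by (auto simp: cocone_def)
  then have "\<mu> j \<bullet> (FA G u \<bullet> g) = (\<mu> j \<bullet> FA G u) \<bullet> g"
    using G.FA_Hom[OF assms(3)] assms(4) Comp_assoc by blast
  also have "\<mu> j \<bullet> FA G u = \<mu> i" using assms(2,3) by (auto simp: cocone_def Hom_def)
  finally show ?thesis .
qed

text \<open>A compatible family \<open>\<psi>\<close> on the stages is well defined on
  \<open>Hom C X L\<close>. Since \<open>hom_colimit\<close> compares arrows at one index only,
  \<open>g\<close> and \<open>g'\<close> are first moved to a common index \<open>k\<close> and then
  made equal at \<open>l\<close>. The values of \<open>\<psi>\<close> may be of any type, so the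
  lemma serves maps of sets and arrows of presheaves alike.\<close>

lemma hom_colimit_descend:
  assumes "filtered I" "cat_functor I C G" "cocone I C G L \<mu>" "hom_colimit I C G L \<mu> X"
    and inv: "\<And>i k u g. \<lbrakk>u \<in> Hom I i k; g \<in> Hom C X (FO G i)\<rbrakk> \<Longrightarrow> \<psi> k (FA G u \<bullet> g) = \<psi> i g"
    and ij: "i \<in> Obj I" "j \<in> Obj I" "g \<in> Hom C X (FO G i)" "g' \<in> Hom C X (FO G j)"
    and eq: "\<mu> i \<bullet> g = \<mu> j \<bullet> g'"
  shows "\<psi> i g = \<psi> j g'"
proof -
  interpret G: cat_functor I C G by fact
  obtain k u v where k: "k \<in> Obj I" and u: "u \<in> Hom I i k" and v: "v \<in> Hom I j k"
    using filtered_upper[OF assms(1) ij(1,2)] by blast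
  have h: "FA G u \<bullet> g \<in> Hom C X (FO G k)" "FA G v \<bullet> g' \<in> Hom C X (FO G k)"
    using G.FA_Hom[OF u] G.FA_Hom[OF v] ij(3,4) Comp_Hom by blast+
  have "\<mu> k \<bullet> (FA G u \<bullet> g) = \<mu> k \<bullet> (FA G v \<bullet> g')"
    using cocone_comp_assoc[OF assms(2,3) u ij(3)] cocone_comp_assoc[OF assms(2,3) v ij(4)] eq
    by simp
  then obtain l w where w: "w \<in> Hom I k l" "FA G w \<bullet> (FA G u \<bullet> g) = FA G w \<bullet> (FA G v \<bullet> g')"
    using hom_colimit_eq[OF assms(4) k h] by blast
  have "\<psi> i g = \<psi> l (FA G w \<bullet> (FA G u \<bullet> g))"
    using inv[OF w(1) h(1)] inv[OF u ij(3)] by simp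
  also have "\<dots> = \<psi> j g'"
    using inv[OF w(1) h(2)] inv[OF v ij(4)] w(2) by simp
  finally show ?thesis .
qed

text \<open>The property depends on the colimit only up to isomorphism. It is established for
  colimits constructed by hand and carried to arbitrary ones by this lemma.\<close>

lemma hom_colimit_iso:
  assumes h: "hom_colimit I C G L \<mu> X" and L: "is_colimit I C G L \<mu>"
    and L': "is_colimit I C G L' \<mu>'" and "X \<in> Obj C"
  shows "hom_colimit I C G L' \<mu>' X"
proof -
  obtain f k where f: "f \<in> Hom C L L'" and k: "k \<in> Hom C L' L" and inv: "inverse_arrows C f k"
    and f\<mu>: "\<And>i. i \<in> Obj I \<Longrightarrow> f \<bullet> \<mu> i = \<mu>' i" and k\<mu>: "\<And>i. i \<in> Obj I \<Longrightarrow> k \<bullet> \<mu>' i = \<mu> i"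
    using is_colimit_unique[OF L L'] by blast
  note kf = inverse_arrowsD[OF inv f]
  have f\<mu>g: "f \<bullet> (\<mu> i \<bullet> g) = \<mu>' i \<bullet> g" if "i \<in> Obj I" "g \<in> Hom C X (FO G i)" for i g
    using Comp_assoc[OF that(2) is_colimitD(4)[OF L that(1)] f] f\<mu> that by simp
  have k\<mu>g: "k \<bullet> (\<mu>' i \<bullet> g) = \<mu> i \<bullet> g" if "i \<in> Obj I" "g \<in> Hom C X (FO G i)" for i g
    using Comp_assoc[OF that(2) is_colimitD(4)[OF L' that(1)] k] k\<mu> that by simp
  show ?thesis
    unfolding hom_colimit_def
  proof (intro conjI ballI impI)
    fix g assume g: "g \<in> Hom C X L'"
    obtain i g' where i: "i \<in> Obj I" "g' \<in> Hom C X (FO G i)" "k \<bullet> g = \<mu> i \<bullet> g'"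
      using hom_colimit_factor[OF h Comp_Hom[OF g k]] by blast
    have "g = f \<bullet> (k \<bullet> g)" using Comp_assoc[OF g k f] kf Ident_left[OF g] by simp
    then show "\<exists>i\<in>Obj I. \<exists>g'\<in>Hom C X (FO G i). g = \<mu>' i \<bullet> g'"
      using i f\<mu>g by auto
  next
    fix i g g' assume g: "i \<in> Obj I" "g \<in> Hom C X (FO G i)" "g' \<in> Hom C X (FO G i)"
      "\<mu>' i \<bullet> g = \<mu>' i \<bullet> g'"
    then have "\<mu> i \<bullet> g = \<mu> i \<bullet> g'" using k\<mu>g by metis
    then show "\<exists>k\<in>Obj I. \<exists>u\<in>Hom I i k. FA G u \<bullet> g = FA G u \<bullet> g'"
      using hom_colimit_eq[OF h g(1-3)] by metis
  qed
qed

section \<open>Compactness in terms of \<open>hom_colimit\<close>\<close>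

lemma cat_functor_hom_func:
  assumes "X \<in> Obj C"
  shows "cat_functor C set_cat (hom_func C X)"
proof -
  interpret S: category "set_cat :: ('a set, 'a set \<times> 'a set \<times> ('a \<Rightarrow> 'a)) cat"
    by (rule category_set_cat)
  show ?thesis
  proof
    show "FO (hom_func C X) Y \<in> Obj set_cat" for Y by simp
    show "FA (hom_func C X) f \<in> Hom set_cat (FO (hom_func C X) Y) (FO (hom_func C X) Z)"
      if "f \<in> Hom C Y Z" for f Y Z
      using that Comp_Hom[OF _ that]
      by (auto simp: hom_func_def Hom_set_cat Hom_def[of C Y Z])
    show "FA (hom_func C X) (Ident C Y) = Ident set_cat (FO (hom_func C X) Y)"
      if "Y \<in> Obj C" for Y
      using that by (auto simp: hom_func_def Hom_def seq_simps fun_eq_iff restrict_def)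
    show "FA (hom_func C X) (g \<bullet> f) = Comp set_cat (FA (hom_func C X) g) (FA (hom_func C X) f)"
      if "f \<in> Hom C Y Z" "g \<in> Hom C Z W" for f g Y Z W
      using that by (auto simp: hom_func_def Hom_def seq_simps fun_eq_iff restrict_def compose_def)
  qed
qed

text \<open>Surjectivity of the comparison map gives uniqueness of mediating maps; together with
  injectivity it lets a cocone of sets descend to \<open>Hom C X L\<close>.\<close>

lemma compact_objectI:
  assumes X: "X \<in> Obj C"
    and hc: "\<And>(I :: ('u, 'u) cat) G L \<mu>. \<lbrakk>small_cat I; filtered I; is_colimit I C G L \<mu>\<rbrakk> \<Longrightarrow>
      hom_colimit I C G L \<mu> X"
  shows "compact_object TYPE('u) C X"
  unfolding compact_object_def preserves_filtered_colimits_def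
proof (intro conjI allI impI X)
  fix I :: "('u, 'u) cat" and G L \<mu>
  assume I: "small_cat I" "filtered I" and L: "is_colimit I C G L \<mu>"
  note h = hc[OF I L]
  interpret S: category "set_cat :: ('a set, 'a set \<times> 'a set \<times> ('a \<Rightarrow> 'a)) cat"
    by (rule category_set_cat)
  interpret H: cat_functor C set_cat "hom_func C X" by (rule cat_functor_hom_func[OF X])
  note G = is_colimitD(1)[OF L] and c = is_colimitD(2)[OF L]
  interpret G: cat_functor I C G by (rule G)
  have FO_H: "FO (hom_func C X) Y = Hom C X Y" for Y by (simp add: hom_func_def)
  have FA_H: "FA (hom_func C X) f = (Hom C X Y, Hom C X Z, \<lambda>g\<in>Hom C X Y. f \<bullet> g)"
    if "f \<in> Hom C Y Z" for f Y Z using that by (auto simp: hom_func_def Hom_def)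
  show "is_colimit I set_cat (comp_func (hom_func C X) G) (FO (hom_func C X) L)
     (\<lambda>i. FA (hom_func C X) (\<mu> i))"
  proof (rule S.is_colimitI)
    show "cat_functor I set_cat (comp_func (hom_func C X) G)"
      using cat_functor_comp[OF G H.cat_functor_axioms] .
    show "cocone I set_cat (comp_func (hom_func C X) G) (FO (hom_func C X) L)
        (\<lambda>i. FA (hom_func C X) (\<mu> i))"
      using cocone_image[OF c G H.cat_functor_axioms] .
    fix M
    show "\<exists>h\<in>Hom set_cat (FO (hom_func C X) L) M. \<forall>i\<in>Obj I. Comp set_cat h (FA (hom_func C X) (\<mu> i)) = \<nu> i"
      if c': "cocone I set_cat (comp_func (hom_func C X) G) M \<nu>" for \<nu>
    proof -
      define \<psi> where "\<psi> i = snd (snd (\<nu> i))" for i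
      have \<nu>: "\<nu> i = (Hom C X (FO G i), M, \<psi> i)" "\<psi> i \<in> Hom C X (FO G i) \<rightarrow>\<^sub>E M" if "i \<in> Obj I" for i
        proof -
        have "\<nu> i \<in> Hom set_cat (Hom C X (FO G i)) M"
          using c' that by (auto simp: cocone_def FO_H)
        then show "\<nu> i = (Hom C X (FO G i), M, \<psi> i)" "\<psi> i \<in> Hom C X (FO G i) \<rightarrow>\<^sub>E M"
          by (auto simp: Hom_set_cat \<psi>_def)
      qed
      have \<psi>: "\<psi> k (FA G u \<bullet> g) = \<psi> i g" if u: "u \<in> Hom I i k" and g: "g \<in> Hom C X (FO G i)" for i k u g
      proof -
        note ik = G.A.Hom_Obj[OF u]
        have "Comp set_cat (\<nu> k) (FA (hom_func C X) (FA G u)) = \<nu> i"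
          using c' u by (auto simp: cocone_def Hom_def)
        then have "compose (Hom C X (FO G i)) (\<psi> k) (\<lambda>g\<in>Hom C X (FO G i). FA G u \<bullet> g) = \<psi> i"
          using \<nu>(1) ik FA_H[OF G.FA_Hom[OF u]] by simp
        from fun_cong[OF this, of g] show ?thesis using g by (simp add: compose_def)
      qed
      \<comment> \<open>The mediating map: factor \<open>g\<close> through a stage and apply the
        cocone there. The choice is of the value \<open>z\<close> and not of the factorization,
        because the value is unique by \<open>hom_colimit_descend\<close>.\<close>
      define t where "t g = (SOME z. \<exists>i\<in>Obj I. \<exists>g'\<in>Hom C X (FO G i). g = \<mu> i \<bullet> g' \<and> z = \<psi> i g')" for g
      have t: "t (\<mu> i \<bullet> g) = \<psi> i g" if "i \<in> Obj I" "g \<in> Hom C X (FO G i)" for i g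
        unfolding t_def
      proof (rule some_equality)
        show "\<exists>j\<in>Obj I. \<exists>g'\<in>Hom C X (FO G j). \<mu> i \<bullet> g = \<mu> j \<bullet> g' \<and> \<psi> i g = \<psi> j g'"
          using that by blast
        fix z assume "\<exists>j\<in>Obj I. \<exists>g'\<in>Hom C X (FO G j). \<mu> i \<bullet> g = \<mu> j \<bullet> g' \<and> z = \<psi> j g'"
        then obtain j g' where j: "j \<in> Obj I" "g' \<in> Hom C X (FO G j)" "\<mu> i \<bullet> g = \<mu> j \<bullet> g'"
          and z: "z = \<psi> j g'" by blast
        have "\<psi> i g = \<psi> j g'"
          by (rule hom_colimit_descend[where \<psi> = \<psi>, OF I(2) G c h _ that(1) j(1) that(2) j(2,3)])
            (rule \<psi>)
        then show "z = \<psi> i g" using z by simp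
      qed
      have "t g \<in> M" if g: "g \<in> Hom C X L" for g
        by (rule hom_colimit_factor[OF h g]) (use t \<nu>(2) in auto)
      then have "(Hom C X L, M, \<lambda>g\<in>Hom C X L. t g) \<in> Hom set_cat (FO (hom_func C X) L) M"
        by (auto simp: Hom_set_cat FO_H)
      moreover have "Comp set_cat (Hom C X L, M, \<lambda>g\<in>Hom C X L. t g) (FA (hom_func C X) (\<mu> i)) = \<nu> i"
        if i: "i \<in> Obj I" for i
      proof -
        have "compose (Hom C X (FO G i)) (\<lambda>g\<in>Hom C X L. t g) (\<lambda>g\<in>Hom C X (FO G i). \<mu> i \<bullet> g) = \<psi> i"
        proof
          fix g
          show "compose (Hom C X (FO G i)) (\<lambda>g\<in>Hom C X L. t g) (\<lambda>g\<in>Hom C X (FO G i). \<mu> i \<bullet> g) g = \<psi> i g"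
            using \<nu>(2)[OF i] t[OF i] Comp_Hom[OF _ is_colimitD(4)[OF L i]]
            by (auto simp: compose_def PiE_iff extensional_def)
        qed
        then show ?thesis using FA_H[OF is_colimitD(4)[OF L i]] \<nu>(1)[OF i] by simp
      qed
      ultimately show ?thesis by blast
    qed
    show "f = f'" if f: "f \<in> Hom set_cat (FO (hom_func C X) L) M"
      and f': "f' \<in> Hom set_cat (FO (hom_func C X) L) M"
      and eq: "\<And>i. i \<in> Obj I \<Longrightarrow> Comp set_cat f (FA (hom_func C X) (\<mu> i)) = Comp set_cat f' (FA (hom_func C X) (\<mu> i))"
      for f f'
    proof -
      obtain r where r: "r \<in> Hom C X L \<rightarrow>\<^sub>E M" "f = (Hom C X L, M, r)"
        using Hom_set_catE[OF f] unfolding FO_H by blast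
      obtain r' where r': "r' \<in> Hom C X L \<rightarrow>\<^sub>E M" "f' = (Hom C X L, M, r')"
        using Hom_set_catE[OF f'] unfolding FO_H by blast
      have "r g = r' g" if g: "g \<in> Hom C X L" for g
      proof -
        obtain i g' where i: "i \<in> Obj I" "g' \<in> Hom C X (FO G i)" "g = \<mu> i \<bullet> g'"
          using hom_colimit_factor[OF h g] by blast
        have "compose (Hom C X (FO G i)) r (\<lambda>g\<in>Hom C X (FO G i). \<mu> i \<bullet> g) =
            compose (Hom C X (FO G i)) r' (\<lambda>g\<in>Hom C X (FO G i). \<mu> i \<bullet> g)"
          using eq[OF i(1)] FA_H[OF is_colimitD(4)[OF L i(1)]] r(2) r'(2) by simp
        from fun_cong[OF this, of g'] show ?thesis using i by (simp add: compose_def)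
      qed
      then have "r = r'" using PiE_ext[OF r(1) r'(1)] by blast
      then show "f = f'" using r(2) r'(2) by simp
    qed
  qed
qed

text \<open>The half of compactness that is used for objects of \<open>D\<close>: it makes an arrow
  into a filtered colimit come from a stage. Surjectivity is recovered from the universal property
  in \<open>set_cat\<close> by an image argument.\<close>

lemma compact_object_factor:
  fixes I :: "('u, 'u) cat"
  assumes X: "compact_object TYPE('u) C X" and I: "small_cat I" "filtered I"
    and L: "is_colimit I C G L \<mu>" and g: "g \<in> Hom C X L"
  obtains i g' where "i \<in> Obj I" "g' \<in> Hom C X (FO G i)" "g = \<mu> i \<bullet> g'"
proof -
  let ?H = "comp_func (hom_func C X) G"
  have XO: "X \<in> Obj C" using X by (simp add: compact_object_def)
  interpret S: category "set_cat :: ('a set, 'a set \<times> 'a set \<times> ('a \<Rightarrow> 'a)) cat"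
    by (rule category_set_cat)
  interpret H: cat_functor C set_cat "hom_func C X" by (rule cat_functor_hom_func[OF XO])
  interpret G: cat_functor I C G by (rule is_colimitD(1)[OF L])
  have FO_H: "FO (hom_func C X) Y = Hom C X Y" for Y by (simp add: hom_func_def)
  have FA_H: "FA (hom_func C X) f = (Hom C X Y, Hom C X Z, \<lambda>g\<in>Hom C X Y. f \<bullet> g)"
    if "f \<in> Hom C Y Z" for f Y Z using that by (auto simp: hom_func_def Hom_def)
  have "is_colimit I set_cat ?H (FO (hom_func C X) L) (\<lambda>i. FA (hom_func C X) (\<mu> i))"
    using X I L by (simp add: compact_object_def preserves_filtered_colimits_def)
  then have colim: "is_colimit I set_cat ?H (Hom C X L) (\<lambda>i. FA (hom_func C X) (\<mu> i))"
    by (simp add: FO_H)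
  \<comment> \<open>The arrows that factor through a stage. All legs of the colimit land in
    \<open>S\<close>, so the diagram has a cocone with vertex \<open>S\<close> and a map from
    \<open>Hom C X L\<close> to \<open>S\<close> results.\<close>
  define S where "S = {g \<in> Hom C X L. \<exists>i\<in>Obj I. \<exists>g'\<in>Hom C X (FO G i). g = \<mu> i \<bullet> g'}"
  define \<nu> where "\<nu> i = (Hom C X (FO G i), S, \<lambda>g\<in>Hom C X (FO G i). \<mu> i \<bullet> g)" for i
  have \<mu>S: "\<mu> i \<bullet> g \<in> S" if "i \<in> Obj I" "g \<in> Hom C X (FO G i)" for i g
    using that Comp_Hom[OF that(2) is_colimitD(4)[OF L that(1)]] by (auto simp: S_def)
  have "cocone I set_cat ?H S \<nu>"
    unfolding cocone_def
  proof (intro conjI ballI)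
    show "S \<in> Obj set_cat" by simp
    show "\<nu> i \<in> Hom set_cat (FO ?H i) S" if "i \<in> Obj I" for i
      using \<mu>S[OF that] by (auto simp: \<nu>_def Hom_set_cat FO_H)
    fix u assume u: "u \<in> Arr I"
    have "compose (Hom C X (FO G (Dom I u))) (\<lambda>g\<in>Hom C X (FO G (Cod I u)). \<mu> (Cod I u) \<bullet> g)
        (\<lambda>g\<in>Hom C X (FO G (Dom I u)). FA G u \<bullet> g) = (\<lambda>g\<in>Hom C X (FO G (Dom I u)). \<mu> (Dom I u) \<bullet> g)"
      using cocone_comp_assoc[OF is_colimitD(1,2)[OF L] Arr_Hom[OF u]]
        Comp_Hom[OF _ G.FA_Hom[OF Arr_Hom[OF u]]]
      by (auto simp: compose_def fun_eq_iff)
    then show "Comp set_cat (\<nu> (Cod I u)) (FA ?H u) = \<nu> (Dom I u)"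
      using FA_H[OF G.FA_Hom[OF Arr_Hom[OF u]]] by (simp add: \<nu>_def)
  qed
  then obtain h where h: "h \<in> Hom set_cat (Hom C X L) S"
    and h\<nu>: "\<And>i. i \<in> Obj I \<Longrightarrow> Comp set_cat h (FA (hom_func C X) (\<mu> i)) = \<nu> i"
    using S.is_colimit_factor[OF colim] by blast
  obtain r where r: "h = (Hom C X L, S, r)" "r \<in> Hom C X L \<rightarrow>\<^sub>E S"
    using Hom_set_catE[OF h] by blast
  \<comment> \<open>Followed by the inclusion of \<open>S\<close>, this map agrees with the identity
    on every leg. Hence \<open>g = r g\<close>, which lies in \<open>S\<close>.\<close>
  have "(Hom C X L, Hom C X L, r) = Ident set_cat (Hom C X L)"
  proof (rule S.is_colimit_eq[OF colim])
    have "r \<in> Hom C X L \<rightarrow>\<^sub>E Hom C X L" using r(2) by (auto simp: S_def PiE_iff)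
    then show "(Hom C X L, Hom C X L, r) \<in> Hom set_cat (Hom C X L) (Hom C X L)"
      by (auto simp: Hom_set_cat)
    show "Ident set_cat (Hom C X L) \<in> Hom set_cat (Hom C X L) (Hom C X L)"
      by (rule S.Ident_Hom) simp
    fix i assume i: "i \<in> Obj I"
    show "Comp set_cat (Hom C X L, Hom C X L, r) (FA (hom_func C X) (\<mu> i)) =
        Comp set_cat (Ident set_cat (Hom C X L)) (FA (hom_func C X) (\<mu> i))"
      using h\<nu>[OF i] FA_H[OF is_colimitD(4)[OF L i]] Comp_Hom[OF _ is_colimitD(4)[OF L i]]
      by (auto simp: r \<nu>_def compose_def fun_eq_iff restrict_def split: if_splits)
  qed
  then have "r g = g" using g by (auto dest: fun_cong[of _ _ g])
  then have "g \<in> S" using r(2) g by (metis PiE_mem)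
  then show thesis using that by (auto simp: S_def)
qed

end

section \<open>Equivalences of categories\<close>

lemma nat_isoD:
  assumes "nat_iso A B F G \<eta>"
  shows "cat_functor A B F" "cat_functor A B G"
    "X \<in> Obj A \<Longrightarrow> \<eta> X \<in> Hom B (FO F X) (FO G X)"
    "f \<in> Hom A X Y \<Longrightarrow> FA G f \<bullet>\<^bsub>B\<^esub> \<eta> X = \<eta> Y \<bullet>\<^bsub>B\<^esub> FA F f"
    "X \<in> Obj A \<Longrightarrow> \<exists>k. inverse_arrows B (\<eta> X) k"
proof -
  show "cat_functor A B F" "cat_functor A B G"
    "X \<in> Obj A \<Longrightarrow> \<eta> X \<in> Hom B (FO F X) (FO G X)"
    "X \<in> Obj A \<Longrightarrow> \<exists>k. inverse_arrows B (\<eta> X) k"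
    using assms unfolding nat_iso_def nat_trans_def iso_arrow_def by blast+
  have "\<forall>f\<in>Arr A. FA G f \<bullet>\<^bsub>B\<^esub> \<eta> (Dom A f) = \<eta> (Cod A f) \<bullet>\<^bsub>B\<^esub> FA F f"
    using assms unfolding nat_iso_def nat_trans_def by blast
  then show "f \<in> Hom A X Y \<Longrightarrow> FA G f \<bullet>\<^bsub>B\<^esub> \<eta> X = \<eta> Y \<bullet>\<^bsub>B\<^esub> FA F f"
    unfolding Hom_def by blast
qed

text \<open>In \<open>equivalence_functor\<close> the isomorphism on \<open>A\<close> starts at the
  identity and the one on \<open>B\<close> ends there. For the inverse functor both directions have
  to be reversed.\<close>

lemma nat_iso_sym:
  assumes \<eta>: "nat_iso A B F G \<eta>"
  obtains \<theta> where "nat_iso A B G F \<theta>"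
proof -
  interpret F: cat_functor A B F by (rule nat_isoD(1)[OF \<eta>])
  interpret G: cat_functor A B G by (rule nat_isoD(2)[OF \<eta>])
  obtain \<theta> where \<theta>: "\<And>X. X \<in> Obj A \<Longrightarrow> inverse_arrows B (\<eta> X) (\<theta> X)"
    using nat_isoD(5)[OF \<eta>] by metis
  note inv = F.B.inverse_arrowsD[OF \<theta> nat_isoD(3)[OF \<eta>]]
  have "FA F f \<bullet>\<^bsub>B\<^esub> \<theta> X = \<theta> Y \<bullet>\<^bsub>B\<^esub> FA G f" if f: "f \<in> Hom A X Y" for f X Y
  proof -
    have X: "X \<in> Obj A" and Y: "Y \<in> Obj A" using f F.A.Hom_Obj by blast+
    note \<eta>X = nat_isoD(3)[OF \<eta> X] and \<eta>Y = nat_isoD(3)[OF \<eta> Y]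
    note hoX = inv[OF X X] and hoY = inv[OF Y Y] and Ff = F.FA_Hom[OF f] and Gf = G.FA_Hom[OF f]
    have "FA F f \<bullet>\<^bsub>B\<^esub> \<theta> X = (\<theta> Y \<bullet>\<^bsub>B\<^esub> \<eta> Y) \<bullet>\<^bsub>B\<^esub> (FA F f \<bullet>\<^bsub>B\<^esub> \<theta> X)"
      using hoY(2) F.B.Ident_left[OF F.B.Comp_Hom[OF hoX(1) Ff]] by simp
    also have "\<dots> = \<theta> Y \<bullet>\<^bsub>B\<^esub> (\<eta> Y \<bullet>\<^bsub>B\<^esub> FA F f) \<bullet>\<^bsub>B\<^esub> \<theta> X"
      using \<eta>X \<eta>Y hoX(1) hoY(1) Ff by (auto simp: Hom_def F.B.seq_simps)
    also have "\<dots> = \<theta> Y \<bullet>\<^bsub>B\<^esub> (FA G f \<bullet>\<^bsub>B\<^esub> \<eta> X) \<bullet>\<^bsub>B\<^esub> \<theta> X"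
      using nat_isoD(4)[OF \<eta> f] by simp
    also have "\<dots> = \<theta> Y \<bullet>\<^bsub>B\<^esub> FA G f \<bullet>\<^bsub>B\<^esub> (\<eta> X \<bullet>\<^bsub>B\<^esub> \<theta> X)"
      using \<eta>X \<eta>Y hoX(1) hoY(1) Gf by (auto simp: Hom_def F.B.seq_simps)
    also have "\<dots> = \<theta> Y \<bullet>\<^bsub>B\<^esub> FA G f"
      using hoX(3) F.B.Ident_right[OF Gf] by simp
    finally show ?thesis .
  qed
  then have "nat_trans A B G F \<theta>"
    unfolding nat_trans_def
    using F.cat_functor_axioms G.cat_functor_axioms inv(1) Arr_Hom[of _ A] by simp
  moreover have "iso_arrow B (\<theta> X)" if X: "X \<in> Obj A" for X
    using F.B.inverse_arrowsI[OF inv(1)[OF X X] nat_isoD(3)[OF \<eta> X] inv(3)[OF X X] inv(2)[OF X X]]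
    by (auto simp: iso_arrow_def)
  ultimately show thesis using that by (auto simp: nat_iso_def)
qed

lemma id_func_simps [simp]: "FO id_func X = X" "FA id_func f = f"
  by (simp_all add: id_func_def)

lemma equivalence_functor_inverse:
  assumes "equivalence_functor A B E"
  obtains G \<eta> \<theta> where "equivalence_functor B A G"
    "nat_iso A A id_func (comp_func G E) \<eta>" "nat_iso B B (comp_func E G) id_func \<theta>"
proof -
  obtain G \<eta> \<theta> where E: "cat_functor A B E" and G: "cat_functor B A G"
    and \<eta>: "nat_iso A A id_func (comp_func G E) \<eta>" and \<theta>: "nat_iso B B (comp_func E G) id_func \<theta>"
    using assms unfolding equivalence_functor_def by blast
  obtain \<eta>' where "nat_iso A A (comp_func G E) id_func \<eta>'" using nat_iso_sym[OF \<eta>] .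
  moreover obtain \<theta>' where "nat_iso B B id_func (comp_func E G) \<theta>'" using nat_iso_sym[OF \<theta>] .
  ultimately have "equivalence_functor B A G"
    using E G unfolding equivalence_functor_def by blast
  then show thesis using \<eta> \<theta> that by blast
qed

text \<open>By naturality \<open>\<eta> Y \<bullet> f\<close> is determined by
  \<open>FA E f\<close>, and \<open>\<eta> Y\<close> is invertible.\<close>

lemma equivalence_functor_faithful:
  assumes E: "equivalence_functor A B E" and f: "f \<in> Hom A X Y" "g \<in> Hom A X Y"
    and eq: "FA E f = FA E g"
  shows "f = g"
proof -
  obtain G \<eta> where \<eta>: "nat_iso A A id_func (comp_func G E) \<eta>"
    using E unfolding equivalence_functor_def by blast
  interpret I: cat_functor A A id_func by (rule nat_isoD(1)[OF \<eta>])
  have Y: "Y \<in> Obj A" using f(1) I.A.Hom_Obj by blast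
  obtain k where k: "inverse_arrows A (\<eta> Y) k" using nat_isoD(5)[OF \<eta> Y] by blast
  have \<eta>Y: "\<eta> Y \<in> Hom A Y (FO G (FO E Y))" using nat_isoD(3)[OF \<eta> Y] by simp
  note kY = I.A.inverse_arrowsD[OF k \<eta>Y]
  have "\<eta> Y \<bullet>\<^bsub>A\<^esub> f = \<eta> Y \<bullet>\<^bsub>A\<^esub> g"
    using nat_isoD(4)[OF \<eta> f(1)] nat_isoD(4)[OF \<eta> f(2)] eq by simp
  then show ?thesis using I.A.comp_cancel_left[OF _ kY(2) kY(1) \<eta>Y f] by blast
qed

lemma equivalence_functor_full:
  assumes E: "equivalence_functor A B E" and X: "X \<in> Obj A" "Y \<in> Obj A"
    and h: "h \<in> Hom B (FO E X) (FO E Y)"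
  obtains f where "f \<in> Hom A X Y" "FA E f = h"
proof -
  obtain G \<eta> \<theta> where G: "equivalence_functor B A G"
    and \<eta>: "nat_iso A A id_func (comp_func G E) \<eta>"
    using equivalence_functor_inverse[OF E] .
  interpret E: cat_functor A B E using E by (simp add: equivalence_functor_def)
  interpret G: cat_functor B A G using G by (simp add: equivalence_functor_def)
  obtain k where k: "inverse_arrows A (\<eta> Y) k" using nat_isoD(5)[OF \<eta> X(2)] by blast
  have \<eta>X: "\<eta> X \<in> Hom A X (FO G (FO E X))" using nat_isoD(3)[OF \<eta> X(1)] by simp
  have \<eta>Y: "\<eta> Y \<in> Hom A Y (FO G (FO E Y))" using nat_isoD(3)[OF \<eta> X(2)] by simp
  note kY = E.A.inverse_arrowsD[OF k \<eta>Y] and Gh = G.FA_Hom[OF h]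
  obtain l where l: "inverse_arrows A (\<eta> X) l" using nat_isoD(5)[OF \<eta> X(1)] by blast
  note lX = E.A.inverse_arrowsD[OF l \<eta>X]
  \<comment> \<open>Naturality of \<eta> leaves no other choice: \<open>FA E f = h\<close> implies
    that \<open>\<eta> Y \<bullet> f\<close> is the composite of \<open>FA G h\<close> with
    \<open>\<eta> X\<close>.\<close>
  define f where "f = k \<bullet>\<^bsub>A\<^esub> FA G h \<bullet>\<^bsub>A\<^esub> \<eta> X"
  have f: "f \<in> Hom A X Y"
    unfolding f_def using kY(1) \<eta>X Gh by (auto intro: E.A.Comp_Hom)
  have "FA G (FA E f) \<bullet>\<^bsub>A\<^esub> \<eta> X = \<eta> Y \<bullet>\<^bsub>A\<^esub> f"
    using nat_isoD(4)[OF \<eta> f] by simp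
  also have "\<dots> = (\<eta> Y \<bullet>\<^bsub>A\<^esub> k) \<bullet>\<^bsub>A\<^esub> (FA G h \<bullet>\<^bsub>A\<^esub> \<eta> X)"
    unfolding f_def using kY(1) \<eta>X \<eta>Y Gh by (auto simp: Hom_def E.A.seq_simps)
  also have "\<dots> = FA G h \<bullet>\<^bsub>A\<^esub> \<eta> X"
    using kY(3) E.A.Ident_left[OF E.A.Comp_Hom[OF \<eta>X Gh]] by simp
  finally have "FA G (FA E f) = FA G h"
    using E.A.comp_cancel_right[OF _ lX(3) lX(1) \<eta>X _ Gh] G.FA_Hom[OF E.FA_Hom[OF f]] by blast
  \<comment> \<open>No triangle identity ties \<eta> to \<theta>, so the equation is shown after
    applying \<open>G\<close> and reflected by the faithfulness of \<open>G\<close>.\<close>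
  then have "FA E f = h"
    using equivalence_functor_faithful[OF G E.FA_Hom[OF f] h] by blast
  then show thesis using f that by blast
qed

text \<open>An equivalence is a left adjoint of its inverse \<open>H\<close>. Composition of
  \<open>FA E g'\<close> with \<open>\<theta> M\<close> is the transposition from
  \<open>Hom A X (FO H M)\<close> to \<open>Hom B (FO E X) M\<close>: surjective as \<open>E\<close>
  is full, injective as \<open>E\<close> is faithful. It turns cocones with vertex \<open>M\<close>
  into cocones with vertex \<open>FO H M\<close>.\<close>

lemma equivalence_functor_colimit:
  assumes E: "equivalence_functor A B E" and L: "is_colimit I A G L \<mu>"
  shows "is_colimit I B (comp_func E G) (FO E L) (\<lambda>i. FA E (\<mu> i))"
proof -
  interpret E: cat_functor A B E using E by (simp add: equivalence_functor_def)
  interpret G: cat_functor I A G by (rule E.A.is_colimitD(1)[OF L])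
  have \<mu>: "\<mu> i \<in> Hom A (FO G i) L" if "i \<in> Obj I" for i using E.A.is_colimitD(4)[OF L that] .
  obtain H \<eta> \<theta> where H: "equivalence_functor B A H"
    and \<theta>: "nat_iso B B (comp_func E H) id_func \<theta>"
    using equivalence_functor_inverse[OF E] .
  interpret H: cat_functor B A H using H by (simp add: equivalence_functor_def)
  have transpose: "\<exists>g'\<in>Hom A X (FO H M). \<theta> M \<bullet>\<^bsub>B\<^esub> FA E g' = g"
    if g: "g \<in> Hom B (FO E X) M" and X: "X \<in> Obj A" for g X M
  proof -
    have M: "M \<in> Obj B" using g E.B.Hom_Obj by blast
    have \<theta>M: "\<theta> M \<in> Hom B (FO E (FO H M)) M" using nat_isoD(3)[OF \<theta> M] by simp
    obtain k where k: "inverse_arrows B (\<theta> M) k" using nat_isoD(5)[OF \<theta> M] by blast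
    note kM = E.B.inverse_arrowsD[OF k \<theta>M]
    obtain g' where g': "g' \<in> Hom A X (FO H M)" "FA E g' = k \<bullet>\<^bsub>B\<^esub> g"
      using equivalence_functor_full[OF E X H.FO_Obj[OF M] E.B.Comp_Hom[OF g kM(1)]] by blast
    have "\<theta> M \<bullet>\<^bsub>B\<^esub> FA E g' = g"
      using E.B.Comp_assoc[OF g kM(1) \<theta>M] g'(2) kM(3) E.B.Ident_left[OF g] by simp
    then show ?thesis using g'(1) by blast
  qed
  have transpose_inj: "f = g" if fg: "f \<in> Hom A X (FO H M)" "g \<in> Hom A X (FO H M)"
    and eq: "\<theta> M \<bullet>\<^bsub>B\<^esub> FA E f = \<theta> M \<bullet>\<^bsub>B\<^esub> FA E g" and M: "M \<in> Obj B" for f g X M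
  proof -
    have \<theta>M: "\<theta> M \<in> Hom B (FO E (FO H M)) M" using nat_isoD(3)[OF \<theta> M] by simp
    obtain k where k: "inverse_arrows B (\<theta> M) k" using nat_isoD(5)[OF \<theta> M] by blast
    note kM = E.B.inverse_arrowsD[OF k \<theta>M]
    have "FA E f = FA E g"
      using E.B.comp_cancel_left[OF eq kM(2) kM(1) \<theta>M E.FA_Hom[OF fg(1)] E.FA_Hom[OF fg(2)]] .
    then show ?thesis using equivalence_functor_faithful[OF E fg] by blast
  qed
  have \<theta>_comp: "\<theta> M \<bullet>\<^bsub>B\<^esub> FA E (g \<bullet>\<^bsub>A\<^esub> f) = (\<theta> M \<bullet>\<^bsub>B\<^esub> FA E g) \<bullet>\<^bsub>B\<^esub> FA E f"
    if "f \<in> Hom A X Y" "g \<in> Hom A Y (FO H M)" "M \<in> Obj B" for f g X Y M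
  proof -
    have \<theta>M: "\<theta> M \<in> Hom B (FO E (FO H M)) M" using nat_isoD(3)[OF \<theta> that(3)] by simp
    show ?thesis
      using E.FA_Comp[OF that(1,2)] E.B.Comp_assoc[OF E.FA_Hom[OF that(1)] E.FA_Hom[OF that(2)] \<theta>M]
      by simp
  qed
  show ?thesis
  proof (rule E.B.is_colimitI)
    show "cat_functor I B (comp_func E G)"
      using cat_functor_comp[OF G.cat_functor_axioms E.cat_functor_axioms] .
    show "cocone I B (comp_func E G) (FO E L) (\<lambda>i. FA E (\<mu> i))"
      using cocone_image[OF E.A.is_colimitD(2)[OF L] G.cat_functor_axioms E.cat_functor_axioms] .
    fix M
    show "\<exists>h\<in>Hom B (FO E L) M. \<forall>i\<in>Obj I. h \<bullet>\<^bsub>B\<^esub> FA E (\<mu> i) = \<nu> i"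
      if c: "cocone I B (comp_func E G) M \<nu>" for \<nu>
    proof -
      have M: "M \<in> Obj B" using c by (simp add: cocone_def)
      have \<theta>M: "\<theta> M \<in> Hom B (FO E (FO H M)) M" using nat_isoD(3)[OF \<theta> M] by simp
      have "\<exists>g'. i \<in> Obj I \<longrightarrow> g' \<in> Hom A (FO G i) (FO H M) \<and> \<theta> M \<bullet>\<^bsub>B\<^esub> FA E g' = \<nu> i" for i
      proof (cases "i \<in> Obj I")
        case True
        then have "\<nu> i \<in> Hom B (FO E (FO G i)) M" using c by (simp add: cocone_def)
        from transpose[OF this G.FO_Obj[OF True]] show ?thesis by blast
      qed simp
      then obtain \<nu>' where \<nu>': "\<And>i. i \<in> Obj I \<Longrightarrow> \<nu>' i \<in> Hom A (FO G i) (FO H M)"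
        "\<And>i. i \<in> Obj I \<Longrightarrow> \<theta> M \<bullet>\<^bsub>B\<^esub> FA E (\<nu>' i) = \<nu> i" by metis
      have "\<nu>' (Cod I u) \<bullet>\<^bsub>A\<^esub> FA G u = \<nu>' (Dom I u)" if u: "u \<in> Arr I" for u
      proof (rule transpose_inj[OF _ _ _ M])
        have ij: "Dom I u \<in> Obj I" "Cod I u \<in> Obj I"
          using u G.A.Dom_Obj G.A.Cod_Obj by auto
        have Gu: "FA G u \<in> Hom A (FO G (Dom I u)) (FO G (Cod I u))"
          using G.FA_Hom[OF Arr_Hom[OF u]] .
        show "\<nu>' (Cod I u) \<bullet>\<^bsub>A\<^esub> FA G u \<in> Hom A (FO G (Dom I u)) (FO H M)"
          using Gu \<nu>'(1)[OF ij(2)] E.A.Comp_Hom by blast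
        show "\<nu>' (Dom I u) \<in> Hom A (FO G (Dom I u)) (FO H M)" using \<nu>'(1)[OF ij(1)] .
        have "\<nu> (Cod I u) \<bullet>\<^bsub>B\<^esub> FA E (FA G u) = \<nu> (Dom I u)"
          using c u by (simp add: cocone_def)
        then show "\<theta> M \<bullet>\<^bsub>B\<^esub> FA E (\<nu>' (Cod I u) \<bullet>\<^bsub>A\<^esub> FA G u) = \<theta> M \<bullet>\<^bsub>B\<^esub> FA E (\<nu>' (Dom I u))"
          using \<theta>_comp[OF Gu \<nu>'(1)[OF ij(2)] M] \<nu>'(2) ij by simp
      qed
      then have "cocone I A G (FO H M) \<nu>'"
        using \<nu>'(1) H.FO_Obj[OF M] by (simp add: cocone_def)
      from E.A.is_colimit_factor[OF L this] obtain h where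
        h: "h \<in> Hom A L (FO H M)" "\<And>i. i \<in> Obj I \<Longrightarrow> h \<bullet>\<^bsub>A\<^esub> \<mu> i = \<nu>' i" by blast
      have "(\<theta> M \<bullet>\<^bsub>B\<^esub> FA E h) \<bullet>\<^bsub>B\<^esub> FA E (\<mu> i) = \<nu> i" if i: "i \<in> Obj I" for i
        using \<theta>_comp[OF \<mu>[OF i] h(1) M] h(2)[OF i] \<nu>'(2)[OF i] by simp
      then show ?thesis using E.B.Comp_Hom[OF E.FA_Hom[OF h(1)] \<theta>M] by blast
    qed
    show "f = g" if fg: "f \<in> Hom B (FO E L) M" "g \<in> Hom B (FO E L) M"
      and eq: "\<And>i. i \<in> Obj I \<Longrightarrow> f \<bullet>\<^bsub>B\<^esub> FA E (\<mu> i) = g \<bullet>\<^bsub>B\<^esub> FA E (\<mu> i)" for f g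
    proof -
      have M: "M \<in> Obj B" using fg E.B.Hom_Obj by blast
      note LO = E.A.is_colimitD(3)[OF L]
      obtain f' where f': "f' \<in> Hom A L (FO H M)" "\<theta> M \<bullet>\<^bsub>B\<^esub> FA E f' = f"
        using transpose[OF fg(1) LO] by blast
      obtain g' where g': "g' \<in> Hom A L (FO H M)" "\<theta> M \<bullet>\<^bsub>B\<^esub> FA E g' = g"
        using transpose[OF fg(2) LO] by blast
      have "f' = g'"
      proof (rule E.A.is_colimit_eq[OF L f'(1) g'(1)])
        fix i assume i: "i \<in> Obj I"
        show "f' \<bullet>\<^bsub>A\<^esub> \<mu> i = g' \<bullet>\<^bsub>A\<^esub> \<mu> i"
          using \<theta>_comp[OF \<mu>[OF i] f'(1) M] \<theta>_comp[OF \<mu>[OF i] g'(1) M] f' g' eq[OF i]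
            E.A.Comp_Hom[OF \<mu>[OF i]]
          by (intro transpose_inj[OF _ _ _ M]) auto
      qed
      then show ?thesis using f'(2) g'(2) by simp
    qed
  qed
qed

text \<open>The diagram in \<open>B\<close> is carried to \<open>A\<close> by the inverse
  \<open>G\<close>, which preserves its colimit, and the hypothesis on \<open>X\<close> is applied
  there. Arrows out of \<open>FO E X\<close> are compared with arrows out of \<open>X\<close> by
  sending \<open>g\<close> to \<open>FA G g \<bullet> \<eta> X\<close>, which is injective by
  \<open>GX\<close>.\<close>

lemma equivalence_functor_compact:
  assumes E: "equivalence_functor A B E" and X: "X \<in> Obj A"
    and hc: "\<And>(I :: ('u, 'u) cat) G L \<mu>. \<lbrakk>small_cat I; filtered I; is_colimit I A G L \<mu>\<rbrakk> \<Longrightarrow>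
      hom_colimit I A G L \<mu> X"
  shows "compact_object TYPE('u) B (FO E X)"
proof -
  interpret E: cat_functor A B E using E by (simp add: equivalence_functor_def)
  obtain G \<eta> \<theta> where G: "equivalence_functor B A G"
    and \<eta>: "nat_iso A A id_func (comp_func G E) \<eta>"
    using equivalence_functor_inverse[OF E] .
  interpret G: cat_functor B A G using G by (simp add: equivalence_functor_def)
  obtain k where k: "inverse_arrows A (\<eta> X) k" using nat_isoD(5)[OF \<eta> X] by blast
  have \<eta>X: "\<eta> X \<in> Hom A X (FO G (FO E X))" using nat_isoD(3)[OF \<eta> X] by simp
  note kX = E.A.inverse_arrowsD[OF k \<eta>X]
  have assoc: "(f \<bullet>\<^bsub>A\<^esub> g) \<bullet>\<^bsub>A\<^esub> \<eta> X = f \<bullet>\<^bsub>A\<^esub> (g \<bullet>\<^bsub>A\<^esub> \<eta> X)"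
    if "g \<in> Hom A (FO G (FO E X)) Y" "f \<in> Hom A Y Z" for f g Y Z
    using E.A.Comp_assoc[OF \<eta>X that] by simp
  have GX: "FA G f \<bullet>\<^bsub>A\<^esub> \<eta> X = FA G g \<bullet>\<^bsub>A\<^esub> \<eta> X \<Longrightarrow> f = g"
    if fg: "f \<in> Hom B (FO E X) Y" "g \<in> Hom B (FO E X) Y" for f g Y
    using equivalence_functor_faithful[OF G fg]
      E.A.comp_cancel_right[OF _ kX(3) kX(1) \<eta>X G.FA_Hom[OF fg(1)] G.FA_Hom[OF fg(2)]] by blast
  show ?thesis
  proof (rule E.B.compact_objectI[OF E.FO_Obj[OF X]])
    fix I :: "('u, 'u) cat" and H L \<mu>
    assume I: "small_cat I" "filtered I" and L: "is_colimit I B H L \<mu>"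
    interpret H: cat_functor I B H by (rule E.B.is_colimitD(1)[OF L])
    have \<mu>: "\<mu> i \<in> Hom B (FO H i) L" if "i \<in> Obj I" for i using E.B.is_colimitD(4)[OF L that] .
    note h = hc[OF I equivalence_functor_colimit[OF G L]]
    show "hom_colimit I B H L \<mu> (FO E X)"
      unfolding hom_colimit_def
    proof (intro conjI ballI impI)
      fix g assume g: "g \<in> Hom B (FO E X) L"
      obtain i g' where i: "i \<in> Obj I" and g': "g' \<in> Hom A X (FO G (FO H i))"
        and eq: "FA G g \<bullet>\<^bsub>A\<^esub> \<eta> X = FA G (\<mu> i) \<bullet>\<^bsub>A\<^esub> g'"
        using hom_colimit_factor[OF h E.A.Comp_Hom[OF \<eta>X G.FA_Hom[OF g]]] by (auto simp: comp_func_def)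
      obtain g'' where g'': "g'' \<in> Hom B (FO E X) (FO H i)" "FA G g'' = g' \<bullet>\<^bsub>A\<^esub> k"
        using equivalence_functor_full[OF G E.FO_Obj[OF X] H.FO_Obj[OF i] E.A.Comp_Hom[OF kX(1) g']] .
      have "FA G g'' \<bullet>\<^bsub>A\<^esub> \<eta> X = g'"
        using g''(2) E.A.Comp_assoc[OF \<eta>X kX(1) g'] kX(2) E.A.Ident_right[OF g'] by simp
      then have "FA G (\<mu> i \<bullet>\<^bsub>B\<^esub> g'') \<bullet>\<^bsub>A\<^esub> \<eta> X = FA G g \<bullet>\<^bsub>A\<^esub> \<eta> X"
        using G.FA_Comp[OF g''(1) \<mu>[OF i]] eq
          assoc[OF G.FA_Hom[OF g''(1)] G.FA_Hom[OF \<mu>[OF i]]] by simp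
      then have "g = \<mu> i \<bullet>\<^bsub>B\<^esub> g''"
        using GX[OF E.B.Comp_Hom[OF g''(1) \<mu>[OF i]] g] by simp
      then show "\<exists>i\<in>Obj I. \<exists>g'\<in>Hom B (FO E X) (FO H i). g = \<mu> i \<bullet>\<^bsub>B\<^esub> g'"
        using i g'' by blast
    next
      fix i g g'
      assume i: "i \<in> Obj I" and g: "g \<in> Hom B (FO E X) (FO H i)" and g': "g' \<in> Hom B (FO E X) (FO H i)"
        and eq: "\<mu> i \<bullet>\<^bsub>B\<^esub> g = \<mu> i \<bullet>\<^bsub>B\<^esub> g'"
      have G\<mu>: "FA G (f \<bullet>\<^bsub>B\<^esub> p) \<bullet>\<^bsub>A\<^esub> \<eta> X = FA G f \<bullet>\<^bsub>A\<^esub> (FA G p \<bullet>\<^bsub>A\<^esub> \<eta> X)"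
        if "p \<in> Hom B (FO E X) (FO H i)" "f \<in> Hom B (FO H i) Z" for f p Z
        using G.FA_Comp[OF that] assoc[OF G.FA_Hom[OF that(1)] G.FA_Hom[OF that(2)]] by simp
      obtain l u where l: "l \<in> Obj I" and u: "u \<in> Hom I i l"
        and eq': "FA G (FA H u) \<bullet>\<^bsub>A\<^esub> (FA G g \<bullet>\<^bsub>A\<^esub> \<eta> X) = FA G (FA H u) \<bullet>\<^bsub>A\<^esub> (FA G g' \<bullet>\<^bsub>A\<^esub> \<eta> X)"
      proof (rule hom_colimit_eq[OF h i])
        show "FA G g \<bullet>\<^bsub>A\<^esub> \<eta> X \<in> Hom A X (FO (comp_func G H) i)"
          "FA G g' \<bullet>\<^bsub>A\<^esub> \<eta> X \<in> Hom A X (FO (comp_func G H) i)"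
          using E.A.Comp_Hom[OF \<eta>X G.FA_Hom[OF g]] E.A.Comp_Hom[OF \<eta>X G.FA_Hom[OF g']] by simp_all
        show "FA G (\<mu> i) \<bullet>\<^bsub>A\<^esub> (FA G g \<bullet>\<^bsub>A\<^esub> \<eta> X) = FA G (\<mu> i) \<bullet>\<^bsub>A\<^esub> (FA G g' \<bullet>\<^bsub>A\<^esub> \<eta> X)"
          using G\<mu>[OF g \<mu>[OF i]] G\<mu>[OF g' \<mu>[OF i]] eq by simp
      qed (use that in \<open>auto simp: comp_func_def\<close>)
      have "FA H u \<bullet>\<^bsub>B\<^esub> g = FA H u \<bullet>\<^bsub>B\<^esub> g'"
        using GX[OF E.B.Comp_Hom[OF g H.FA_Hom[OF u]] E.B.Comp_Hom[OF g' H.FA_Hom[OF u]]]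
          G\<mu>[OF g H.FA_Hom[OF u]] G\<mu>[OF g' H.FA_Hom[OF u]] eq' by simp
      then show "\<exists>k\<in>Obj I. \<exists>u\<in>Hom I i k. FA H u \<bullet>\<^bsub>B\<^esub> g = FA H u \<bullet>\<^bsub>B\<^esub> g'"
        using l u by blast
    qed
  qed
qed

section \<open>Presheaves\<close>

lemma func_cat_sel [simp]:
  "Obj (func_cat A B) = {F. cat_functor A B F}"
  "Dom (func_cat A B) = fst" "Cod (func_cat A B) = fst \<circ> snd"
  "Ident (func_cat A B) F = (F, F, \<lambda>X\<in>Obj A. Ident B (FO F X))"
  "Comp (func_cat A B) (F', G', \<theta>) (F, G, \<eta>) = (F, G', \<lambda>X\<in>Obj A. \<theta> X \<bullet>\<^bsub>B\<^esub> \<eta> X)"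
  by (simp_all add: func_cat_def)

lemma Hom_func_cat:
  "h \<in> Hom (func_cat A B) F G \<longleftrightarrow>
    (\<exists>\<eta>. h = (F, G, \<eta>) \<and> nat_trans A B F G \<eta> \<and> \<eta> \<in> extensional (Obj A))"
  by (auto simp: Hom_def func_cat_def)

lemma nat_transD:
  assumes "nat_trans A B F G \<eta>"
  shows "cat_functor A B F" "cat_functor A B G"
    "X \<in> Obj A \<Longrightarrow> \<eta> X \<in> Hom B (FO F X) (FO G X)"
    "f \<in> Hom A X Y \<Longrightarrow> FA G f \<bullet>\<^bsub>B\<^esub> \<eta> X = \<eta> Y \<bullet>\<^bsub>B\<^esub> FA F f"
proof -
  show "cat_functor A B F" "cat_functor A B G"
    "X \<in> Obj A \<Longrightarrow> \<eta> X \<in> Hom B (FO F X) (FO G X)"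
    using assms unfolding nat_trans_def by blast+
  have "\<forall>f\<in>Arr A. FA G f \<bullet>\<^bsub>B\<^esub> \<eta> (Dom A f) = \<eta> (Cod A f) \<bullet>\<^bsub>B\<^esub> FA F f"
    using assms unfolding nat_trans_def by blast
  then show "f \<in> Hom A X Y \<Longrightarrow> FA G f \<bullet>\<^bsub>B\<^esub> \<eta> X = \<eta> Y \<bullet>\<^bsub>B\<^esub> FA F f"
    unfolding Hom_def by blast
qed

lemma nat_transI:
  assumes "cat_functor A B F" "cat_functor A B G"
    "\<And>X. X \<in> Obj A \<Longrightarrow> \<eta> X \<in> Hom B (FO F X) (FO G X)"
    "\<And>f X Y. f \<in> Hom A X Y \<Longrightarrow> FA G f \<bullet>\<^bsub>B\<^esub> \<eta> X = \<eta> Y \<bullet>\<^bsub>B\<^esub> FA F f"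
  shows "nat_trans A B F G \<eta>"
  using assms(1-3) assms(4)[OF Arr_Hom[of _ A]] by (simp add: nat_trans_def)

lemma nat_trans_Ident:
  assumes "cat_functor A B F"
  shows "nat_trans A B F F (\<lambda>X\<in>Obj A. Ident B (FO F X))"
proof -
  interpret F: cat_functor A B F by fact
  show ?thesis
  proof (rule nat_transI[OF assms assms])
    fix f X Y assume f: "f \<in> Hom A X Y"
    show "FA F f \<bullet>\<^bsub>B\<^esub> (\<lambda>X\<in>Obj A. Ident B (FO F X)) X = (\<lambda>X\<in>Obj A. Ident B (FO F X)) Y \<bullet>\<^bsub>B\<^esub> FA F f"
      using F.A.Hom_Obj[OF f] F.B.Ident_left[OF F.FA_Hom[OF f]] F.B.Ident_right[OF F.FA_Hom[OF f]]
      by simp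
  qed (simp add: F.B.Ident_Hom F.FO_Obj)
qed

lemma nat_trans_Comp:
  assumes \<eta>: "nat_trans A B F G \<eta>" and \<theta>: "nat_trans A B G H \<theta>"
  shows "nat_trans A B F H (\<lambda>X\<in>Obj A. \<theta> X \<bullet>\<^bsub>B\<^esub> \<eta> X)"
proof (rule nat_transI)
  interpret F: cat_functor A B F by (rule nat_transD(1)[OF \<eta>])
  interpret H: cat_functor A B H by (rule nat_transD(2)[OF \<theta>])
  interpret G: cat_functor A B G by (rule nat_transD(2)[OF \<eta>])
  show "cat_functor A B F" "cat_functor A B H" by unfold_locales
  show "(\<lambda>X\<in>Obj A. \<theta> X \<bullet>\<^bsub>B\<^esub> \<eta> X) X \<in> Hom B (FO F X) (FO H X)" if X: "X \<in> Obj A" for X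
    using F.B.Comp_Hom[OF nat_transD(3)[OF \<eta> X] nat_transD(3)[OF \<theta> X]] X by simp
  fix f X Y assume f: "f \<in> Hom A X Y"
  have X: "X \<in> Obj A" "Y \<in> Obj A" using F.A.Hom_Obj[OF f] by auto
  note \<eta>X = nat_transD(3)[OF \<eta> X(1)] and \<eta>Y = nat_transD(3)[OF \<eta> X(2)]
    and \<theta>X = nat_transD(3)[OF \<theta> X(1)] and \<theta>Y = nat_transD(3)[OF \<theta> X(2)]
  have "FA H f \<bullet>\<^bsub>B\<^esub> (\<theta> X \<bullet>\<^bsub>B\<^esub> \<eta> X) = (FA H f \<bullet>\<^bsub>B\<^esub> \<theta> X) \<bullet>\<^bsub>B\<^esub> \<eta> X"
    using F.B.Comp_assoc[OF \<eta>X \<theta>X H.FA_Hom[OF f]] .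
  also have "\<dots> = \<theta> Y \<bullet>\<^bsub>B\<^esub> (FA G f \<bullet>\<^bsub>B\<^esub> \<eta> X)"
    using nat_transD(4)[OF \<theta> f] F.B.Comp_assoc[OF \<eta>X G.FA_Hom[OF f] \<theta>Y] by simp
  also have "\<dots> = (\<theta> Y \<bullet>\<^bsub>B\<^esub> \<eta> Y) \<bullet>\<^bsub>B\<^esub> FA F f"
    using nat_transD(4)[OF \<eta> f] F.B.Comp_assoc[OF F.FA_Hom[OF f] \<eta>Y \<theta>Y] by simp
  finally show "FA H f \<bullet>\<^bsub>B\<^esub> (\<lambda>X\<in>Obj A. \<theta> X \<bullet>\<^bsub>B\<^esub> \<eta> X) X =
      (\<lambda>X\<in>Obj A. \<theta> X \<bullet>\<^bsub>B\<^esub> \<eta> X) Y \<bullet>\<^bsub>B\<^esub> FA F f"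
    using X by simp
qed

lemma category_func_cat: "category (func_cat A B)"
proof
  let ?F = "func_cat A B"
  show "Dom ?F f \<in> Obj ?F" if "f \<in> Arr ?F" for f
    using that by (auto simp: func_cat_def nat_trans_def)
  show "Cod ?F f \<in> Obj ?F" if "f \<in> Arr ?F" for f
    using that by (auto simp: func_cat_def nat_trans_def)
  show "Ident ?F X \<in> Hom ?F X X" if "X \<in> Obj ?F" for X
    using that nat_trans_Ident[of A B X] by (auto simp: Hom_func_cat)
  show "Comp ?F g f \<in> Hom ?F X Z" if "f \<in> Hom ?F X Y" "g \<in> Hom ?F Y Z" for f g X Y Z
    using that nat_trans_Comp by (fastforce simp: Hom_func_cat)
  show "Comp ?F (Ident ?F Y) f = f" if f: "f \<in> Hom ?F X Y" for f X Y
  proof -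
    obtain \<eta> where \<eta>: "f = (X, Y, \<eta>)" "nat_trans A B X Y \<eta>" "\<eta> \<in> extensional (Obj A)"
      using f by (auto simp: Hom_func_cat)
    interpret Y: cat_functor A B Y by (rule nat_transD(2)[OF \<eta>(2)])
    have "(\<lambda>Z\<in>Obj A. (\<lambda>Z\<in>Obj A. Ident B (FO Y Z)) Z \<bullet>\<^bsub>B\<^esub> \<eta> Z) = \<eta>"
      using Y.B.Ident_left[OF nat_transD(3)[OF \<eta>(2)]]
      by (intro extensionalityI[OF _ \<eta>(3)]) auto
    then show ?thesis using \<eta>(1) by simp
  qed
  show "Comp ?F f (Ident ?F X) = f" if f: "f \<in> Hom ?F X Y" for f X Y
  proof -
    obtain \<eta> where \<eta>: "f = (X, Y, \<eta>)" "nat_trans A B X Y \<eta>" "\<eta> \<in> extensional (Obj A)"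
      using f by (auto simp: Hom_func_cat)
    interpret Y: cat_functor A B Y by (rule nat_transD(2)[OF \<eta>(2)])
    have "(\<lambda>Z\<in>Obj A. \<eta> Z \<bullet>\<^bsub>B\<^esub> (\<lambda>Z\<in>Obj A. Ident B (FO X Z)) Z) = \<eta>"
      using Y.B.Ident_right[OF nat_transD(3)[OF \<eta>(2)]]
      by (intro extensionalityI[OF _ \<eta>(3)]) auto
    then show ?thesis using \<eta>(1) by simp
  qed
  show "Comp ?F h (Comp ?F g f) = Comp ?F (Comp ?F h g) f"
    if f: "f \<in> Hom ?F W X" and g: "g \<in> Hom ?F X Y" and h: "h \<in> Hom ?F Y Z" for f g h W X Y Z
  proof -
    obtain \<eta> where \<eta>: "f = (W, X, \<eta>)" "nat_trans A B W X \<eta>"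
      using f by (auto simp: Hom_func_cat)
    obtain \<theta> where \<theta>: "g = (X, Y, \<theta>)" "nat_trans A B X Y \<theta>"
      using g by (auto simp: Hom_func_cat)
    obtain \<kappa> where \<kappa>: "h = (Y, Z, \<kappa>)" "nat_trans A B Y Z \<kappa>"
      using h by (auto simp: Hom_func_cat)
    interpret Y: cat_functor A B Y by (rule nat_transD(2)[OF \<theta>(2)])
    show ?thesis
      using Y.B.Comp_assoc[OF nat_transD(3)[OF \<eta>(2)] nat_transD(3)[OF \<theta>(2)] nat_transD(3)[OF \<kappa>(2)]]
      by (auto simp: \<eta>(1) \<theta>(1) \<kappa>(1) fun_eq_iff)
  qed
qed

lemma op_cat_sel [simp]:
  "Obj (op_cat C) = Obj C" "Arr (op_cat C) = Arr C" "Dom (op_cat C) = Cod C" "Cod (op_cat C) = Dom C"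
  "Ident (op_cat C) = Ident C" "Comp (op_cat C) g f = f \<bullet>\<^bsub>C\<^esub> g"
  by (simp_all add: op_cat_def)

lemma Hom_op_cat [simp]: "Hom (op_cat C) X Y = Hom C Y X"
  by (auto simp: Hom_def)

lemma (in category) category_op_cat: "category (op_cat C)"
  by unfold_locales
    (auto simp: Dom_Obj Cod_Obj Ident_Hom Ident_left Ident_right Comp_assoc[symmetric] intro: Comp_Hom)

text \<open>The restriction map of \<open>P\<close> along \<open>f\<close> as a bare function. Like
  \<open>pcomp\<close>, the component of a morphism of presheaves, it drops the source and target
  sets that arrows of \<open>set_cat\<close> carry.\<close>

definition pact :: "('o, 'a, 's set, 's set \<times> 's set \<times> ('s \<Rightarrow> 's)) func \<Rightarrow> 'a \<Rightarrow> 's \<Rightarrow> 's" where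
  "pact P f = snd (snd (FA P f))"

definition pcomp :: "'p \<times> 'q \<times> ('o \<Rightarrow> 's set \<times> 's set \<times> ('s \<Rightarrow> 's)) \<Rightarrow> 'o \<Rightarrow> 's \<Rightarrow> 's" where
  "pcomp h c = snd (snd (snd (snd h) c))"

section \<open>Presheaves on \<open>C\<close> and the Yoneda lemma\<close>

locale presheaves = category C for C :: "('u, 'u, 'x) cat_scheme" (structure)
begin

abbreviation psh where "psh \<equiv> psh_cat C"
abbreviation yo where "yo \<equiv> FO (yoneda C)"
abbreviation ya where "ya \<equiv> FA (yoneda C)"

sublocale psh: category psh
  unfolding psh_cat_def by (rule category_func_cat)

lemma psh_Obj: "P \<in> Obj psh \<longleftrightarrow> cat_functor (op_cat C) set_cat P"
  by (simp add: psh_cat_def)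

lemma FA_psh:
  assumes P: "P \<in> Obj psh" and f: "f \<in> Hom C c d"
  shows "FA P f = (FO P d, FO P c, pact P f)" "pact P f \<in> FO P d \<rightarrow>\<^sub>E FO P c"
proof -
  interpret P: cat_functor "op_cat C" set_cat P using P by (simp add: psh_Obj)
  have "FA P f \<in> Hom set_cat (FO P d) (FO P c)" using f by (intro P.FA_Hom) simp
  then show "FA P f = (FO P d, FO P c, pact P f)" "pact P f \<in> FO P d \<rightarrow>\<^sub>E FO P c"
    by (auto simp: Hom_set_cat pact_def)
qed

lemma pact_mem: "P \<in> Obj psh \<Longrightarrow> f \<in> Hom C c d \<Longrightarrow> x \<in> FO P d \<Longrightarrow> pact P f x \<in> FO P c"
  by (rule PiE_mem[OF FA_psh(2)])

lemma pact_Ident: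
  assumes P: "P \<in> Obj psh" and c: "c \<in> Obj C" "x \<in> FO P c"
  shows "pact P (Ident C c) x = x"
proof -
  interpret P: cat_functor "op_cat C" set_cat P using P by (simp add: psh_Obj)
  have "FA P (Ident C c) = (FO P c, FO P c, \<lambda>x\<in>FO P c. x)" using P.FA_Ident[of c] c(1) by simp
  then show ?thesis using c(2) by (simp add: pact_def)
qed

lemma pact_Comp:
  assumes P: "P \<in> Obj psh" and f: "f \<in> Hom C c d" and g: "g \<in> Hom C d e" and x: "x \<in> FO P e"
  shows "pact P (g \<bullet> f) x = pact P f (pact P g x)"
proof -
  interpret P: cat_functor "op_cat C" set_cat P using P by (simp add: psh_Obj)
  have "FA P (g \<bullet> f) = Comp set_cat (FA P f) (FA P g)"
    using P.FA_Comp[of g e d f c] f g by simp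
  then have "pact P (g \<bullet> f) = compose (FO P e) (pact P f) (pact P g)"
    by (simp add: FA_psh(1)[OF P f] FA_psh(1)[OF P g] FA_psh(1)[OF P Comp_Hom[OF f g]])
  then show ?thesis using x by (simp add: compose_def)
qed

text \<open>The maps of \<open>set_cat\<close> have to be extensional; this is arranged here once,
  so that \<open>act\<close> may be arbitrary outside the sets \<open>Q c\<close>. The lemma
  \<open>psh_HomI\<close> does the same for morphisms.\<close>

lemma psh_ObjI:
  assumes mem: "\<And>f c d x. f \<in> Hom C c d \<Longrightarrow> x \<in> Q d \<Longrightarrow> act f x \<in> Q c"
    and ident: "\<And>c x. c \<in> Obj C \<Longrightarrow> x \<in> Q c \<Longrightarrow> act (Ident C c) x = x"
    and comp: "\<And>f g c d e x. f \<in> Hom C c d \<Longrightarrow> g \<in> Hom C d e \<Longrightarrow> x \<in> Q e \<Longrightarrow>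
      act (g \<bullet> f) x = act f (act g x)"
  obtains P where "P \<in> Obj psh" "\<And>c. FO P c = Q c"
    "\<And>f c d x. f \<in> Hom C c d \<Longrightarrow> x \<in> Q d \<Longrightarrow> pact P f x = act f x"
proof -
  define P where "P = \<lparr>FO = Q, FA = (\<lambda>f. (Q (Cod C f), Q (Dom C f), \<lambda>x\<in>Q (Cod C f). act f x))\<rparr>"
  have "cat_functor (op_cat C) set_cat P"
  proof (intro cat_functor.intro category_op_cat category_set_cat cat_functor_axioms.intro)
    show "FO P X \<in> Obj set_cat" for X by simp
    show "FA P f \<in> Hom set_cat (FO P X) (FO P Y)" if "f \<in> Hom (op_cat C) X Y" for f X Y
      using that mem[of f Y X] by (auto simp: P_def Hom_set_cat Hom_def[of C Y X])
    show "FA P (Ident (op_cat C) X) = Ident set_cat (FO P X)" if "X \<in> Obj (op_cat C)" for X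
      using that ident[of X] by (auto simp: P_def Ident_seq fun_eq_iff)
    show "FA P (Comp (op_cat C) g f) = Comp set_cat (FA P g) (FA P f)"
      if "f \<in> Hom (op_cat C) X Y" "g \<in> Hom (op_cat C) Y Z" for f g X Y Z
    proof -
      have fg: "f \<in> Hom C Y X" "g \<in> Hom C Z Y" using that by auto
      have "Dom C f = Y" "Cod C f = X" "Dom C g = Z" "Cod C g = Y"
        "Dom C (f \<bullet> g) = Z" "Cod C (f \<bullet> g) = X"
        using fg by (auto simp: Hom_def Comp_seq)
      then show ?thesis
        using comp[OF fg(2,1)] mem[OF fg(1)] by (auto simp: P_def fun_eq_iff compose_def)
    qed
  qed
  then have "P \<in> Obj psh" by (simp add: psh_Obj)
  moreover have "FO P c = Q c" for c by (simp add: P_def)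
  moreover have "pact P f x = act f x" if "f \<in> Hom C c d" "x \<in> Q d" for f c d x
    using that by (auto simp: P_def pact_def Hom_def)
  ultimately show thesis using that by blast
qed

lemma psh_Hom_comp:
  assumes h: "h \<in> Hom psh P M" and c: "c \<in> Obj C"
  shows "snd (snd h) c = (FO P c, FO M c, pcomp h c)" "pcomp h c \<in> FO P c \<rightarrow>\<^sub>E FO M c"
proof -
  obtain \<eta> where \<eta>: "h = (P, M, \<eta>)" "nat_trans (op_cat C) set_cat P M \<eta>"
    using h by (auto simp: psh_cat_def Hom_func_cat)
  have "\<eta> c \<in> Hom set_cat (FO P c) (FO M c)" using nat_transD(3)[OF \<eta>(2)] c by simp
  then show "snd (snd h) c = (FO P c, FO M c, pcomp h c)" "pcomp h c \<in> FO P c \<rightarrow>\<^sub>E FO M c"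
    by (auto simp: \<eta>(1) Hom_set_cat pcomp_def)
qed

lemma pcomp_mem: "h \<in> Hom psh P M \<Longrightarrow> c \<in> Obj C \<Longrightarrow> x \<in> FO P c \<Longrightarrow> pcomp h c x \<in> FO M c"
  by (rule PiE_mem[OF psh_Hom_comp(2)])

lemma pcomp_natural:
  assumes h: "h \<in> Hom psh P M" and f: "f \<in> Hom C c d" and x: "x \<in> FO P d"
  shows "pcomp h c (pact P f x) = pact M f (pcomp h d x)"
proof -
  have PM: "P \<in> Obj psh" "M \<in> Obj psh" and cd: "c \<in> Obj C" "d \<in> Obj C"
    using psh.Hom_Obj[OF h] Hom_Obj[OF f] by auto
  obtain \<eta> where \<eta>: "h = (P, M, \<eta>)" "nat_trans (op_cat C) set_cat P M \<eta>"
    using h by (auto simp: psh_cat_def Hom_func_cat)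
  have "\<eta> c = (FO P c, FO M c, pcomp h c)" "\<eta> d = (FO P d, FO M d, pcomp h d)"
    using psh_Hom_comp(1)[OF h cd(1)] psh_Hom_comp(1)[OF h cd(2)] \<eta>(1) by simp_all
  moreover have "Comp set_cat (FA M f) (\<eta> d) = Comp set_cat (\<eta> c) (FA P f)"
    using nat_transD(4)[OF \<eta>(2)] f by simp
  ultimately have "compose (FO P d) (pact M f) (pcomp h d) = compose (FO P d) (pcomp h c) (pact P f)"
    by (simp add: FA_psh(1)[OF PM(1) f] FA_psh(1)[OF PM(2) f])
  from fun_cong[OF this, of x] show ?thesis using x by (simp add: compose_def)
qed

lemma psh_HomI:
  assumes P: "P \<in> Obj psh" and M: "M \<in> Obj psh"
    and mem: "\<And>c x. c \<in> Obj C \<Longrightarrow> x \<in> FO P c \<Longrightarrow> t c x \<in> FO M c"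
    and nat: "\<And>f c d x. f \<in> Hom C c d \<Longrightarrow> x \<in> FO P d \<Longrightarrow> t c (pact P f x) = pact M f (t d x)"
  obtains h where "h \<in> Hom psh P M" "\<And>c x. c \<in> Obj C \<Longrightarrow> x \<in> FO P c \<Longrightarrow> pcomp h c x = t c x"
proof -
  define \<eta> where "\<eta> = (\<lambda>c\<in>Obj C. (FO P c, FO M c, \<lambda>x\<in>FO P c. t c x))"
  have "nat_trans (op_cat C) set_cat P M \<eta>"
  proof (rule nat_transI)
    show "cat_functor (op_cat C) set_cat P" "cat_functor (op_cat C) set_cat M"
      using P M by (simp_all add: psh_Obj)
    show "\<eta> X \<in> Hom set_cat (FO P X) (FO M X)" if "X \<in> Obj (op_cat C)" for X
      using that mem by (auto simp: Hom_set_cat \<eta>_def)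
    fix f X Y assume "f \<in> Hom (op_cat C) X Y"
    then have f: "f \<in> Hom C Y X" by simp
    have "compose (FO P X) (pact M f) (\<lambda>x\<in>FO P X. t X x) = compose (FO P X) (\<lambda>x\<in>FO P Y. t Y x) (pact P f)"
      using nat[OF f] pact_mem[OF P f] by (auto simp: compose_def fun_eq_iff)
    then show "Comp set_cat (FA M f) (\<eta> X) = Comp set_cat (\<eta> Y) (FA P f)"
      using Hom_Obj[OF f] by (simp add: FA_psh(1)[OF P f] FA_psh(1)[OF M f] \<eta>_def)
  qed
  then have "(P, M, \<eta>) \<in> Hom psh P M" by (auto simp: psh_cat_def Hom_func_cat \<eta>_def)
  moreover have "pcomp (P, M, \<eta>) c x = t c x" if "c \<in> Obj C" "x \<in> FO P c" for c x
    using that by (simp add: pcomp_def \<eta>_def)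
  ultimately show thesis using that by blast
qed

lemma psh_Hom_eqI:
  assumes h: "h \<in> Hom psh P M" and k: "k \<in> Hom psh P M"
    and eq: "\<And>c x. c \<in> Obj C \<Longrightarrow> x \<in> FO P c \<Longrightarrow> pcomp h c x = pcomp k c x"
  shows "h = k"
proof -
  obtain \<eta> where \<eta>: "h = (P, M, \<eta>)" "\<eta> \<in> extensional (Obj C)"
    using h by (auto simp: psh_cat_def Hom_func_cat)
  obtain \<theta> where \<theta>: "k = (P, M, \<theta>)" "\<theta> \<in> extensional (Obj C)"
    using k by (auto simp: psh_cat_def Hom_func_cat)
  have "\<eta> = \<theta>"
  proof (rule extensionalityI[OF \<eta>(2) \<theta>(2)])
    fix c assume c: "c \<in> Obj C"
    have "pcomp h c = pcomp k c"
      by (rule PiE_ext[OF psh_Hom_comp(2)[OF h c] psh_Hom_comp(2)[OF k c] eq[OF c]])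
    then show "\<eta> c = \<theta> c"
      using psh_Hom_comp(1)[OF h c] psh_Hom_comp(1)[OF k c] \<eta>(1) \<theta>(1) by simp
  qed
  then show ?thesis using \<eta>(1) \<theta>(1) by simp
qed

lemma pcomp_Comp:
  assumes f: "f \<in> Hom psh P M" and g: "g \<in> Hom psh M N" and c: "c \<in> Obj C" "x \<in> FO P c"
  shows "pcomp (g \<bullet>\<^bsub>psh\<^esub> f) c x = pcomp g c (pcomp f c x)"
proof -
  obtain \<eta> where \<eta>: "f = (P, M, \<eta>)" using f by (auto simp: psh_cat_def Hom_func_cat)
  obtain \<theta> where \<theta>: "g = (M, N, \<theta>)" using g by (auto simp: psh_cat_def Hom_func_cat)
  have "\<eta> c = (FO P c, FO M c, pcomp f c)" "\<theta> c = (FO M c, FO N c, pcomp g c)"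
    using psh_Hom_comp(1)[OF f c(1)] psh_Hom_comp(1)[OF g c(1)] \<eta> \<theta> by simp_all
  then show ?thesis
    unfolding pcomp_def[of "g \<bullet>\<^bsub>psh\<^esub> f"] using c by (simp add: \<eta> \<theta> psh_cat_def compose_def)
qed

lemma yo_sel: "FO (yo c) d = Hom C d c"
  by (simp add: yoneda_def hom_presheaf_def)

lemma pact_yo:
  assumes "f \<in> Hom C c d" "g \<in> Hom C d e"
  shows "pact (yo e) f g = g \<bullet> f"
  using assms by (auto simp: yoneda_def hom_presheaf_def pact_def Hom_def)

lemma yo_Obj:
  assumes c: "c \<in> Obj C"
  shows "yo c \<in> Obj psh"
  unfolding psh_Obj
proof (intro cat_functor.intro category_op_cat category_set_cat cat_functor_axioms.intro)
  show "FO (yo c) X \<in> Obj set_cat" for X by simp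
  have FA_yo: "FA (yo c) f = (Hom C X c, Hom C Y c, \<lambda>g\<in>Hom C X c. g \<bullet> f)" if "f \<in> Hom C Y X" for f X Y
    using that by (auto simp: yoneda_def hom_presheaf_def Hom_def)
  show "FA (yo c) f \<in> Hom set_cat (FO (yo c) X) (FO (yo c) Y)" if "f \<in> Hom (op_cat C) X Y" for f X Y
    using that Comp_Hom[of f Y X] by (auto simp: FA_yo Hom_set_cat yo_sel)
  show "FA (yo c) (Ident (op_cat C) X) = Ident set_cat (FO (yo c) X)" if "X \<in> Obj (op_cat C)" for X
    using that Ident_right by (auto simp: FA_yo[OF Ident_Hom] yo_sel fun_eq_iff)
  show "FA (yo c) (Comp (op_cat C) g f) = Comp set_cat (FA (yo c) g) (FA (yo c) f)"
    if "f \<in> Hom (op_cat C) X Y" "g \<in> Hom (op_cat C) Y Z" for f g X Y Z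
    using that Comp_assoc[of g Z Y f X] Comp_Hom[of f Y X]
    by (auto simp: FA_yo FA_yo[OF Comp_Hom] fun_eq_iff compose_def)
qed

text \<open>An arrow \<open>h\<close> with the right components comes from \<open>psh_HomI\<close>.
  Families of components and the components themselves are extensional, so \<open>h\<close> is
  literally \<open>ya f\<close>.\<close>

lemma ya_Hom:
  assumes f: "f \<in> Hom C c d"
  shows "ya f \<in> Hom psh (yo c) (yo d)"
    and "e \<in> Obj C \<Longrightarrow> g \<in> Hom C e c \<Longrightarrow> pcomp (ya f) e g = f \<bullet> g"
proof -
  define \<eta> where "\<eta> = (\<lambda>Y\<in>Obj C. (Hom C Y c, Hom C Y d, \<lambda>g\<in>Hom C Y c. f \<bullet> g))"
  have ya: "ya f = (yo c, yo d, \<eta>)" using f by (simp add: yoneda_def Hom_def \<eta>_def)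
  have cd: "c \<in> Obj C" "d \<in> Obj C" using Hom_Obj[OF f] by auto
  obtain h where h: "h \<in> Hom psh (yo c) (yo d)"
    "\<And>e g. e \<in> Obj C \<Longrightarrow> g \<in> FO (yo c) e \<Longrightarrow> pcomp h e g = f \<bullet> g"
  proof (rule psh_HomI[OF yo_Obj[OF cd(1)] yo_Obj[OF cd(2)], of "\<lambda>e g. f \<bullet> g"])
    show "f \<bullet> g \<in> FO (yo d) e" if "g \<in> FO (yo c) e" for e g
      using that f Comp_Hom by (simp add: yo_sel)
    show "f \<bullet> pact (yo c) p g = pact (yo d) p (f \<bullet> g)"
      if "p \<in> Hom C a b" "g \<in> FO (yo c) b" for p a b g
      using that Comp_assoc[OF that(1) _ f] pact_yo[OF that(1)] Comp_Hom[OF _ f] by (simp add: yo_sel)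
  qed blast
  obtain \<theta> where \<theta>: "h = (yo c, yo d, \<theta>)" "\<theta> \<in> extensional (Obj C)"
    using h by (auto simp: psh_cat_def Hom_func_cat)
  have "\<eta> = \<theta>"
  proof (rule extensionalityI[OF _ \<theta>(2)])
    show "\<eta> \<in> extensional (Obj C)" by (simp add: \<eta>_def)
    fix e assume e: "e \<in> Obj C"
    have "pcomp h e = (\<lambda>g\<in>Hom C e c. f \<bullet> g)"
      using h(2)[OF e] psh_Hom_comp(2)[OF h(1) e]
      by (auto simp: fun_eq_iff yo_sel PiE_iff extensional_def)
    then show "\<eta> e = \<theta> e"
      using psh_Hom_comp(1)[OF h(1) e] \<theta>(1) e by (simp add: \<eta>_def yo_sel)
  qed
  then have "h = ya f" using ya \<theta>(1) by simp
  then show "ya f \<in> Hom psh (yo c) (yo d)"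
    "e \<in> Obj C \<Longrightarrow> g \<in> Hom C e c \<Longrightarrow> pcomp (ya f) e g = f \<bullet> g"
    using h by (simp_all add: yo_sel)
qed

lemma pcomp_Ident:
  assumes "P \<in> Obj psh" "c \<in> Obj C" "x \<in> FO P c"
  shows "pcomp (Ident psh P) c x = x"
  using assms by (simp add: psh_cat_def pcomp_def)

sublocale yoneda: cat_functor C psh "yoneda C"
proof
  show "yo X \<in> Obj psh" if "X \<in> Obj C" for X using yo_Obj[OF that] .
  show "ya f \<in> Hom psh (yo X) (yo Y)" if "f \<in> Hom C X Y" for f X Y using ya_Hom(1)[OF that] .
  show "ya (Ident C X) = Ident psh (yo X)" if X: "X \<in> Obj C" for X
  proof (rule psh_Hom_eqI[OF ya_Hom(1)[OF Ident_Hom[OF X]] psh.Ident_Hom[OF yo_Obj[OF X]]])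
    fix c g assume c: "c \<in> Obj C" "g \<in> FO (yo X) c"
    show "pcomp (ya (Ident C X)) c g = pcomp (Ident psh (yo X)) c g"
      using c ya_Hom(2)[OF Ident_Hom[OF X]] pcomp_Ident[OF yo_Obj[OF X] c] Ident_left
      by (simp add: yo_sel)
  qed
  show "ya (g \<bullet> f) = ya g \<bullet>\<^bsub>psh\<^esub> ya f" if f: "f \<in> Hom C X Y" and g: "g \<in> Hom C Y Z" for f g X Y Z
  proof (rule psh_Hom_eqI[OF ya_Hom(1)[OF Comp_Hom[OF f g]] psh.Comp_Hom[OF ya_Hom(1)[OF f] ya_Hom(1)[OF g]]])
    fix c h assume c: "c \<in> Obj C" "h \<in> FO (yo X) c"
    then have h: "h \<in> Hom C c X" by (simp add: yo_sel)
    show "pcomp (ya (g \<bullet> f)) c h = pcomp (ya g \<bullet>\<^bsub>psh\<^esub> ya f) c h"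
      using pcomp_Comp[OF ya_Hom(1)[OF f] ya_Hom(1)[OF g] c] ya_Hom(2)[OF f c(1) h]
        ya_Hom(2)[OF g c(1) Comp_Hom[OF h f]] ya_Hom(2)[OF Comp_Hom[OF f g] c(1) h]
        Comp_assoc[OF h f g] by simp
  qed
qed

text \<open>The Yoneda correspondence between arrows from \<open>yo c\<close> to \<open>P\<close>
  and elements of \<open>P\<close> at \<open>c\<close>. It is bijective by \<open>ev_inj\<close> and
  \<open>ev_surj\<close> and natural by \<open>ev_ya\<close> and \<open>ev_Comp\<close>. It also
  codes such arrows, which live in a larger type, by elements of \<open>'u\<close>.\<close>

definition ev :: "'u \<Rightarrow> 'u presheaf_arr \<Rightarrow> 'u" where
  "ev c g = pcomp g c (Ident C c)"

lemma Ident_yo: "c \<in> Obj C \<Longrightarrow> Ident C c \<in> FO (yo c) c"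
  by (simp add: yo_sel Ident_Hom)

lemma ev_mem: "c \<in> Obj C \<Longrightarrow> g \<in> Hom psh (yo c) P \<Longrightarrow> ev c g \<in> FO P c"
  unfolding ev_def using pcomp_mem Ident_yo by blast

lemma pcomp_ev:
  assumes g: "g \<in> Hom psh (yo c) P" and f: "f \<in> Hom C d c"
  shows "pcomp g d f = pact P f (ev c g)"
proof -
  have c: "c \<in> Obj C" using Hom_Obj[OF f] by simp
  show ?thesis
    using pcomp_natural[OF g f Ident_yo[OF c]] pact_yo[OF f Ident_Hom[OF c]] Ident_left[OF f]
    by (simp add: ev_def)
qed

lemma ev_inj:
  assumes "c \<in> Obj C" "g \<in> Hom psh (yo c) P" "h \<in> Hom psh (yo c) P" "ev c g = ev c h"
  shows "g = h"
  by (rule psh_Hom_eqI[OF assms(2,3)]) (use assms pcomp_ev in \<open>auto simp: yo_sel\<close>)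

lemma ev_surj:
  assumes P: "P \<in> Obj psh" and c: "c \<in> Obj C" and x: "x \<in> FO P c"
  obtains g where "g \<in> Hom psh (yo c) P" "ev c g = x"
proof -
  obtain g where g: "g \<in> Hom psh (yo c) P"
    "\<And>d f. d \<in> Obj C \<Longrightarrow> f \<in> FO (yo c) d \<Longrightarrow> pcomp g d f = pact P f x"
  proof (rule psh_HomI[OF yo_Obj[OF c] P, of "\<lambda>d f. pact P f x"])
    show "pact P f x \<in> FO P d" if "f \<in> FO (yo c) d" for d f
      using that pact_mem[OF P _ x] by (simp add: yo_sel)
    show "pact P (pact (yo c) f g) x = pact P f (pact P g x)"
      if "f \<in> Hom C d e" "g \<in> FO (yo c) e" for f g d e
      using that pact_yo[OF that(1)] pact_Comp[OF P that(1) _ x] by (simp add: yo_sel)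
  qed blast
  then show thesis
    using that Ident_yo[OF c] c pact_Ident[OF P c x] by (simp add: ev_def)
qed

lemma ev_ya:
  assumes g: "g \<in> Hom psh (yo c) P" and f: "f \<in> Hom C d c"
  shows "ev d (g \<bullet>\<^bsub>psh\<^esub> ya f) = pact P f (ev c g)"
proof -
  have d: "d \<in> Obj C" using Hom_Obj[OF f] by simp
  show ?thesis
    using pcomp_Comp[OF ya_Hom(1)[OF f] g d Ident_yo[OF d]] ya_Hom(2)[OF f d Ident_Hom[OF d]]
      Ident_right[OF f] pcomp_ev[OF g f] by (simp add: ev_def)
qed

lemma ev_Comp:
  assumes "g \<in> Hom psh (yo c) P" "h \<in> Hom psh P M" "c \<in> Obj C"
  shows "ev c (h \<bullet>\<^bsub>psh\<^esub> g) = pcomp h c (ev c g)"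
  using pcomp_Comp[OF assms Ident_yo[OF assms(3)]] by (simp add: ev_def)

lemma ev_of_ya: "f \<in> Hom C c d \<Longrightarrow> ev c (ya f) = f"
  using ya_Hom(2)[of f c d c "Ident C c"] Hom_Obj Ident_Hom Ident_right by (simp add: ev_def)

lemma ya_full:
  assumes c: "c \<in> Obj C" and g: "g \<in> Hom psh (yo c) (yo d)"
  obtains f where "f \<in> Hom C c d" "g = ya f"
proof -
  have f: "ev c g \<in> Hom C c d" using ev_mem[OF c g] by (simp add: yo_sel)
  have "g = ya (ev c g)" using ev_inj[OF c g ya_Hom(1)[OF f]] ev_of_ya[OF f] by simp
  then show thesis using f that by blast
qed

lemma ya_faithful: "f \<in> Hom C c d \<Longrightarrow> g \<in> Hom C c d \<Longrightarrow> ya f = ya g \<Longrightarrow> f = g"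
  using ev_of_ya by metis

text \<open>Every element of \<open>P\<close> at \<open>c\<close> is \<open>ev c g\<close> for some
  arrow \<open>g\<close> out of \<open>yo c\<close>, so testing on these arrows tests all
  components.\<close>

lemma yo_joint_epi:
  assumes h: "h \<in> Hom psh P M" and k: "k \<in> Hom psh P M"
    and eq: "\<And>c g. c \<in> Obj C \<Longrightarrow> g \<in> Hom psh (yo c) P \<Longrightarrow> h \<bullet>\<^bsub>psh\<^esub> g = k \<bullet>\<^bsub>psh\<^esub> g"
  shows "h = k"
proof (rule psh_Hom_eqI[OF h k])
  fix c x assume c: "c \<in> Obj C" and x: "x \<in> FO P c"
  obtain g where g: "g \<in> Hom psh (yo c) P" "ev c g = x"
    using ev_surj[OF _ c x] psh.Hom_Obj[OF h] by blast
  show "pcomp h c x = pcomp k c x"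
    using ev_Comp[OF g(1) h c] ev_Comp[OF g(1) k c] eq[OF c g(1)] g(2) by simp
qed

text \<open>Density of the representables: under the bijection \<open>ev\<close>, with inverse
  \<open>\<gamma>\<close>, the family \<open>\<phi>\<close> becomes a family of maps from
  \<open>P\<close> to \<open>M\<close> at each object, and the hypothesis on \<open>ya f\<close>
  becomes naturality. Presheaf morphisms can thus be built from arrows alone.\<close>

lemma yo_dense:
  assumes P: "P \<in> Obj psh" and M: "M \<in> Obj psh"
    and mem: "\<And>c g. c \<in> Obj C \<Longrightarrow> g \<in> Hom psh (yo c) P \<Longrightarrow> \<phi> c g \<in> Hom psh (yo c) M"
    and nat: "\<And>c d f g. f \<in> Hom C d c \<Longrightarrow> g \<in> Hom psh (yo c) P \<Longrightarrow>
      \<phi> d (g \<bullet>\<^bsub>psh\<^esub> ya f) = \<phi> c g \<bullet>\<^bsub>psh\<^esub> ya f"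
  obtains h where "h \<in> Hom psh P M"
    "\<And>c g. c \<in> Obj C \<Longrightarrow> g \<in> Hom psh (yo c) P \<Longrightarrow> h \<bullet>\<^bsub>psh\<^esub> g = \<phi> c g"
proof -
  define \<gamma> where "\<gamma> c x = (SOME g. g \<in> Hom psh (yo c) P \<and> ev c g = x)" for c x
  have \<gamma>: "\<gamma> c x \<in> Hom psh (yo c) P" "ev c (\<gamma> c x) = x" if "c \<in> Obj C" "x \<in> FO P c" for c x
  proof -
    have "\<exists>g. g \<in> Hom psh (yo c) P \<and> ev c g = x" using ev_surj[OF P that] by blast
    from someI_ex[OF this] show "\<gamma> c x \<in> Hom psh (yo c) P" "ev c (\<gamma> c x) = x"
      by (simp_all add: \<gamma>_def)
  qed
  have \<gamma>_ev: "\<gamma> c (ev c g) = g" if "c \<in> Obj C" "g \<in> Hom psh (yo c) P" for c g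
    using ev_inj[OF that(1) _ that(2)] \<gamma>[OF that(1) ev_mem[OF that]] by blast
  obtain h where h: "h \<in> Hom psh P M"
    "\<And>c x. c \<in> Obj C \<Longrightarrow> x \<in> FO P c \<Longrightarrow> pcomp h c x = ev c (\<phi> c (\<gamma> c x))"
  proof (rule psh_HomI[OF P M, of "\<lambda>c x. ev c (\<phi> c (\<gamma> c x))"])
    show "ev c (\<phi> c (\<gamma> c x)) \<in> FO M c" if "c \<in> Obj C" "x \<in> FO P c" for c x
      using ev_mem[OF that(1) mem[OF that(1) \<gamma>(1)[OF that]]] .
    fix f d c x assume f: "f \<in> Hom C d c" and x: "x \<in> FO P c"
    have c: "c \<in> Obj C" and d: "d \<in> Obj C" using Hom_Obj[OF f] by auto
    note g = \<gamma>[OF c x]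
    have "\<gamma> d (pact P f x) = \<gamma> c x \<bullet>\<^bsub>psh\<^esub> ya f"
      using \<gamma>_ev[OF d psh.Comp_Hom[OF ya_Hom(1)[OF f] g(1)]] ev_ya[OF g(1) f] g(2) by simp
    then show "ev d (\<phi> d (\<gamma> d (pact P f x))) = pact M f (ev c (\<phi> c (\<gamma> c x)))"
      using nat[OF f g(1)] ev_ya[OF mem[OF c g(1)] f] by simp
  qed blast
  have "h \<bullet>\<^bsub>psh\<^esub> g = \<phi> c g" if c: "c \<in> Obj C" and g: "g \<in> Hom psh (yo c) P" for c g
    using ev_inj[OF c psh.Comp_Hom[OF g h(1)] mem[OF c g]] ev_Comp[OF g h(1) c]
      h(2)[OF c ev_mem[OF c g]] \<gamma>_ev[OF c g] by simp
  then show thesis using h(1) that by blast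
qed

end

section \<open>Filtered colimits of presheaves\<close>

context presheaves
begin

text \<open>Filtered colimits of presheaves are detected pointwise: by Yoneda
  \<open>Hom psh (yo c) P\<close> is the value of \<open>P\<close> at \<open>c\<close>, so the
  hypothesis says that each value is the colimit of the values of the stages.\<close>

lemma psh_colimitI:
  assumes I: "filtered I" and G: "cat_functor I psh G" and \<mu>: "cocone I psh G P \<mu>"
    and hc: "\<And>c. c \<in> Obj C \<Longrightarrow> hom_colimit I psh G P \<mu> (yo c)"
  shows "is_colimit I psh G P \<mu>"
proof (rule psh.is_colimitI[OF G \<mu>])
  interpret G: cat_functor I psh G by (rule G)
  have \<mu>i: "\<mu> i \<in> Hom psh (FO G i) P" if "i \<in> Obj I" for i
    using \<mu> that by (simp add: cocone_def)
  have P: "P \<in> Obj psh" using \<mu> by (simp add: cocone_def)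
  have assoc: "h \<bullet>\<^bsub>psh\<^esub> (\<mu> i \<bullet>\<^bsub>psh\<^esub> g) = (h \<bullet>\<^bsub>psh\<^esub> \<mu> i) \<bullet>\<^bsub>psh\<^esub> g"
    if "i \<in> Obj I" "g \<in> Hom psh X (FO G i)" "h \<in> Hom psh P M" for h i g X M
    using psh.Comp_assoc[OF that(2) \<mu>i[OF that(1)] that(3)] .
  fix M
  show "\<exists>h\<in>Hom psh P M. \<forall>i\<in>Obj I. h \<bullet>\<^bsub>psh\<^esub> \<mu> i = \<nu> i" if \<nu>: "cocone I psh G M \<nu>" for \<nu>
  proof -
    have M: "M \<in> Obj psh" and \<nu>i: "\<And>i. i \<in> Obj I \<Longrightarrow> \<nu> i \<in> Hom psh (FO G i) M"
      using \<nu> by (simp_all add: cocone_def)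
    \<comment> \<open>The mediating morphism on arrows from representables: factor through a stage
      and apply the cocone. Again it is the value that is chosen, being unique by
      \<open>hom_colimit_descend\<close>.\<close>
    define \<phi> where "\<phi> c g = (SOME k. \<exists>i\<in>Obj I. \<exists>g'\<in>Hom psh (yo c) (FO G i).
        g = \<mu> i \<bullet>\<^bsub>psh\<^esub> g' \<and> k = \<nu> i \<bullet>\<^bsub>psh\<^esub> g')" for c g
    have \<phi>: "\<phi> c (\<mu> i \<bullet>\<^bsub>psh\<^esub> g) = \<nu> i \<bullet>\<^bsub>psh\<^esub> g"
      if c: "c \<in> Obj C" and i: "i \<in> Obj I" and g: "g \<in> Hom psh (yo c) (FO G i)" for c i g
      unfolding \<phi>_def
    proof (rule some_equality)
      show "\<exists>j\<in>Obj I. \<exists>g'\<in>Hom psh (yo c) (FO G j).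
          \<mu> i \<bullet>\<^bsub>psh\<^esub> g = \<mu> j \<bullet>\<^bsub>psh\<^esub> g' \<and> \<nu> i \<bullet>\<^bsub>psh\<^esub> g = \<nu> j \<bullet>\<^bsub>psh\<^esub> g'"
        using i g by blast
      fix k assume "\<exists>j\<in>Obj I. \<exists>g'\<in>Hom psh (yo c) (FO G j).
          \<mu> i \<bullet>\<^bsub>psh\<^esub> g = \<mu> j \<bullet>\<^bsub>psh\<^esub> g' \<and> k = \<nu> j \<bullet>\<^bsub>psh\<^esub> g'"
      then obtain j g' where j: "j \<in> Obj I" "g' \<in> Hom psh (yo c) (FO G j)"
        "\<mu> i \<bullet>\<^bsub>psh\<^esub> g = \<mu> j \<bullet>\<^bsub>psh\<^esub> g'" and k: "k = \<nu> j \<bullet>\<^bsub>psh\<^esub> g'" by blast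
      have "\<nu> i \<bullet>\<^bsub>psh\<^esub> g = \<nu> j \<bullet>\<^bsub>psh\<^esub> g'"
        using psh.hom_colimit_descend[where \<psi> = "\<lambda>i g. \<nu> i \<bullet>\<^bsub>psh\<^esub> g", OF I G \<mu> hc[OF c]
            psh.cocone_comp_assoc[OF G \<nu>] i j(1) g j(2,3)] .
      then show "k = \<nu> i \<bullet>\<^bsub>psh\<^esub> g" using k by simp
    qed
    obtain h where h: "h \<in> Hom psh P M"
      and h\<phi>: "\<And>c g. c \<in> Obj C \<Longrightarrow> g \<in> Hom psh (yo c) P \<Longrightarrow> h \<bullet>\<^bsub>psh\<^esub> g = \<phi> c g"
    proof (rule yo_dense[OF P M, of \<phi>])
      show "\<phi> c g \<in> Hom psh (yo c) M" if c: "c \<in> Obj C" and g: "g \<in> Hom psh (yo c) P" for c g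
      proof -
        obtain i g' where i: "i \<in> Obj I" "g' \<in> Hom psh (yo c) (FO G i)" "g = \<mu> i \<bullet>\<^bsub>psh\<^esub> g'"
          using hom_colimit_factor[OF hc[OF c] g] by blast
        then show ?thesis using \<phi>[OF c i(1,2)] psh.Comp_Hom[OF i(2) \<nu>i[OF i(1)]] by simp
      qed
      fix c d f g assume f: "f \<in> Hom C d c" and g: "g \<in> Hom psh (yo c) P"
      have c: "c \<in> Obj C" and d: "d \<in> Obj C" using Hom_Obj[OF f] by auto
      obtain i g' where i: "i \<in> Obj I" and g': "g' \<in> Hom psh (yo c) (FO G i)" and gg': "g = \<mu> i \<bullet>\<^bsub>psh\<^esub> g'"
        using hom_colimit_factor[OF hc[OF c] g] by blast
      note yf = ya_Hom(1)[OF f]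
      have "\<phi> d (g \<bullet>\<^bsub>psh\<^esub> ya f) = \<phi> d (\<mu> i \<bullet>\<^bsub>psh\<^esub> (g' \<bullet>\<^bsub>psh\<^esub> ya f))"
        using psh.Comp_assoc[OF yf g' \<mu>i[OF i]] gg' by simp
      also have "\<dots> = \<nu> i \<bullet>\<^bsub>psh\<^esub> (g' \<bullet>\<^bsub>psh\<^esub> ya f)"
        using \<phi>[OF d i psh.Comp_Hom[OF yf g']] .
      also have "\<dots> = \<phi> c g \<bullet>\<^bsub>psh\<^esub> ya f"
        using psh.Comp_assoc[OF yf g' \<nu>i[OF i]] \<phi>[OF c i g'] gg' by simp
      finally show "\<phi> d (g \<bullet>\<^bsub>psh\<^esub> ya f) = \<phi> c g \<bullet>\<^bsub>psh\<^esub> ya f" .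
    qed blast
    have "h \<bullet>\<^bsub>psh\<^esub> \<mu> i = \<nu> i" if i: "i \<in> Obj I" for i
    proof (rule yo_joint_epi[OF psh.Comp_Hom[OF \<mu>i[OF i] h] \<nu>i[OF i]])
      fix c g assume c: "c \<in> Obj C" and g: "g \<in> Hom psh (yo c) (FO G i)"
      show "(h \<bullet>\<^bsub>psh\<^esub> \<mu> i) \<bullet>\<^bsub>psh\<^esub> g = \<nu> i \<bullet>\<^bsub>psh\<^esub> g"
        using assoc[OF i g h] h\<phi>[OF c psh.Comp_Hom[OF g \<mu>i[OF i]]] \<phi>[OF c i g] by simp
    qed
    then show ?thesis using h by blast
  qed
  show "h = k" if h: "h \<in> Hom psh P M" and k: "k \<in> Hom psh P M"
    and eq: "\<And>i. i \<in> Obj I \<Longrightarrow> h \<bullet>\<^bsub>psh\<^esub> \<mu> i = k \<bullet>\<^bsub>psh\<^esub> \<mu> i" for h k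
  proof (rule yo_joint_epi[OF h k])
    fix c g assume c: "c \<in> Obj C" and g: "g \<in> Hom psh (yo c) P"
    obtain i g' where i: "i \<in> Obj I" "g' \<in> Hom psh (yo c) (FO G i)" "g = \<mu> i \<bullet>\<^bsub>psh\<^esub> g'"
      using hom_colimit_factor[OF hc[OF c] g] by blast
    then show "h \<bullet>\<^bsub>psh\<^esub> g = k \<bullet>\<^bsub>psh\<^esub> g"
      using assoc[OF i(1,2) h] assoc[OF i(1,2) k] eq[OF i(1)] by simp
  qed
qed

text \<open>The colimit is formed pointwise as the usual quotient of the disjoint union of the
  stages. Sets of equivalence classes are not subsets of \<open>'u\<close>, so each class is
  replaced by the code in \<open>'u\<close> of a chosen representative.\<close>

lemma psh_colimit_exists:
  fixes I :: "('u, 'u, 'y) cat_scheme"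
  assumes inf: "infinite (UNIV :: 'u set)" and I: "filtered I" and G: "cat_functor I psh G"
  obtains P \<mu> where "is_colimit I psh G P \<mu>" "\<And>c. c \<in> Obj C \<Longrightarrow> hom_colimit I psh G P \<mu> (yo c)"
proof -
  interpret G: cat_functor I psh G by (rule G)
  define S where "S c = {(i, g). i \<in> Obj I \<and> g \<in> Hom psh (yo c) (FO G i)}" for c
  \<comment> \<open>Two elements of stages are identified when their images at some common later
    index agree.\<close>
  define eqv where "eqv p q \<longleftrightarrow> (\<exists>k. \<exists>u\<in>Hom I (fst p) k. \<exists>v\<in>Hom I (fst q) k.
      FA G u \<bullet>\<^bsub>psh\<^esub> snd p = FA G v \<bullet>\<^bsub>psh\<^esub> snd q)" for p q
  have FA_comp: "FA G (w \<bullet>\<^bsub>I\<^esub> u) \<bullet>\<^bsub>psh\<^esub> g = FA G w \<bullet>\<^bsub>psh\<^esub> (FA G u \<bullet>\<^bsub>psh\<^esub> g)"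
    if "u \<in> Hom I i j" "w \<in> Hom I j k" "g \<in> Hom psh X (FO G i)" for u w g i j k X
    using G.FA_Comp[OF that(1,2)] psh.Comp_assoc[OF that(3) G.FA_Hom[OF that(1)] G.FA_Hom[OF that(2)]]
    by simp
  have eqv_sym: "eqv q p" if "eqv p q" for p q
    using that unfolding eqv_def by metis
  have eqv_refl: "eqv p p" if "p \<in> S c" for p c
    using that G.A.Ident_Hom unfolding eqv_def S_def by fastforce
  \<comment> \<open>The indices \<open>k\<close> and \<open>l\<close> have a common upper index
    \<open>m\<close>, but the two arrows from \<open>fst q\<close> to \<open>m\<close> may differ; a
    further arrow \<open>w\<close> makes them equal. Hence both conditions on pairs in a filtered
    category enter.\<close>
  have eqv_trans: "eqv p r" if "eqv p q" "eqv q r" and S: "p \<in> S c" "q \<in> S c" "r \<in> S c" for p q r c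
  proof -
    obtain k u v where u: "u \<in> Hom I (fst p) k" and v: "v \<in> Hom I (fst q) k"
      and 1: "FA G u \<bullet>\<^bsub>psh\<^esub> snd p = FA G v \<bullet>\<^bsub>psh\<^esub> snd q"
      using \<open>eqv p q\<close> unfolding eqv_def by blast
    obtain l s t where s: "s \<in> Hom I (fst q) l" and t: "t \<in> Hom I (fst r) l"
      and 2: "FA G s \<bullet>\<^bsub>psh\<^esub> snd q = FA G t \<bullet>\<^bsub>psh\<^esub> snd r"
      using \<open>eqv q r\<close> unfolding eqv_def by blast
    have kl: "k \<in> Obj I" "l \<in> Obj I" using G.A.Hom_Obj[OF u] G.A.Hom_Obj[OF s] by auto
    obtain m a b where a: "a \<in> Hom I k m" and b: "b \<in> Hom I l m"
      using filtered_upper[OF I kl] by blast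
    have av: "a \<bullet>\<^bsub>I\<^esub> v \<in> Hom I (fst q) m" and bs: "b \<bullet>\<^bsub>I\<^esub> s \<in> Hom I (fst q) m"
      using G.A.Comp_Hom[OF v a] G.A.Comp_Hom[OF s b] by auto
    obtain n w where w: "w \<in> Hom I m n" and ws: "w \<bullet>\<^bsub>I\<^esub> (a \<bullet>\<^bsub>I\<^esub> v) = w \<bullet>\<^bsub>I\<^esub> (b \<bullet>\<^bsub>I\<^esub> s)"
      using filtered_coequalize[OF I av bs] by blast
    have au: "a \<bullet>\<^bsub>I\<^esub> u \<in> Hom I (fst p) m" and bt: "b \<bullet>\<^bsub>I\<^esub> t \<in> Hom I (fst r) m"
      using G.A.Comp_Hom[OF u a] G.A.Comp_Hom[OF t b] by auto
    have gp: "snd p \<in> Hom psh (yo c) (FO G (fst p))" and gq: "snd q \<in> Hom psh (yo c) (FO G (fst q))"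
      and gr: "snd r \<in> Hom psh (yo c) (FO G (fst r))" using S by (auto simp: S_def)
    have "FA G (w \<bullet>\<^bsub>I\<^esub> (a \<bullet>\<^bsub>I\<^esub> u)) \<bullet>\<^bsub>psh\<^esub> snd p = FA G (w \<bullet>\<^bsub>I\<^esub> (a \<bullet>\<^bsub>I\<^esub> v)) \<bullet>\<^bsub>psh\<^esub> snd q"
      by (simp add: FA_comp[OF au w gp] FA_comp[OF u a gp] FA_comp[OF av w gq] FA_comp[OF v a gq] 1)
    also have "\<dots> = FA G (w \<bullet>\<^bsub>I\<^esub> (b \<bullet>\<^bsub>I\<^esub> t)) \<bullet>\<^bsub>psh\<^esub> snd r"
      by (simp add: ws FA_comp[OF bs w gq] FA_comp[OF s b gq] FA_comp[OF bt w gr] FA_comp[OF t b gr] 2)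
    finally show ?thesis
      unfolding eqv_def using G.A.Comp_Hom[OF au w] G.A.Comp_Hom[OF bt w] by blast
  qed
  \<comment> \<open>An infinite set is equipotent with its square, so pairs from \<open>'u\<close>
    can be coded in \<open>'u\<close>.\<close>
  obtain pr :: "'u \<times> 'u \<Rightarrow> 'u" where pr: "inj pr"
    using card_of_Times_same_infinite[OF inf] card_of_ordIso[of "UNIV \<times> UNIV :: ('u \<times> 'u) set" "UNIV :: 'u set"]
    by (metis UNIV_Times_UNIV bij_betw_imp_inj_on)
  define enc where "enc c p = pr (fst p, ev c (snd p))" for c p
  have enc: "p = q" if "c \<in> Obj C" "p \<in> S c" "q \<in> S c" "enc c p = enc c q" for c p q
  proof -
    have "fst p = fst q" "ev c (snd p) = ev c (snd q)"
      using that(4) injD[OF pr] by (auto simp: enc_def)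
    moreover have "snd p \<in> Hom psh (yo c) (FO G (fst p))" "snd q \<in> Hom psh (yo c) (FO G (fst q))"
      using that by (auto simp: S_def)
    ultimately show "p = q" using ev_inj[OF that(1)] by (metis prod_eqI)
  qed
  \<comment> \<open>Equivalent elements define the same predicate under the choice operator, so they
    receive the same representative; this makes \<open>q\<close> below a quotient map.\<close>
  define rep where "rep c p = (SOME q. q \<in> S c \<and> eqv q p)" for c p
  have rep: "rep c p \<in> S c" "eqv (rep c p) p" if "p \<in> S c" for c p
  proof -
    have "\<exists>q. q \<in> S c \<and> eqv q p" using that eqv_refl by blast
    from someI_ex[OF this] show "rep c p \<in> S c" "eqv (rep c p) p" by (simp_all add: rep_def)
  qed
  define q where "q c p = enc c (rep c p)" for c p
  have q_eqv: "q c p = q c p' \<longleftrightarrow> eqv p p'" if c: "c \<in> Obj C" and p: "p \<in> S c" "p' \<in> S c" for c p p'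
  proof
    assume "q c p = q c p'"
    then have "rep c p = rep c p'" using enc[OF c rep(1)[OF p(1)] rep(1)[OF p(2)]] by (simp add: q_def)
    then show "eqv p p'" using rep p eqv_sym eqv_trans by metis
  next
    assume e: "eqv p p'"
    have "(r \<in> S c \<and> eqv r p) = (r \<in> S c \<and> eqv r p')" for r
      using eqv_trans[OF _ e _ p(1) p(2)] eqv_trans[OF _ eqv_sym[OF e] _ p(2) p(1)] by blast
    then show "q c p = q c p'" by (simp add: q_def rep_def)
  qed
  have S_ya: "(i, g \<bullet>\<^bsub>psh\<^esub> ya f) \<in> S c" if "f \<in> Hom C c d" "(i, g) \<in> S d" for c d f i g
    using that psh.Comp_Hom[OF ya_Hom(1)[OF that(1)]] by (auto simp: S_def)
  have q_ya: "q c (i, g \<bullet>\<^bsub>psh\<^esub> ya f) = q c (j, g' \<bullet>\<^bsub>psh\<^esub> ya f)"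
    if f: "f \<in> Hom C c d" and S: "(i, g) \<in> S d" "(j, g') \<in> S d" and eq: "q d (i, g) = q d (j, g')"
    for c d f i j g g'
  proof -
    have c: "c \<in> Obj C" "d \<in> Obj C" using Hom_Obj[OF f] by auto
    have gg: "g \<in> Hom psh (yo d) (FO G i)" "g' \<in> Hom psh (yo d) (FO G j)" using S by (auto simp: S_def)
    obtain k u v where u: "u \<in> Hom I i k" and v: "v \<in> Hom I j k"
      and e: "FA G u \<bullet>\<^bsub>psh\<^esub> g = FA G v \<bullet>\<^bsub>psh\<^esub> g'"
      using q_eqv[OF c(2) S] eq by (auto simp: eqv_def)
    have "FA G u \<bullet>\<^bsub>psh\<^esub> (g \<bullet>\<^bsub>psh\<^esub> ya f) = FA G v \<bullet>\<^bsub>psh\<^esub> (g' \<bullet>\<^bsub>psh\<^esub> ya f)"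
      using psh.Comp_assoc[OF ya_Hom(1)[OF f] gg(1) G.FA_Hom[OF u]]
        psh.Comp_assoc[OF ya_Hom(1)[OF f] gg(2) G.FA_Hom[OF v]] e by simp
    then have "eqv (i, g \<bullet>\<^bsub>psh\<^esub> ya f) (j, g' \<bullet>\<^bsub>psh\<^esub> ya f)"
      unfolding eqv_def using u v by auto
    then show ?thesis using q_eqv[OF c(1) S_ya[OF f S(1)] S_ya[OF f S(2)]] by simp
  qed
  \<comment> \<open>Restriction along \<open>f\<close> acts on a class through an arbitrary preimage
    under \<open>q\<close>; by \<open>q_ya\<close> the result does not depend on it.\<close>
  define act where "act f z = (let p = SOME p. p \<in> S (Cod C f) \<and> q (Cod C f) p = z in
      q (Dom C f) (fst p, snd p \<bullet>\<^bsub>psh\<^esub> ya f))" for f z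
  have act: "act f (q d (i, g)) = q c (i, g \<bullet>\<^bsub>psh\<^esub> ya f)"
    if f: "f \<in> Hom C c d" and S: "(i, g) \<in> S d" for c d f i g
  proof -
    define p where "p = (SOME p. p \<in> S d \<and> q d p = q d (i, g))"
    have "\<exists>p. p \<in> S d \<and> q d p = q d (i, g)" using S by blast
    from someI_ex[OF this] have p: "p \<in> S d" "q d p = q d (i, g)" by (simp_all add: p_def)
    have "act f (q d (i, g)) = q c (fst p, snd p \<bullet>\<^bsub>psh\<^esub> ya f)"
      using f by (simp add: act_def p_def Hom_def Let_def)
    also have "\<dots> = q c (i, g \<bullet>\<^bsub>psh\<^esub> ya f)"
      using q_ya[OF f, of "fst p" "snd p" i g] p S by simp
    finally show ?thesis .
  qed
  obtain P where P: "P \<in> Obj psh" and FO_P: "\<And>c. FO P c = q c ` S c"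
    and pact_P: "\<And>f c d x. f \<in> Hom C c d \<Longrightarrow> x \<in> q d ` S d \<Longrightarrow> pact P f x = act f x"
  proof (rule psh_ObjI[of "\<lambda>c. q c ` S c" act])
    show "act f x \<in> q c ` S c" if f: "f \<in> Hom C c d" and z: "x \<in> q d ` S d" for f c d x
    proof -
      obtain p where "x = q d p" "p \<in> S d" using z by (rule imageE)
      then obtain i g where x: "x = q d (i, g)" "(i, g) \<in> S d" by (cases p) simp
      show ?thesis using act[OF f x(2)] S_ya[OF f x(2)] x(1) by simp
    qed
    show "act (Ident C c) x = x" if c: "c \<in> Obj C" and z: "x \<in> q c ` S c" for c x
    proof -
      obtain p where "x = q c p" "p \<in> S c" using z by (rule imageE)
      then obtain i g where x: "x = q c (i, g)" "(i, g) \<in> S c" by (cases p) simp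
      then have "g \<in> Hom psh (yo c) (FO G i)" by (simp add: S_def)
      then have "g \<bullet>\<^bsub>psh\<^esub> ya (Ident C c) = g"
        using yoneda.FA_Ident[OF c] psh.Ident_right by simp
      then show ?thesis using act[OF Ident_Hom[OF c] x(2)] x(1) by simp
    qed
    show "act (g \<bullet> f) x = act f (act g x)"
      if f: "f \<in> Hom C c d" and g: "g \<in> Hom C d e" and z: "x \<in> q e ` S e" for f g c d e x
    proof -
      obtain p where "x = q e p" "p \<in> S e" using z by (rule imageE)
      then obtain i h where x: "x = q e (i, h)" "(i, h) \<in> S e" by (cases p) simp
      then have h: "h \<in> Hom psh (yo e) (FO G i)" by (simp add: S_def)
      have "h \<bullet>\<^bsub>psh\<^esub> ya (g \<bullet> f) = (h \<bullet>\<^bsub>psh\<^esub> ya g) \<bullet>\<^bsub>psh\<^esub> ya f"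
        using yoneda.FA_Comp[OF f g] psh.Comp_assoc[OF ya_Hom(1)[OF f] ya_Hom(1)[OF g] h]
        by simp
      then show ?thesis
        using act[OF Comp_Hom[OF f g] x(2)] act[OF g x(2)] act[OF f S_ya[OF g x(2)]] x(1) by simp
    qed
  qed (rule that)
  \<comment> \<open>The leg at \<open>i\<close> sends an element of the stage to its class. It is
    built from arrows out of representables by \<open>yo_dense\<close>.\<close>
  have "\<exists>h. i \<in> Obj I \<longrightarrow> h \<in> Hom psh (FO G i) P \<and>
      (\<forall>c\<in>Obj C. \<forall>g\<in>Hom psh (yo c) (FO G i). ev c (h \<bullet>\<^bsub>psh\<^esub> g) = q c (i, g))" for i
  proof (cases "i \<in> Obj I")
    case i: True
    define \<phi> where "\<phi> c g = (SOME h. h \<in> Hom psh (yo c) P \<and> ev c h = q c (i, g))" for c g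
    have S: "(i, g) \<in> S c" if "g \<in> Hom psh (yo c) (FO G i)" for c g
      using that i by (simp add: S_def)
    have \<phi>: "\<phi> c g \<in> Hom psh (yo c) P" "ev c (\<phi> c g) = q c (i, g)"
      if "c \<in> Obj C" "g \<in> Hom psh (yo c) (FO G i)" for c g
    proof -
      have "q c (i, g) \<in> FO P c" using S[OF that(2)] by (simp add: FO_P)
      then have "\<exists>h. h \<in> Hom psh (yo c) P \<and> ev c h = q c (i, g)"
        using ev_surj[OF P that(1)] by blast
      from someI_ex[OF this] show "\<phi> c g \<in> Hom psh (yo c) P" "ev c (\<phi> c g) = q c (i, g)"
        by (simp_all add: \<phi>_def)
    qed
    obtain h where h: "h \<in> Hom psh (FO G i) P"
      "\<And>c g. c \<in> Obj C \<Longrightarrow> g \<in> Hom psh (yo c) (FO G i) \<Longrightarrow> h \<bullet>\<^bsub>psh\<^esub> g = \<phi> c g"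
    proof (rule yo_dense[OF G.FO_Obj[OF i] P, of \<phi>])
      fix c d f g assume f: "f \<in> Hom C d c" and g: "g \<in> Hom psh (yo c) (FO G i)"
      have c: "c \<in> Obj C" "d \<in> Obj C" using Hom_Obj[OF f] by auto
      have gf: "g \<bullet>\<^bsub>psh\<^esub> ya f \<in> Hom psh (yo d) (FO G i)" using psh.Comp_Hom[OF ya_Hom(1)[OF f] g] .
      have "ev d (\<phi> c g \<bullet>\<^bsub>psh\<^esub> ya f) = pact P f (q c (i, g))"
        using ev_ya[OF \<phi>(1)[OF c(1) g] f] \<phi>(2)[OF c(1) g] by simp
      also have "\<dots> = ev d (\<phi> d (g \<bullet>\<^bsub>psh\<^esub> ya f))"
        using pact_P[OF f] act[OF f S[OF g]] S[OF g] \<phi>(2)[OF c(2) gf] by simp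
      finally show "\<phi> d (g \<bullet>\<^bsub>psh\<^esub> ya f) = \<phi> c g \<bullet>\<^bsub>psh\<^esub> ya f"
        using ev_inj[OF c(2) \<phi>(1)[OF c(2) gf] psh.Comp_Hom[OF ya_Hom(1)[OF f] \<phi>(1)[OF c(1) g]]] by simp
    qed (use \<phi> in blast)+
    have "\<forall>c\<in>Obj C. \<forall>g\<in>Hom psh (yo c) (FO G i). ev c (h \<bullet>\<^bsub>psh\<^esub> g) = q c (i, g)"
      using h(2) \<phi>(2) by simp
    then show ?thesis using h(1) by blast
  qed simp
  then obtain \<mu> where \<mu>: "\<And>i. i \<in> Obj I \<Longrightarrow> \<mu> i \<in> Hom psh (FO G i) P"
    and ev_\<mu>: "\<And>i c g. i \<in> Obj I \<Longrightarrow> c \<in> Obj C \<Longrightarrow> g \<in> Hom psh (yo c) (FO G i) \<Longrightarrow>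
      ev c (\<mu> i \<bullet>\<^bsub>psh\<^esub> g) = q c (i, g)"
    by metis
  have "cocone I psh G P \<mu>"
    unfolding cocone_def
  proof (intro conjI ballI P \<mu>)
    fix u assume "u \<in> Arr I"
    then obtain i k where i: "Dom I u = i" and k: "Cod I u = k" and u: "u \<in> Hom I i k"
      by (auto simp: Hom_def)
    note ik = G.A.Hom_Obj[OF u] and Gu = G.FA_Hom[OF u]
    have "\<mu> k \<bullet>\<^bsub>psh\<^esub> FA G u = \<mu> i"
    proof (rule yo_joint_epi[OF psh.Comp_Hom[OF Gu \<mu>[OF ik(2)]] \<mu>[OF ik(1)]])
      fix c g assume c: "c \<in> Obj C" and g: "g \<in> Hom psh (yo c) (FO G i)"
      note Gug = psh.Comp_Hom[OF g Gu]
      have S: "(i, g) \<in> S c" "(k, FA G u \<bullet>\<^bsub>psh\<^esub> g) \<in> S c" using ik g Gug by (auto simp: S_def)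
      have "eqv (k, FA G u \<bullet>\<^bsub>psh\<^esub> g) (i, g)"
        unfolding eqv_def
        using G.A.Ident_Hom[OF ik(2)] u G.FA_Ident[OF ik(2)] psh.Ident_left[OF Gug]
        by (intro exI[of _ k] bexI[of _ "Ident I k"] bexI[of _ u]) simp_all
      then have "q c (k, FA G u \<bullet>\<^bsub>psh\<^esub> g) = q c (i, g)" using q_eqv[OF c S(2,1)] by simp
      then have "ev c (\<mu> k \<bullet>\<^bsub>psh\<^esub> (FA G u \<bullet>\<^bsub>psh\<^esub> g)) = ev c (\<mu> i \<bullet>\<^bsub>psh\<^esub> g)"
        using ev_\<mu>[OF ik(2) c Gug] ev_\<mu>[OF ik(1) c g] by simp
      then have "\<mu> k \<bullet>\<^bsub>psh\<^esub> (FA G u \<bullet>\<^bsub>psh\<^esub> g) = \<mu> i \<bullet>\<^bsub>psh\<^esub> g"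
        using ev_inj[OF c psh.Comp_Hom[OF Gug \<mu>[OF ik(2)]] psh.Comp_Hom[OF g \<mu>[OF ik(1)]]] by simp
      then show "(\<mu> k \<bullet>\<^bsub>psh\<^esub> FA G u) \<bullet>\<^bsub>psh\<^esub> g = \<mu> i \<bullet>\<^bsub>psh\<^esub> g"
        using psh.Comp_assoc[OF g Gu \<mu>[OF ik(2)]] by simp
    qed
    then show "\<mu> (Cod I u) \<bullet>\<^bsub>psh\<^esub> FA G u = \<mu> (Dom I u)" using i k by simp
  qed
  moreover have hc: "hom_colimit I psh G P \<mu> (yo c)" if c: "c \<in> Obj C" for c
    unfolding hom_colimit_def
  proof (intro conjI ballI impI)
    fix g assume g: "g \<in> Hom psh (yo c) P"
    have "ev c g \<in> q c ` S c" using ev_mem[OF c g] by (simp add: FO_P)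
    then obtain i g' where i: "i \<in> Obj I" and g': "g' \<in> Hom psh (yo c) (FO G i)"
      and eq: "ev c g = q c (i, g')" by (auto simp: S_def)
    have "g = \<mu> i \<bullet>\<^bsub>psh\<^esub> g'"
      using ev_inj[OF c g psh.Comp_Hom[OF g' \<mu>[OF i]]] ev_\<mu>[OF i c g'] eq by simp
    then show "\<exists>i\<in>Obj I. \<exists>g'\<in>Hom psh (yo c) (FO G i). g = \<mu> i \<bullet>\<^bsub>psh\<^esub> g'" using i g' by blast
  next
    fix i g g' assume i: "i \<in> Obj I" and g: "g \<in> Hom psh (yo c) (FO G i)"
      and g': "g' \<in> Hom psh (yo c) (FO G i)" and eq: "\<mu> i \<bullet>\<^bsub>psh\<^esub> g = \<mu> i \<bullet>\<^bsub>psh\<^esub> g'"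
    have "q c (i, g) = q c (i, g')" using ev_\<mu>[OF i c g] ev_\<mu>[OF i c g'] eq by simp
    then have "eqv (i, g) (i, g')" using q_eqv[OF c] i g g' by (auto simp: S_def)
    then obtain k u v where u: "u \<in> Hom I i k" and v: "v \<in> Hom I i k"
      and e: "FA G u \<bullet>\<^bsub>psh\<^esub> g = FA G v \<bullet>\<^bsub>psh\<^esub> g'" by (auto simp: eqv_def)
    obtain l w where l: "l \<in> Obj I" and w: "w \<in> Hom I k l" and wu: "w \<bullet>\<^bsub>I\<^esub> u = w \<bullet>\<^bsub>I\<^esub> v"
      using filtered_coequalize[OF I u v] .
    have "FA G (w \<bullet>\<^bsub>I\<^esub> u) \<bullet>\<^bsub>psh\<^esub> g = FA G (w \<bullet>\<^bsub>I\<^esub> u) \<bullet>\<^bsub>psh\<^esub> g'"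
      using FA_comp[OF u w g] FA_comp[OF v w g'] e wu by simp
    then show "\<exists>k\<in>Obj I. \<exists>u\<in>Hom I i k. FA G u \<bullet>\<^bsub>psh\<^esub> g = FA G u \<bullet>\<^bsub>psh\<^esub> g'"
      using l G.A.Comp_Hom[OF u w] by blast
  qed
  ultimately have "is_colimit I psh G P \<mu>" using psh_colimitI[OF I G] by blast
  then show thesis using hc that by blast
qed

text \<open>Any colimit is isomorphic to the one constructed above, and the property is invariant
  under isomorphism.\<close>

lemma psh_hom_colimit:
  fixes I :: "('u, 'u, 'y) cat_scheme"
  assumes "infinite (UNIV :: 'u set)" "filtered I" "is_colimit I psh G P \<mu>" "c \<in> Obj C"
  shows "hom_colimit I psh G P \<mu> (yo c)"
proof -
  obtain P' \<mu>' where P': "is_colimit I psh G P' \<mu>'" "hom_colimit I psh G P' \<mu>' (yo c)"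
    using psh_colimit_exists[OF assms(1,2) psh.is_colimitD(1)[OF assms(3)]] assms(4) by metis
  show ?thesis using psh.hom_colimit_iso[OF P'(2,1) assms(3) yo_Obj[OF assms(4)]] .
qed

end

section \<open>Representable presheaves are compact in the ind-completion\<close>

lemma universe_small_UN:
  assumes "universe TYPE('u)" "|A| <o |UNIV :: 'u set|" "\<And>a. a \<in> A \<Longrightarrow> |B a| <o |UNIV :: 'u set|"
  shows "|\<Union>a\<in>A. B a| <o |UNIV :: 'u set|"
proof (rule card_of_UNION_ordLess_infinite_Field_regularCard)
  show "regularCard |UNIV :: 'u set|" using assms(1) by (simp add: universe_def)
  show "Cinfinite |UNIV :: 'u set|"
    using assms(1) by (simp add: universe_def cinfinite_def Field_card_of card_of_card_order_on)
qed (use assms in auto)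

lemma small_image: "|A| <o r \<Longrightarrow> |f ` A| <o r"
  by (rule ordLeq_ordLess_trans[OF card_of_image])

lemma small_subset: "A \<subseteq> B \<Longrightarrow> |B| <o r \<Longrightarrow> |A| <o r"
  by (rule ordLeq_ordLess_trans[OF card_of_mono1])

lemma universe_small_Sigma:
  assumes "universe TYPE('u)" "|A| <o |UNIV :: 'u set|" "\<And>a. a \<in> A \<Longrightarrow> |B a| <o |UNIV :: 'u set|"
  shows "|Sigma A B| <o |UNIV :: 'u set|"
proof -
  have "Sigma A B = (\<Union>a\<in>A. Pair a ` B a)" by auto
  moreover have "|\<Union>a\<in>A. Pair a ` B a| <o |UNIV :: 'u set|"
    by (rule universe_small_UN[OF assms(1,2) small_image[OF assms(3)]])
  ultimately show ?thesis by simp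
qed

definition cat_iso :: "('i, 'j, 'x) cat_scheme \<Rightarrow> ('o, 'a, 'y) cat_scheme \<Rightarrow>
    ('i, 'j, 'o, 'a) func \<Rightarrow> bool" where
  "cat_iso I J \<Phi> \<longleftrightarrow> cat_functor I J \<Phi> \<and>
     bij_betw (FO \<Phi>) (Obj I) (Obj J) \<and> bij_betw (FA \<Phi>) (Arr I) (Arr J)"

text \<open>The diagrams in the definitions are indexed by categories of type
  \<open>('u, 'u) cat\<close>. A category of another type with few enough objects and arrows is
  copied there along injections into \<open>'u\<close>.\<close>

lemma small_model:
  fixes J :: "('i, 'j, 'x) cat_scheme"
  assumes J: "category J" and "|Obj J| <o |UNIV :: 'u set|" "|Arr J| <o |UNIV :: 'u set|"
  obtains I :: "('u, 'u) cat" and \<Phi> where "small_cat I" "cat_iso I J \<Phi>"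
proof -
  interpret J: category J by fact
  obtain \<phi> :: "'i \<Rightarrow> 'u" where \<phi>: "inj_on \<phi> (Obj J)"
    using ordLess_imp_ordLeq[OF assms(2)] card_of_ordLeq by metis
  obtain \<psi> :: "'j \<Rightarrow> 'u" where \<psi>: "inj_on \<psi> (Arr J)"
    using ordLess_imp_ordLeq[OF assms(3)] card_of_ordLeq by metis
  define \<phi>' where "\<phi>' = inv_into (Obj J) \<phi>"
  define \<psi>' where "\<psi>' = inv_into (Arr J) \<psi>"
  have \<phi>': "\<phi>' (\<phi> x) = x" if "x \<in> Obj J" for x using that \<phi> by (simp add: \<phi>'_def)
  have \<psi>': "\<psi>' (\<psi> f) = f" if "f \<in> Arr J" for f using that \<psi> by (simp add: \<psi>'_def)
  define I where "I = \<lparr>Obj = \<phi> ` Obj J, Arr = \<psi> ` Arr J, Dom = (\<lambda>u. \<phi> (Dom J (\<psi>' u))),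
    Cod = (\<lambda>u. \<phi> (Cod J (\<psi>' u))), Ident = (\<lambda>x. \<psi> (Ident J (\<phi>' x))),
    Comp = (\<lambda>v u. \<psi> (\<psi>' v \<bullet>\<^bsub>J\<^esub> \<psi>' u))\<rparr>"
  have HomE: "\<exists>f\<in>Arr J. u = \<psi> f \<and> X = \<phi> (Dom J f) \<and> Y = \<phi> (Cod J f)" if "u \<in> Hom I X Y" for u X Y
    using that by (auto simp: I_def Hom_def \<psi>')
  \<comment> \<open>Since \<open>\<phi>\<close> is injective on objects, arrows that are composable
    in the copy are composable in \<open>J\<close>.\<close>
  have cod_dom: "Cod J f = Dom J g"
    if "f \<in> Arr J" "g \<in> Arr J" "\<phi> (Cod J f) = \<phi> (Dom J g)" for f g
    using that inj_onD[OF \<phi>] J.Dom_Obj J.Cod_Obj by metis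
  have I: "category I"
  proof
    show "u \<in> Arr I \<Longrightarrow> Dom I u \<in> Obj I" for u by (auto simp: I_def \<psi>' J.Dom_Obj)
    show "u \<in> Arr I \<Longrightarrow> Cod I u \<in> Obj I" for u by (auto simp: I_def \<psi>' J.Cod_Obj)
    show "X \<in> Obj I \<Longrightarrow> Ident I X \<in> Hom I X X" for X
      by (auto simp: I_def Hom_def \<psi>' \<phi>' J.Ident_seq)
    show "v \<bullet>\<^bsub>I\<^esub> u \<in> Hom I X Z" if u: "u \<in> Hom I X Y" and v: "v \<in> Hom I Y Z" for u v X Y Z
    proof -
      obtain f g where f: "f \<in> Arr J" "u = \<psi> f" "X = \<phi> (Dom J f)" "Y = \<phi> (Cod J f)"
        and g: "g \<in> Arr J" "v = \<psi> g" "Y = \<phi> (Dom J g)" "Z = \<phi> (Cod J g)"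
        using HomE[OF u] HomE[OF v] by blast
      have "Cod J f = Dom J g" using f g cod_dom by auto
      then show ?thesis using f g by (simp add: I_def Hom_def \<psi>' J.Comp_seq)
    qed
    show "Ident I Y \<bullet>\<^bsub>I\<^esub> u = u" if u: "u \<in> Hom I X Y" for u X Y
      using HomE[OF u] by (auto simp: I_def \<psi>' \<phi>' J.seq_simps)
    show "u \<bullet>\<^bsub>I\<^esub> Ident I X = u" if u: "u \<in> Hom I X Y" for u X Y
      using HomE[OF u] by (auto simp: I_def \<psi>' \<phi>' J.seq_simps)
    show "w \<bullet>\<^bsub>I\<^esub> (v \<bullet>\<^bsub>I\<^esub> u) = (w \<bullet>\<^bsub>I\<^esub> v) \<bullet>\<^bsub>I\<^esub> u"
      if u: "u \<in> Hom I W X" and v: "v \<in> Hom I X Y" and w: "w \<in> Hom I Y Z" for u v w W X Y Z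
    proof -
      obtain f g h where f: "f \<in> Arr J" "u = \<psi> f" "X = \<phi> (Cod J f)"
        and g: "g \<in> Arr J" "v = \<psi> g" "X = \<phi> (Dom J g)" "Y = \<phi> (Cod J g)"
        and h: "h \<in> Arr J" "w = \<psi> h" "Y = \<phi> (Dom J h)"
        using HomE[OF u] HomE[OF v] HomE[OF w] by blast
      have "Cod J f = Dom J g" "Cod J g = Dom J h" using f g h cod_dom by auto
      then show ?thesis using f g h by (simp add: I_def \<psi>' J.seq_simps)
    qed
  qed
  define \<Phi> where "\<Phi> = \<lparr>FO = \<phi>', FA = \<psi>'\<rparr>"
  have "cat_functor I J \<Phi>"
  proof (intro cat_functor.intro cat_functor_axioms.intro I J)
    show "X \<in> Obj I \<Longrightarrow> FO \<Phi> X \<in> Obj J" for X by (auto simp: \<Phi>_def I_def \<phi>')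
    show "FA \<Phi> u \<in> Hom J (FO \<Phi> X) (FO \<Phi> Y)" if u: "u \<in> Hom I X Y" for u X Y
      using HomE[OF u] by (auto simp: \<Phi>_def Hom_def \<psi>' \<phi>' J.Dom_Obj J.Cod_Obj)
    show "X \<in> Obj I \<Longrightarrow> FA \<Phi> (Ident I X) = Ident J (FO \<Phi> X)" for X
      by (auto simp: \<Phi>_def I_def \<phi>' \<psi>' J.Ident_seq)
    show "FA \<Phi> (v \<bullet>\<^bsub>I\<^esub> u) = FA \<Phi> v \<bullet>\<^bsub>J\<^esub> FA \<Phi> u"
      if u: "u \<in> Hom I X Y" and v: "v \<in> Hom I Y Z" for u v X Y Z
    proof -
      obtain f g where f: "f \<in> Arr J" "u = \<psi> f" "Y = \<phi> (Cod J f)"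
        and g: "g \<in> Arr J" "v = \<psi> g" "Y = \<phi> (Dom J g)"
        using HomE[OF u] HomE[OF v] by blast
      have "Cod J f = Dom J g" using f g cod_dom by auto
      then show ?thesis using f g by (simp add: I_def \<Phi>_def \<psi>' J.Comp_seq)
    qed
  qed
  moreover have "bij_betw (FO \<Phi>) (Obj I) (Obj J)"
    using bij_betw_inv_into[of \<phi> "Obj J" "\<phi> ` Obj J"] \<phi> by (simp add: \<Phi>_def I_def \<phi>'_def bij_betw_def)
  moreover have "bij_betw (FA \<Phi>) (Arr I) (Arr J)"
    using bij_betw_inv_into[of \<psi> "Arr J" "\<psi> ` Arr J"] \<psi> by (simp add: \<Phi>_def I_def \<psi>'_def bij_betw_def)
  moreover have "small_cat I"
    using I small_image[OF assms(2), of \<phi>] small_image[OF assms(3), of \<psi>]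
    by (simp add: small_cat_def small_def I_def)
  ultimately show thesis using that by (auto simp: cat_iso_def)
qed

lemma cat_iso_onto:
  assumes "cat_iso I J \<Phi>" "k \<in> Obj J"
  shows "\<exists>i\<in>Obj I. FO \<Phi> i = k"
proof -
  have "k \<in> FO \<Phi> ` Obj I" using assms by (simp add: cat_iso_def bij_betw_def)
  then show ?thesis by blast
qed

lemma cat_iso_Hom:
  assumes \<Phi>: "cat_iso I J \<Phi>" and i: "i \<in> Obj I" "j \<in> Obj I" and f: "f \<in> Hom J (FO \<Phi> i) (FO \<Phi> j)"
  obtains u where "u \<in> Hom I i j" "FA \<Phi> u = f"
proof -
  interpret \<Phi>: cat_functor I J \<Phi> using \<Phi> by (simp add: cat_iso_def)
  have "f \<in> FA \<Phi> ` Arr I" using \<Phi> f by (simp add: cat_iso_def bij_betw_def Hom_def)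
  then obtain u where u: "u \<in> Arr I" "FA \<Phi> u = f" by blast
  have "FO \<Phi> (Dom I u) = FO \<Phi> i" "FO \<Phi> (Cod I u) = FO \<Phi> j"
    using \<Phi>.FA_seq[OF u(1)] u(2) f by (auto simp: Hom_def)
  moreover have "inj_on (FO \<Phi>) (Obj I)" using \<Phi> by (simp add: cat_iso_def bij_betw_def)
  ultimately have "Dom I u = i" "Cod I u = j"
    using \<Phi>.A.Dom_Obj[OF u(1)] \<Phi>.A.Cod_Obj[OF u(1)] i inj_onD by metis+
  then show thesis using u that by (auto simp: Hom_def)
qed

lemma cat_iso_filtered:
  assumes \<Phi>: "cat_iso I J \<Phi>" and J: "filtered J"
  shows "filtered I"
proof -
  interpret \<Phi>: cat_functor I J \<Phi> using \<Phi> by (simp add: cat_iso_def)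
  note onto = cat_iso_onto[OF \<Phi>]
  show ?thesis
    unfolding filtered_def
  proof (intro conjI ballI \<Phi>.A.category_axioms)
    show "Obj I \<noteq> {}" using J onto by (auto simp: filtered_def)
    fix i j assume i: "i \<in> Obj I" and j: "j \<in> Obj I"
    show "\<exists>k\<in>Obj I. Hom I i k \<noteq> {} \<and> Hom I j k \<noteq> {}"
    proof -
      obtain k u v where k: "k \<in> Obj J" and u: "u \<in> Hom J (FO \<Phi> i) k" and v: "v \<in> Hom J (FO \<Phi> j) k"
        using filtered_upper[OF J \<Phi>.FO_Obj[OF i] \<Phi>.FO_Obj[OF j]] .
      obtain k' where k': "k' \<in> Obj I" "FO \<Phi> k' = k" using onto[OF k] by blast
      obtain u' where "u' \<in> Hom I i k'" using cat_iso_Hom[OF \<Phi> i k'(1)] u k'(2) by metis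
      moreover obtain v' where "v' \<in> Hom I j k'" using cat_iso_Hom[OF \<Phi> j k'(1)] v k'(2) by metis
      ultimately show ?thesis using k'(1) by blast
    qed
    fix u v assume u: "u \<in> Hom I i j" and v: "v \<in> Hom I i j"
    obtain k w where k: "k \<in> Obj J" and w: "w \<in> Hom J (FO \<Phi> j) k"
      and eq: "w \<bullet>\<^bsub>J\<^esub> FA \<Phi> u = w \<bullet>\<^bsub>J\<^esub> FA \<Phi> v"
      using filtered_coequalize[OF J \<Phi>.FA_Hom[OF u] \<Phi>.FA_Hom[OF v]] .
    obtain k' where k': "k' \<in> Obj I" "FO \<Phi> k' = k" using onto[OF k] by blast
    obtain w' where w': "w' \<in> Hom I j k'" "FA \<Phi> w' = w"
      using cat_iso_Hom[OF \<Phi> j k'(1)] w k'(2) by metis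
    have "FA \<Phi> (w' \<bullet>\<^bsub>I\<^esub> u) = FA \<Phi> (w' \<bullet>\<^bsub>I\<^esub> v)"
      using \<Phi>.FA_Comp[OF u w'(1)] \<Phi>.FA_Comp[OF v w'(1)] eq w'(2) by simp
    moreover have "inj_on (FA \<Phi>) (Arr I)" using \<Phi> by (simp add: cat_iso_def bij_betw_def)
    moreover have "w' \<bullet>\<^bsub>I\<^esub> u \<in> Arr I" "w' \<bullet>\<^bsub>I\<^esub> v \<in> Arr I"
      using \<Phi>.A.Comp_Hom[OF u w'(1)] \<Phi>.A.Comp_Hom[OF v w'(1)] by (auto simp: Hom_def)
    ultimately have "w' \<bullet>\<^bsub>I\<^esub> u = w' \<bullet>\<^bsub>I\<^esub> v" using inj_onD by metis
    then show "\<exists>k\<in>Obj I. \<exists>w\<in>Hom I j k. w \<bullet>\<^bsub>I\<^esub> u = w \<bullet>\<^bsub>I\<^esub> v" using k'(1) w'(1) by blast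
  qed
qed

text \<open>Cocones over the two diagrams correspond under the bijection on objects and its inverse
  \<open>\<iota>\<close>; compatibility is carried back because every arrow of \<open>J\<close> is
  the image of one of \<open>I\<close>.\<close>

lemma cat_iso_colimit:
  assumes \<Phi>: "cat_iso I J \<Phi>" and A: "category A" and L: "is_colimit J A G L \<mu>"
  shows "is_colimit I A (comp_func G \<Phi>) L (\<lambda>i. \<mu> (FO \<Phi> i))"
proof -
  interpret \<Phi>: cat_functor I J \<Phi> using \<Phi> by (simp add: cat_iso_def)
  interpret A: category A by (rule A)
  note G = A.is_colimitD(1)[OF L] and c = A.is_colimitD(2)[OF L]
  note onto = cat_iso_onto[OF \<Phi>]
  have inj: "inj_on (FO \<Phi>) (Obj I)" using \<Phi> by (simp add: cat_iso_def bij_betw_def)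
  show ?thesis
  proof (rule A.is_colimitI)
    show "cat_functor I A (comp_func G \<Phi>)" using cat_functor_comp[OF \<Phi>.cat_functor_axioms G] .
    show "cocone I A (comp_func G \<Phi>) L (\<lambda>i. \<mu> (FO \<Phi> i))"
      using c \<Phi>.FO_Obj \<Phi>.FA_seq by (auto simp: cocone_def) metis
    fix M
    show "\<exists>h\<in>Hom A L M. \<forall>i\<in>Obj I. h \<bullet>\<^bsub>A\<^esub> \<mu> (FO \<Phi> i) = \<nu> i"
      if \<nu>: "cocone I A (comp_func G \<Phi>) M \<nu>" for \<nu>
    proof -
      define \<iota> where "\<iota> = inv_into (Obj I) (FO \<Phi>)"
      have \<iota>: "\<iota> (FO \<Phi> i) = i" if "i \<in> Obj I" for i using that inj by (simp add: \<iota>_def)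
      have "cocone J A G M (\<lambda>k. \<nu> (\<iota> k))"
        unfolding cocone_def
      proof (intro conjI ballI)
        show "M \<in> Obj A" using \<nu> by (simp add: cocone_def)
        show "\<nu> (\<iota> k) \<in> Hom A (FO G k) M" if "k \<in> Obj J" for k
          using onto[OF that] \<nu> \<iota> by (auto simp: cocone_def)
        fix u assume u: "u \<in> Arr J"
        obtain i j where ij: "i \<in> Obj I" "j \<in> Obj I" "FO \<Phi> i = Dom J u" "FO \<Phi> j = Cod J u"
          using onto[OF \<Phi>.B.Dom_Obj[OF u]] onto[OF \<Phi>.B.Cod_Obj[OF u]] by blast
        obtain w where w: "w \<in> Hom I i j" "FA \<Phi> w = u"
          using cat_iso_Hom[OF \<Phi> ij(1,2)] Arr_Hom[OF u] ij(3,4) by metis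
        have "\<nu> j \<bullet>\<^bsub>A\<^esub> FA G u = \<nu> i" using \<nu> w by (auto simp: cocone_def Hom_def)
        then show "\<nu> (\<iota> (Cod J u)) \<bullet>\<^bsub>A\<^esub> FA G u = \<nu> (\<iota> (Dom J u))"
          using \<iota>[OF ij(1)] \<iota>[OF ij(2)] ij(3,4) by simp
      qed
      then obtain h where "h \<in> Hom A L M" "\<And>k. k \<in> Obj J \<Longrightarrow> h \<bullet>\<^bsub>A\<^esub> \<mu> k = \<nu> (\<iota> k)"
        using A.is_colimit_factor[OF L] by blast
      then show ?thesis using \<iota> \<Phi>.FO_Obj by (intro bexI[of _ h]) auto
    qed
    show "h = k" if "h \<in> Hom A L M" "k \<in> Hom A L M"
      "\<And>i. i \<in> Obj I \<Longrightarrow> h \<bullet>\<^bsub>A\<^esub> \<mu> (FO \<Phi> i) = k \<bullet>\<^bsub>A\<^esub> \<mu> (FO \<Phi> i)" for h k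
      by (rule A.is_colimit_eq[OF L that(1,2)]) (use onto that(3) in blast)
  qed
qed

section \<open>Ind-objects as flat presheaves\<close>

locale small_presheaves = presheaves C for C :: "('u, 'u, 'x) cat_scheme" (structure) +
  assumes universe: "universe TYPE('u)" and small_C: "small_cat C"
begin

lemma infinite_universe: "infinite (UNIV :: 'u set)"
  using universe by (simp add: universe_def)

text \<open>The ind-objects among the presheaves: the category of elements is filtered, and the values
  are small. The last condition is not automatic, the values being arbitrary subsets of \<open>'u\<close>.\<close>

definition flat :: "'u presheaf \<Rightarrow> bool" where
  "flat P \<longleftrightarrow> P \<in> Obj psh \<and> (\<exists>c\<in>Obj C. Hom psh (yo c) P \<noteq> {}) \<and>
     (\<forall>c\<in>Obj C. \<forall>c'\<in>Obj C. \<forall>g\<in>Hom psh (yo c) P. \<forall>g'\<in>Hom psh (yo c') P.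
        \<exists>d\<in>Obj C. \<exists>h\<in>Hom psh (yo d) P. \<exists>f\<in>Hom C c d. \<exists>f'\<in>Hom C c' d.
          g = h \<bullet>\<^bsub>psh\<^esub> ya f \<and> g' = h \<bullet>\<^bsub>psh\<^esub> ya f') \<and>
     (\<forall>c\<in>Obj C. \<forall>d\<in>Obj C. \<forall>g\<in>Hom psh (yo c) P. \<forall>f\<in>Hom C d c. \<forall>f'\<in>Hom C d c.
        g \<bullet>\<^bsub>psh\<^esub> ya f = g \<bullet>\<^bsub>psh\<^esub> ya f' \<longrightarrow>
        (\<exists>e\<in>Obj C. \<exists>h\<in>Hom psh (yo e) P. \<exists>w\<in>Hom C c e. g = h \<bullet>\<^bsub>psh\<^esub> ya w \<and> w \<bullet> f = w \<bullet> f')) \<and>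
     (\<forall>c\<in>Obj C. |Hom psh (yo c) P| <o |UNIV :: 'u set| )"

lemma flatD:
  assumes "flat P"
  shows "P \<in> Obj psh" "\<exists>c\<in>Obj C. Hom psh (yo c) P \<noteq> {}"
    "\<lbrakk>c \<in> Obj C; c' \<in> Obj C; g \<in> Hom psh (yo c) P; g' \<in> Hom psh (yo c') P\<rbrakk> \<Longrightarrow>
      \<exists>d\<in>Obj C. \<exists>h\<in>Hom psh (yo d) P. \<exists>f\<in>Hom C c d. \<exists>f'\<in>Hom C c' d.
        g = h \<bullet>\<^bsub>psh\<^esub> ya f \<and> g' = h \<bullet>\<^bsub>psh\<^esub> ya f'"
    "\<lbrakk>c \<in> Obj C; d \<in> Obj C; g \<in> Hom psh (yo c) P; f \<in> Hom C d c; f' \<in> Hom C d c;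
      g \<bullet>\<^bsub>psh\<^esub> ya f = g \<bullet>\<^bsub>psh\<^esub> ya f'\<rbrakk> \<Longrightarrow>
      \<exists>e\<in>Obj C. \<exists>h\<in>Hom psh (yo e) P. \<exists>w\<in>Hom C c e. g = h \<bullet>\<^bsub>psh\<^esub> ya w \<and> w \<bullet> f = w \<bullet> f'"
    "c \<in> Obj C \<Longrightarrow> |Hom psh (yo c) P| <o |UNIV :: 'u set|"
  using assms unfolding flat_def by blast+

text \<open>The identity of \<open>yo d\<close> is a terminal element, so it serves as upper bound
  for every pair of elements. For parallel arrows, the arrow underlying \<open>g\<close> coequalizes
  because the Yoneda embedding is faithful.\<close>

lemma flat_yo:
  assumes d: "d \<in> Obj C"
  shows "flat (yo d)"
  unfolding flat_def
proof (intro conjI ballI impI)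
  show "yo d \<in> Obj psh" by (rule yo_Obj[OF d])
  have idd: "Ident psh (yo d) \<in> Hom psh (yo d) (yo d)" using psh.Ident_Hom[OF yo_Obj[OF d]] .
  show "\<exists>c\<in>Obj C. Hom psh (yo c) (yo d) \<noteq> {}" using d idd by blast
  have id_ya: "ya f = Ident psh (yo d) \<bullet>\<^bsub>psh\<^esub> ya f" if "f \<in> Hom C c d" for f c
    using psh.Ident_left[OF ya_Hom(1)[OF that]] by simp
  fix c assume c: "c \<in> Obj C"
  have "Hom psh (yo c) (yo d) \<subseteq> ya ` Arr C"
  proof
    fix g assume "g \<in> Hom psh (yo c) (yo d)"
    then obtain f where "f \<in> Hom C c d" "g = ya f" using ya_full[OF c] by blast
    then show "g \<in> ya ` Arr C" by (simp add: Hom_def[of C])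
  qed
  moreover have "|ya ` Arr C| <o |UNIV :: 'u set|"
    using small_C by (intro small_image) (simp add: small_cat_def small_def)
  ultimately show "|Hom psh (yo c) (yo d)| <o |UNIV :: 'u set|" by (rule small_subset)
  fix c' g assume c': "c' \<in> Obj C" and g: "g \<in> Hom psh (yo c) (yo d)"
  obtain f where f: "f \<in> Hom C c d" "g = ya f" using ya_full[OF c g] .
  show "\<exists>e\<in>Obj C. \<exists>h\<in>Hom psh (yo e) (yo d). \<exists>f\<in>Hom C c e. \<exists>f'\<in>Hom C c' e.
      g = h \<bullet>\<^bsub>psh\<^esub> ya f \<and> g' = h \<bullet>\<^bsub>psh\<^esub> ya f'" if g': "g' \<in> Hom psh (yo c') (yo d)" for g'
  proof -
    obtain f' where f': "f' \<in> Hom C c' d" "g' = ya f'" using ya_full[OF c' g'] .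
    show ?thesis using d idd f f' id_ya by blast
  qed
  fix p p' assume p: "p \<in> Hom C c' c" "p' \<in> Hom C c' c" and eq: "g \<bullet>\<^bsub>psh\<^esub> ya p = g \<bullet>\<^bsub>psh\<^esub> ya p'"
  have "ya (f \<bullet> p) = ya (f \<bullet> p')"
    using yoneda.FA_Comp[OF p(1) f(1)] yoneda.FA_Comp[OF p(2) f(1)] eq f(2) by simp
  then have "f \<bullet> p = f \<bullet> p'" using ya_faithful Comp_Hom[OF p(1) f(1)] Comp_Hom[OF p(2) f(1)] by blast
  then show "\<exists>e\<in>Obj C. \<exists>h\<in>Hom psh (yo e) (yo d). \<exists>w\<in>Hom C c e. g = h \<bullet>\<^bsub>psh\<^esub> ya w \<and> w \<bullet> p = w \<bullet> p'"
    using d idd f id_ya by blast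
qed

text \<open>Every element of \<open>P\<close>, and every equation between elements, already occurs
  at some stage. Filteredness of \<open>I\<close> brings finitely many of them to one stage, where
  flatness is applied; the resulting witnesses are then pushed forward by the leg.\<close>

lemma flat_colimit:
  fixes I :: "('u, 'u, 'y) cat_scheme"
  assumes I: "small (Obj I)" "filtered I" and L: "is_colimit I psh G P \<mu>"
    and fl: "\<And>i. i \<in> Obj I \<Longrightarrow> flat (FO G i)"
  shows "flat P"
  unfolding flat_def
proof (intro conjI ballI impI)
  interpret G: cat_functor I psh G by (rule psh.is_colimitD(1)[OF L])
  note hc = psh_hom_colimit[OF infinite_universe I(2) L]
  have \<mu>: "\<mu> i \<in> Hom psh (FO G i) P" if "i \<in> Obj I" for i using psh.is_colimitD(4)[OF L that] .
  have \<mu>G: "\<mu> k \<bullet>\<^bsub>psh\<^esub> (FA G u \<bullet>\<^bsub>psh\<^esub> g) = \<mu> i \<bullet>\<^bsub>psh\<^esub> g"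
    if "u \<in> Hom I i k" "g \<in> Hom psh X (FO G i)" for u i k g X
    using psh.cocone_comp_assoc[OF psh.is_colimitD(1,2)[OF L] that] .
  have \<mu>ya: "\<mu> i \<bullet>\<^bsub>psh\<^esub> (g \<bullet>\<^bsub>psh\<^esub> ya f) = (\<mu> i \<bullet>\<^bsub>psh\<^esub> g) \<bullet>\<^bsub>psh\<^esub> ya f"
    if "i \<in> Obj I" "g \<in> Hom psh (yo c) (FO G i)" "f \<in> Hom C d c" for i g f c d
    using psh.Comp_assoc[OF ya_Hom(1)[OF that(3)] that(2) \<mu>[OF that(1)]] .
  show "P \<in> Obj psh" using psh.is_colimitD(3)[OF L] .
  obtain i where i: "i \<in> Obj I" using I(2) by (auto simp: filtered_def)
  show "\<exists>c\<in>Obj C. Hom psh (yo c) P \<noteq> {}"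
    using flatD(2)[OF fl[OF i]] psh.Comp_Hom[OF _ \<mu>[OF i]] by blast
  fix c assume c: "c \<in> Obj C"
  \<comment> \<open>The value at \<open>c\<close> is covered by the images of the values of the
    stages, a small union of small sets. Regularity of the universe makes this small.\<close>
  have "Hom psh (yo c) P \<subseteq> (\<Union>i\<in>Obj I. (\<lambda>g. \<mu> i \<bullet>\<^bsub>psh\<^esub> g) ` Hom psh (yo c) (FO G i))"
  proof
    fix g assume "g \<in> Hom psh (yo c) P"
    then obtain i g' where "i \<in> Obj I" "g' \<in> Hom psh (yo c) (FO G i)" "g = \<mu> i \<bullet>\<^bsub>psh\<^esub> g'"
      using hom_colimit_factor[OF hc[OF c]] by metis
    then show "g \<in> (\<Union>i\<in>Obj I. (\<lambda>g. \<mu> i \<bullet>\<^bsub>psh\<^esub> g) ` Hom psh (yo c) (FO G i))" by blast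
  qed
  moreover have "|\<Union>i\<in>Obj I. (\<lambda>g. \<mu> i \<bullet>\<^bsub>psh\<^esub> g) ` Hom psh (yo c) (FO G i)| <o |UNIV :: 'u set|"
  proof (rule universe_small_UN[OF universe])
    show "|Obj I| <o |UNIV :: 'u set|" using I(1) by (simp add: small_def)
    fix i assume "i \<in> Obj I"
    then show "|(\<lambda>g. \<mu> i \<bullet>\<^bsub>psh\<^esub> g) ` Hom psh (yo c) (FO G i)| <o |UNIV :: 'u set|"
      by (rule small_image[OF flatD(5)[OF fl c]])
  qed
  ultimately show "|Hom psh (yo c) P| <o |UNIV :: 'u set|" by (rule small_subset)
  fix c' g assume c': "c' \<in> Obj C" and g: "g \<in> Hom psh (yo c) P"
  obtain i g1 where i: "i \<in> Obj I" and g1: "g1 \<in> Hom psh (yo c) (FO G i)" and gg1: "g = \<mu> i \<bullet>\<^bsub>psh\<^esub> g1"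
    using hom_colimit_factor[OF hc[OF c] g] .
  show "\<exists>d\<in>Obj C. \<exists>h\<in>Hom psh (yo d) P. \<exists>f\<in>Hom C c d. \<exists>f'\<in>Hom C c' d.
      g = h \<bullet>\<^bsub>psh\<^esub> ya f \<and> g' = h \<bullet>\<^bsub>psh\<^esub> ya f'" if g': "g' \<in> Hom psh (yo c') P" for g'
  proof -
    obtain j g2 where j: "j \<in> Obj I" and g2: "g2 \<in> Hom psh (yo c') (FO G j)" and gg2: "g' = \<mu> j \<bullet>\<^bsub>psh\<^esub> g2"
      using hom_colimit_factor[OF hc[OF c'] g'] .
    obtain k u v where k: "k \<in> Obj I" and u: "u \<in> Hom I i k" and v: "v \<in> Hom I j k"
      using filtered_upper[OF I(2) i j] .
    obtain d h f f' where d: "d \<in> Obj C" and h: "h \<in> Hom psh (yo d) (FO G k)"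
      and f: "f \<in> Hom C c d" "f' \<in> Hom C c' d"
      and eq: "FA G u \<bullet>\<^bsub>psh\<^esub> g1 = h \<bullet>\<^bsub>psh\<^esub> ya f" "FA G v \<bullet>\<^bsub>psh\<^esub> g2 = h \<bullet>\<^bsub>psh\<^esub> ya f'"
      using flatD(3)[OF fl[OF k] c c' psh.Comp_Hom[OF g1 G.FA_Hom[OF u]] psh.Comp_Hom[OF g2 G.FA_Hom[OF v]]]
      by blast
    have "g = (\<mu> k \<bullet>\<^bsub>psh\<^esub> h) \<bullet>\<^bsub>psh\<^esub> ya f" "g' = (\<mu> k \<bullet>\<^bsub>psh\<^esub> h) \<bullet>\<^bsub>psh\<^esub> ya f'"
      using \<mu>G[OF u g1] \<mu>G[OF v g2] eq \<mu>ya[OF k h f(1)] \<mu>ya[OF k h f(2)] gg1 gg2 by simp_all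
    then show ?thesis using d f psh.Comp_Hom[OF h \<mu>[OF k]] by blast
  qed
  fix f f' assume f: "f \<in> Hom C c' c" "f' \<in> Hom C c' c" and eq: "g \<bullet>\<^bsub>psh\<^esub> ya f = g \<bullet>\<^bsub>psh\<^esub> ya f'"
  have "\<mu> i \<bullet>\<^bsub>psh\<^esub> (g1 \<bullet>\<^bsub>psh\<^esub> ya f) = \<mu> i \<bullet>\<^bsub>psh\<^esub> (g1 \<bullet>\<^bsub>psh\<^esub> ya f')"
    using \<mu>ya[OF i g1 f(1)] \<mu>ya[OF i g1 f(2)] eq gg1 by simp
  \<comment> \<open>The equation holds in \<open>P\<close> and need not hold at stage
    \<open>i\<close>. It does hold after a transition \<open>u\<close> to a later stage, so flatness
    is applied to the transported element at \<open>k\<close>.\<close>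
  then obtain k u where k: "k \<in> Obj I" and u: "u \<in> Hom I i k"
    and eq1: "FA G u \<bullet>\<^bsub>psh\<^esub> (g1 \<bullet>\<^bsub>psh\<^esub> ya f) = FA G u \<bullet>\<^bsub>psh\<^esub> (g1 \<bullet>\<^bsub>psh\<^esub> ya f')"
    using hom_colimit_eq[OF hc[OF c'] i psh.Comp_Hom[OF ya_Hom(1)[OF f(1)] g1] psh.Comp_Hom[OF ya_Hom(1)[OF f(2)] g1]]
    by blast
  have ug1: "FA G u \<bullet>\<^bsub>psh\<^esub> g1 \<in> Hom psh (yo c) (FO G k)" using psh.Comp_Hom[OF g1 G.FA_Hom[OF u]] .
  have "(FA G u \<bullet>\<^bsub>psh\<^esub> g1) \<bullet>\<^bsub>psh\<^esub> ya f = (FA G u \<bullet>\<^bsub>psh\<^esub> g1) \<bullet>\<^bsub>psh\<^esub> ya f'"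
    using psh.Comp_assoc[OF ya_Hom(1)[OF f(1)] g1 G.FA_Hom[OF u]]
      psh.Comp_assoc[OF ya_Hom(1)[OF f(2)] g1 G.FA_Hom[OF u]] eq1 by simp
  then obtain e h w where e: "e \<in> Obj C" and h: "h \<in> Hom psh (yo e) (FO G k)" and w: "w \<in> Hom C c e"
    and eq2: "FA G u \<bullet>\<^bsub>psh\<^esub> g1 = h \<bullet>\<^bsub>psh\<^esub> ya w" and wf: "w \<bullet> f = w \<bullet> f'"
    using flatD(4)[OF fl[OF k] c c' ug1 f] by blast
  have "g = (\<mu> k \<bullet>\<^bsub>psh\<^esub> h) \<bullet>\<^bsub>psh\<^esub> ya w"
    using \<mu>G[OF u g1] eq2 \<mu>ya[OF k h w] gg1 by simp
  then show "\<exists>e\<in>Obj C. \<exists>h\<in>Hom psh (yo e) P. \<exists>w\<in>Hom C c e. g = h \<bullet>\<^bsub>psh\<^esub> ya w \<and> w \<bullet> f = w \<bullet> f'"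
    using e w wf psh.Comp_Hom[OF h \<mu>[OF k]] by blast
qed

text \<open>The comma category of the Yoneda embedding over \<open>P\<close>, with arrows directed
  as in \<open>C\<close>. An arrow records its underlying arrow of \<open>C\<close> and its target
  element; the source element is the restriction of the latter and needs no record.\<close>

definition elements :: "'u presheaf \<Rightarrow> ('u \<times> 'u presheaf_arr, 'u \<times> 'u presheaf_arr) cat" where
  "elements P = \<lparr>Obj = (SIGMA c:Obj C. Hom psh (yo c) P),
     Arr = (SIGMA f:Arr C. Hom psh (yo (Cod C f)) P),
     Dom = (\<lambda>(f, g). (Dom C f, g \<bullet>\<^bsub>psh\<^esub> ya f)), Cod = (\<lambda>(f, g). (Cod C f, g)),
     Ident = (\<lambda>(c, g). (Ident C c, g)), Comp = (\<lambda>(f', g') (f, g). (f' \<bullet> f, g'))\<rparr>"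

lemma elements_sel [simp]:
  "Obj (elements P) = (SIGMA c:Obj C. Hom psh (yo c) P)"
  "Arr (elements P) = (SIGMA f:Arr C. Hom psh (yo (Cod C f)) P)"
  "Dom (elements P) (f, g) = (Dom C f, g \<bullet>\<^bsub>psh\<^esub> ya f)" "Cod (elements P) (f, g) = (Cod C f, g)"
  "Ident (elements P) (c, g) = (Ident C c, g)" "Comp (elements P) (f', g') (f, g) = (f' \<bullet> f, g')"
  by (simp_all add: elements_def)

lemma Hom_elements:
  "u \<in> Hom (elements P) (c, g) (d, h) \<longleftrightarrow>
    (\<exists>f\<in>Hom C c d. u = (f, h) \<and> h \<in> Hom psh (yo d) P \<and> g = h \<bullet>\<^bsub>psh\<^esub> ya f)"
  by (cases u) (auto simp: Hom_def[of "elements P"] Hom_def[of C])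

lemma category_elements: "category (elements P)"
proof
  let ?J = "elements P"
  show "u \<in> Arr ?J \<Longrightarrow> Dom ?J u \<in> Obj ?J" for u
    using psh.Comp_Hom[OF ya_Hom(1)[OF Arr_Hom]] by (auto simp: Dom_Obj)
  show "u \<in> Arr ?J \<Longrightarrow> Cod ?J u \<in> Obj ?J" for u by (auto simp: Cod_Obj)
  show "Ident ?J X \<in> Hom ?J X X" if "X \<in> Obj ?J" for X
    using that Ident_Hom yoneda.FA_Ident psh.Ident_right
    by (cases X) (auto simp: Hom_elements intro!: bexI[of _ "Ident C (fst X)"])
  show "v \<bullet>\<^bsub>?J\<^esub> u \<in> Hom ?J X Z" if u: "u \<in> Hom ?J X Y" and v: "v \<in> Hom ?J Y Z" for u v X Y Z
  proof -
    obtain c g d h e k where X: "X = (c, g)" "Y = (d, h)" "Z = (e, k)" by (metis prod.exhaust)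
    obtain f where f: "f \<in> Hom C c d" "u = (f, h)" "g = h \<bullet>\<^bsub>psh\<^esub> ya f"
      using u X by (auto simp: Hom_elements)
    obtain f' where f': "f' \<in> Hom C d e" "v = (f', k)" "k \<in> Hom psh (yo e) P" "h = k \<bullet>\<^bsub>psh\<^esub> ya f'"
      using v X by (auto simp: Hom_elements)
    have "g = k \<bullet>\<^bsub>psh\<^esub> ya (f' \<bullet> f)"
      using f f' yoneda.FA_Comp[OF f(1) f'(1)]
        psh.Comp_assoc[OF ya_Hom(1)[OF f(1)] ya_Hom(1)[OF f'(1)] f'(3)] by simp
    then show ?thesis using X f(1,2) f'(1-3) Comp_Hom[OF f(1) f'(1)] by (simp add: Hom_elements)
  qed
  show "Ident ?J Y \<bullet>\<^bsub>?J\<^esub> u = u" if "u \<in> Hom ?J X Y" for u X Y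
    using that Ident_left by (cases X; cases Y) (auto simp: Hom_elements)
  show "u \<bullet>\<^bsub>?J\<^esub> Ident ?J X = u" if "u \<in> Hom ?J X Y" for u X Y
    using that Ident_right by (cases X; cases Y) (auto simp: Hom_elements)
  show "w \<bullet>\<^bsub>?J\<^esub> (v \<bullet>\<^bsub>?J\<^esub> u) = (w \<bullet>\<^bsub>?J\<^esub> v) \<bullet>\<^bsub>?J\<^esub> u"
    if "u \<in> Hom ?J W X" "v \<in> Hom ?J X Y" "w \<in> Hom ?J Y Z" for u v w W X Y Z
    using that Comp_assoc by (cases W; cases X; cases Y; cases Z) (auto simp: Hom_elements)
qed

lemma filtered_elements:
  assumes P: "flat P"
  shows "filtered (elements P)"
  unfolding filtered_def
proof (intro conjI ballI category_elements)
  show "Obj (elements P) \<noteq> {}" using flatD(2)[OF P] by auto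
  fix x y assume "x \<in> Obj (elements P)" "y \<in> Obj (elements P)"
  then obtain c g d h where x: "x = (c, g)" "c \<in> Obj C" "g \<in> Hom psh (yo c) P"
    and y: "y = (d, h)" "d \<in> Obj C" "h \<in> Hom psh (yo d) P" by auto
  obtain e k f f' where e: "e \<in> Obj C" "k \<in> Hom psh (yo e) P" "f \<in> Hom C c e" "f' \<in> Hom C d e"
    "g = k \<bullet>\<^bsub>psh\<^esub> ya f" "h = k \<bullet>\<^bsub>psh\<^esub> ya f'"
    using flatD(3)[OF P x(2) y(2) x(3) y(3)] by blast
  have "(f, k) \<in> Hom (elements P) x (e, k)" "(f', k) \<in> Hom (elements P) y (e, k)"
    using e x y by (auto simp: Hom_elements)
  then show "\<exists>z\<in>Obj (elements P). Hom (elements P) x z \<noteq> {} \<and> Hom (elements P) y z \<noteq> {}"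
    using e(1,2) by (intro bexI[of _ "(e, k)"]) auto
  fix u v assume u: "u \<in> Hom (elements P) x y" and v: "v \<in> Hom (elements P) x y"
  obtain f f' where f: "f \<in> Hom C c d" "u = (f, h)" "g = h \<bullet>\<^bsub>psh\<^esub> ya f"
    and f': "f' \<in> Hom C c d" "v = (f', h)" "g = h \<bullet>\<^bsub>psh\<^esub> ya f'"
    using u v x(1) y(1) by (auto simp: Hom_elements)
  obtain e k w where e: "e \<in> Obj C" "k \<in> Hom psh (yo e) P" "w \<in> Hom C d e" "h = k \<bullet>\<^bsub>psh\<^esub> ya w"
    "w \<bullet> f = w \<bullet> f'"
    using flatD(4)[OF P y(2) x(2) y(3) f(1) f'(1)] f(3) f'(3) by metis
  have "(w, k) \<in> Hom (elements P) y (e, k)" using e y(1) by (auto simp: Hom_elements)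
  moreover have "(w, k) \<bullet>\<^bsub>elements P\<^esub> u = (w, k) \<bullet>\<^bsub>elements P\<^esub> v" using f(2) f'(2) e(5) by simp
  ultimately show "\<exists>z\<in>Obj (elements P). \<exists>w\<in>Hom (elements P) y z. w \<bullet>\<^bsub>elements P\<^esub> u = w \<bullet>\<^bsub>elements P\<^esub> v"
    using e(1,2) by (intro bexI[of _ "(e, k)"] bexI[of _ "(w, k)"]) auto
qed

definition elements_proj :: "('u \<times> 'u presheaf_arr, 'u \<times> 'u presheaf_arr, 'u, 'u) func" where
  "elements_proj = \<lparr>FO = fst, FA = fst\<rparr>"

lemma cat_functor_elements_proj: "cat_functor (elements P) C elements_proj"
proof (intro cat_functor.intro cat_functor_axioms.intro category_elements category_axioms)
  show "FO elements_proj X \<in> Obj C" if "X \<in> Obj (elements P)" for X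
    using that by (auto simp: elements_proj_def)
  show "FA elements_proj u \<in> Hom C (FO elements_proj X) (FO elements_proj Y)"
    if "u \<in> Hom (elements P) X Y" for u X Y
    using that by (cases X; cases Y) (auto simp: elements_proj_def Hom_elements)
  show "FA elements_proj (Ident (elements P) X) = Ident C (FO elements_proj X)"
    if "X \<in> Obj (elements P)" for X
    using that by (auto simp: elements_proj_def)
  show "FA elements_proj (v \<bullet>\<^bsub>elements P\<^esub> u) = FA elements_proj v \<bullet> FA elements_proj u" for u v
    by (cases u; cases v) (simp add: elements_proj_def)
qed

text \<open>Every presheaf is the canonical colimit of representables over its elements, the leg at
  an element being that element itself, hence \<open>snd\<close>. A cocone over this diagram is
  exactly a family as in \<open>yo_dense\<close>.\<close>

lemma elements_colimit:
  assumes P: "P \<in> Obj psh"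
  shows "is_colimit (elements P) psh (comp_func (yoneda C) elements_proj) P snd"
proof (rule psh.is_colimitI)
  let ?G = "comp_func (yoneda C) elements_proj"
  show "cat_functor (elements P) psh ?G"
    using cat_functor_comp[OF cat_functor_elements_proj yoneda.cat_functor_axioms] .
  show "cocone (elements P) psh ?G P snd"
    using P by (auto simp: cocone_def elements_proj_def)
  fix M
  show "\<exists>h\<in>Hom psh P M. \<forall>x\<in>Obj (elements P). h \<bullet>\<^bsub>psh\<^esub> snd x = \<nu> x"
    if \<nu>: "cocone (elements P) psh ?G M \<nu>" for \<nu>
  proof -
    have M: "M \<in> Obj psh" using \<nu> by (simp add: cocone_def)
    obtain h where "h \<in> Hom psh P M"
      "\<And>c g. c \<in> Obj C \<Longrightarrow> g \<in> Hom psh (yo c) P \<Longrightarrow> h \<bullet>\<^bsub>psh\<^esub> g = \<nu> (c, g)"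
    proof (rule yo_dense[OF P M, of "\<lambda>c g. \<nu> (c, g)"])
      show "\<nu> (c, g) \<in> Hom psh (yo c) M" if "c \<in> Obj C" "g \<in> Hom psh (yo c) P" for c g
        using \<nu> that by (auto simp: cocone_def elements_proj_def)
      fix c d f g assume f: "f \<in> Hom C d c" and g: "g \<in> Hom psh (yo c) P"
      have "(f, g) \<in> Arr (elements P)" using f g by (auto simp: Hom_def[of C])
      then have "\<nu> (Cod C f, g) \<bullet>\<^bsub>psh\<^esub> ya f = \<nu> (Dom C f, g \<bullet>\<^bsub>psh\<^esub> ya f)"
        using \<nu> unfolding cocone_def by (auto simp: elements_proj_def)
      then show "\<nu> (d, g \<bullet>\<^bsub>psh\<^esub> ya f) = \<nu> (c, g) \<bullet>\<^bsub>psh\<^esub> ya f" using f by (simp add: Hom_def[of C])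
    qed blast
    then have "\<forall>x\<in>Obj (elements P). h \<bullet>\<^bsub>psh\<^esub> snd x = \<nu> x" by (simp add: Ball_def split_paired_all)
    with \<open>h \<in> Hom psh P M\<close> show ?thesis by blast
  qed
  show "h = k" if "h \<in> Hom psh P M" "k \<in> Hom psh P M"
    "\<And>x. x \<in> Obj (elements P) \<Longrightarrow> h \<bullet>\<^bsub>psh\<^esub> snd x = k \<bullet>\<^bsub>psh\<^esub> snd x" for h k
    by (rule yo_joint_epi[OF that(1,2)]) (use that(3) in fastforce)
qed

lemma small_elements:
  assumes P: "flat P"
  shows "|Obj (elements P)| <o |UNIV :: 'u set|" "|Arr (elements P)| <o |UNIV :: 'u set|"
proof -
  have small: "|Obj C| <o |UNIV :: 'u set|" "|Arr C| <o |UNIV :: 'u set|"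
    using small_C by (simp_all add: small_cat_def small_def)
  show "|Obj (elements P)| <o |UNIV :: 'u set|"
    unfolding elements_sel by (rule universe_small_Sigma[OF universe small(1) flatD(5)[OF P]])
  show "|Arr (elements P)| <o |UNIV :: 'u set|"
    unfolding elements_sel
    by (rule universe_small_Sigma[OF universe small(2) flatD(5)[OF P Cod_Obj]])
qed

definition ind_obj :: "'u presheaf \<Rightarrow> bool" where
  "ind_obj P \<longleftrightarrow> (\<exists>(I :: ('u, 'u) cat) G \<mu>. small_cat I \<and> filtered I \<and> cat_functor I C G \<and>
     is_colimit I psh (comp_func (yoneda C) G) P \<mu>)"

lemma ind_cat_eq: "ind_cat C = full_subcat psh (Collect ind_obj)"
  by (simp add: ind_cat_def ind_obj_def[abs_def])

text \<open>A flat presheaf is presented by the canonical diagram over its elements, copied to an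
  index category in \<open>'u\<close>. Conversely representables are flat, and flatness passes to
  the colimit of any presenting diagram.\<close>

lemma ind_obj_flat: "ind_obj P \<longleftrightarrow> flat P"
proof
  assume P: "flat P"
  obtain I :: "('u, 'u) cat" and \<Phi> where I: "small_cat I" and \<Phi>: "cat_iso I (elements P) \<Phi>"
    using small_model[OF category_elements small_elements[OF P]] .
  have "is_colimit I psh (comp_func (yoneda C) (comp_func elements_proj \<Phi>)) P (\<lambda>i. snd (FO \<Phi> i))"
    unfolding comp_func_assoc
    using cat_iso_colimit[OF \<Phi> psh.category_axioms elements_colimit[OF flatD(1)[OF P]]] .
  moreover have "cat_functor I C (comp_func elements_proj \<Phi>)"
    using \<Phi> cat_functor_comp[OF _ cat_functor_elements_proj] by (auto simp: cat_iso_def)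
  ultimately show "ind_obj P"
    using I cat_iso_filtered[OF \<Phi> filtered_elements[OF P]] unfolding ind_obj_def by blast
next
  assume "ind_obj P"
  then obtain I :: "('u, 'u) cat" and G \<mu> where I: "small_cat I" "filtered I" and G: "cat_functor I C G"
    and L: "is_colimit I psh (comp_func (yoneda C) G) P \<mu>" unfolding ind_obj_def by blast
  interpret G: cat_functor I C G by (rule G)
  show "flat P"
    using flat_colimit[OF _ I(2) L] I(1) flat_yo[OF G.FO_Obj] by (simp add: small_cat_def)
qed

lemma category_ind_cat: "category (ind_cat C)"
  unfolding ind_cat_eq by (rule psh.category_full_subcat)

lemma Hom_ind_cat: "flat P \<Longrightarrow> flat Q \<Longrightarrow> Hom (ind_cat C) P Q = Hom psh P Q"
  by (simp add: ind_cat_eq Hom_full_subcat ind_obj_flat)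

lemma Obj_ind_cat: "P \<in> Obj (ind_cat C) \<longleftrightarrow> flat P"
  using flatD(1) by (auto simp: ind_cat_eq ind_obj_flat)

text \<open>The given colimit \<open>L\<close> is known only inside the ind-completion. The colimit
  \<open>P\<close> of the same diagram among presheaves is computed pointwise and is flat, hence a
  colimit in the ind-completion as well; the property then passes from \<open>P\<close> to
  \<open>L\<close> along the isomorphism.\<close>

lemma yo_ind_hom_colimit:
  fixes I :: "('u, 'u) cat"
  assumes I: "small_cat I" "filtered I" and L: "is_colimit I (ind_cat C) G L \<mu>" and c: "c \<in> Obj C"
  shows "hom_colimit I (ind_cat C) G L \<mu> (yo c)"
proof -
  interpret ind: category "ind_cat C" by (rule category_ind_cat)
  interpret G: cat_functor I "ind_cat C" G by (rule ind.is_colimitD(1)[OF L])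
  have Gpsh: "cat_functor I psh G"
    using cat_functor_from_full_subcat[OF psh.category_axioms] G.cat_functor_axioms by (simp add: ind_cat_eq)
  have flG: "flat (FO G i)" if "i \<in> Obj I" for i using G.FO_Obj[OF that] by (simp add: Obj_ind_cat)
  obtain P \<nu> where P: "is_colimit I psh G P \<nu>"
    and hc: "\<And>c. c \<in> Obj C \<Longrightarrow> hom_colimit I psh G P \<nu> (yo c)"
    using psh_colimit_exists[OF infinite_universe I(2) Gpsh] by metis
  have flP: "flat P" using flat_colimit[OF _ I(2) P flG] I(1) by (simp add: small_cat_def)
  have P': "is_colimit I (ind_cat C) G P \<nu>"
    unfolding ind_cat_eq
    using is_colimit_full_subcat[OF psh.category_axioms P] flG flP by (simp add: ind_obj_flat)
  have "hom_colimit I (ind_cat C) G P \<nu> (yo c)"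
    using hc[OF c] flG flP flat_yo[OF c]
    by (simp add: hom_colimit_def Hom_ind_cat) (simp add: ind_cat_eq)
  then show ?thesis
    using ind.hom_colimit_iso[OF _ P' L] flat_yo[OF c] by (simp add: Obj_ind_cat)
qed

lemma ind_obj_colimit:
  assumes P: "P \<in> Obj (ind_cat C)"
  obtains I :: "('u, 'u) cat" and G \<mu> where "small_cat I" "filtered I" "cat_functor I C G"
    "is_colimit I (ind_cat C) (comp_func (yoneda C) G) P \<mu>"
proof -
  have flP: "flat P" using P by (simp add: Obj_ind_cat)
  then obtain I :: "('u, 'u) cat" and G \<mu> where I: "small_cat I" "filtered I" and G: "cat_functor I C G"
    and L: "is_colimit I psh (comp_func (yoneda C) G) P \<mu>"
    unfolding ind_obj_flat[symmetric] ind_obj_def by blast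
  interpret G: cat_functor I C G by (rule G)
  have "is_colimit I (ind_cat C) (comp_func (yoneda C) G) P \<mu>"
    unfolding ind_cat_eq
    using is_colimit_full_subcat[OF psh.category_axioms L] flat_yo[OF G.FO_Obj] flP
    by (simp add: ind_obj_flat)
  then show thesis using I G that by blast
qed

text \<open>The inverse equivalence turns \<open>X\<close> into an ind-object, whose presentation by
  representables is carried back by \<open>E\<close>. This ends at \<open>FO E (FO H X)\<close>, and
  \<open>\<theta> X\<close> moves the vertex to \<open>X\<close>.\<close>

lemma colimit_of_compact_objects:
  assumes E: "equivalence_functor (ind_cat C) D E" and X: "X \<in> Obj D"
  obtains I :: "('u, 'u) cat" and G \<mu> where "small_cat I" "filtered I" "is_colimit I D G X \<mu>"
    "\<And>i. i \<in> Obj I \<Longrightarrow> compact_object TYPE('u) D (FO G i)"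
proof -
  obtain H \<eta> \<theta> where H: "equivalence_functor D (ind_cat C) H"
    and \<theta>: "nat_iso D D (comp_func E H) id_func \<theta>"
    using equivalence_functor_inverse[OF E] .
  interpret H: cat_functor D "ind_cat C" H using H by (simp add: equivalence_functor_def)
  obtain I :: "('u, 'u) cat" and G \<mu> where I: "small_cat I" "filtered I" and G: "cat_functor I C G"
    and L: "is_colimit I (ind_cat C) (comp_func (yoneda C) G) (FO H X) \<mu>"
    using ind_obj_colimit[OF H.FO_Obj[OF X]] .
  interpret G: cat_functor I C G by (rule G)
  obtain k where k: "inverse_arrows D (\<theta> X) k" using nat_isoD(5)[OF \<theta> X] by blast
  have \<theta>X: "\<theta> X \<in> Hom D (FO E (FO H X)) X" using nat_isoD(3)[OF \<theta> X] by simp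
  have "is_colimit I D (comp_func E (comp_func (yoneda C) G)) X (\<lambda>i. \<theta> X \<bullet>\<^bsub>D\<^esub> FA E (\<mu> i))"
    using H.A.is_colimit_iso[OF equivalence_functor_colimit[OF E L] \<theta>X k] .
  moreover have "compact_object TYPE('u) D (FO (comp_func E (comp_func (yoneda C) G)) i)"
    if i: "i \<in> Obj I" for i
  proof -
    have c: "FO G i \<in> Obj C" using G.FO_Obj[OF i] .
    have "compact_object TYPE('u) D (FO E (yo (FO G i)))"
      using equivalence_functor_compact[OF E _ yo_ind_hom_colimit[OF _ _ _ c]] flat_yo[OF c]
      by (simp add: Obj_ind_cat)
    then show ?thesis by simp
  qed
  ultimately show thesis using I that by blast
qed

end

section \<open>Transport of the vertex algebra\<close>

context preadditive_category
begin

lemma hom_group_sel [simp]: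
  "carrier (hom_group C X Y) = Hom C X Y" "one (hom_group C X Y) = Zero C X Y"
  "monoid.mult (hom_group C X Y) = Plus C"
  by (simp_all add: hom_group_def)

lemma group_hom_group: "X \<in> Obj C \<Longrightarrow> Y \<in> Obj C \<Longrightarrow> group (hom_group C X Y)"
  using hom_comm_group by (simp add: comm_group_def)

lemma arr_minus_Hom:
  assumes "f \<in> Hom C X Y" "g \<in> Hom C X Y"
  shows "arr_minus C X Y f g \<in> Hom C X Y"
proof -
  interpret G: group "hom_group C X Y" using group_hom_group Hom_Obj[OF assms(1)] by blast
  show ?thesis using assms G.m_closed[OF _ G.inv_closed] by (simp add: arr_minus_def)
qed

end

text \<open>All axioms are transported along the additive maps \<open>f \<mapsto> F(f) \<circ> p\<close>.\<close>

definition pull :: "('p, 'b, 'y) cat_scheme \<Rightarrow> ('o, 'a, 'p, 'b) func \<Rightarrow> 'b \<Rightarrow> 'a \<Rightarrow> 'b" where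
  "pull D F p f = FA F f \<bullet>\<^bsub>D\<^esub> p"

text \<open>Additivity of \<open>F\<close> and distributivity of composition give a homomorphism.
  Zero, differences and integer multiples are then respected for free, and the operations on
  coefficients of distributions are built from these.\<close>

lemma pull_group_hom:
  assumes C: "preadditive_category C" and D: "preadditive_category D" and F: "additive_functor C D F"
    and p: "p \<in> Hom D W (FO F X)" and X: "X \<in> Obj C" and Y: "Y \<in> Obj C"
  shows "group_hom (hom_group C X Y) (hom_group D W (FO F Y)) (pull D F p)"
proof -
  interpret C: preadditive_category C by (rule C)
  interpret D: preadditive_category D by (rule D)
  interpret F: cat_functor C D F using F by (simp add: additive_functor_def)
  show ?thesis
  proof (intro group_hom.intro group_hom_axioms.intro C.group_hom_group D.group_hom_group X Y homI)
    show "W \<in> Obj D" using D.Hom_Obj[OF p] by simp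
    show "FO F Y \<in> Obj D" using F.FO_Obj[OF Y] .
    show "pull D F p f \<in> carrier (hom_group D W (FO F Y))" if "f \<in> carrier (hom_group C X Y)" for f
      using that D.Comp_Hom[OF p F.FA_Hom] by (simp add: pull_def)
    show "pull D F p (f \<otimes>\<^bsub>hom_group C X Y\<^esub> g) =
        pull D F p f \<otimes>\<^bsub>hom_group D W (FO F Y)\<^esub> pull D F p g"
      if "f \<in> carrier (hom_group C X Y)" "g \<in> carrier (hom_group C X Y)" for f g
      using that F X Y D.Comp_Plus_left[OF p F.FA_Hom F.FA_Hom]
      by (simp add: pull_def additive_functor_def)
  qed
qed

lemma mult_z_minus_w_Suc:
  "(mult_z_minus_w C X Y ^^ Suc K) f i j =
    arr_minus C X Y ((mult_z_minus_w C X Y ^^ K) f (i - 1) j) ((mult_z_minus_w C X Y ^^ K) f i (j - 1))"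
  by (simp add: mult_z_minus_w_def)

lemma mult_z_minus_w_Hom:
  assumes "preadditive_category C" "\<And>i j. f i j \<in> Hom C X Y"
  shows "(mult_z_minus_w C X Y ^^ K) f i j \<in> Hom C X Y"
  using assms preadditive_category.arr_minus_Hom[OF assms(1)]
  by (induction K arbitrary: i j) (auto simp: mult_z_minus_w_def)

text \<open>Multiplication by \<open>z - w\<close> shifts indices and takes differences. Shifts
  commute with any coefficientwise map, differences with a homomorphism.\<close>

lemma mult_z_minus_w_pull:
  assumes C: "preadditive_category C" and D: "preadditive_category D" and F: "additive_functor C D F"
    and p: "p \<in> Hom D W (FO F X)" and X: "X \<in> Obj C" and Y: "Y \<in> Obj C"
    and f: "\<And>i j. f i j \<in> Hom C X Y"
  shows "(mult_z_minus_w D W (FO F Y) ^^ K) (\<lambda>i j. pull D F p (f i j)) =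
    (\<lambda>i j. pull D F p ((mult_z_minus_w C X Y ^^ K) f i j))"
proof (induction K)
  case (Suc K)
  interpret H: group_hom "hom_group C X Y" "hom_group D W (FO F Y)" "pull D F p"
    by (rule pull_group_hom[OF assms(1-6)])
  have "arr_minus D W (FO F Y) (pull D F p x) (pull D F p y) = pull D F p (arr_minus C X Y x y)"
    if "x \<in> Hom C X Y" "y \<in> Hom C X Y" for x y
    using that H.hom_mult[of x "inv\<^bsub>hom_group C X Y\<^esub> y"] H.hom_inv[of y] H.G.inv_closed[of y]
    by (simp add: arr_minus_def preadditive_category.hom_group_sel[OF C])
  then show ?case
    unfolding fun_eq_iff mult_z_minus_w_Suc Suc.IH using mult_z_minus_w_Hom[OF C f] by simp
qed simp

text \<open>The assumption \<open>factor\<close> isolates what the presentation of \<open>V\<close>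
  by compact objects contributes. What remains is computation with the coherence of \<open>J\<close>
  and \<open>e\<close>.\<close>

locale vertex_algebra_transport =
  lax_symmetric_monoidal_functor C D F J e + C: preadditive_category C + D: preadditive_category D +
  V: vertex_algebra U C V vac T m
  for U :: "'u itself" and C :: "('o, 'a) mon_cat" and D :: "('p, 'b) mon_cat"
    and F :: "('o, 'a, 'p, 'b) func" and J e V vac T m +
  assumes additive: "additive_functor C D F"
    and factor: "compact_object U D X \<Longrightarrow> \<alpha> \<in> Hom D X (FO F V) \<Longrightarrow>
      \<exists>X'. compact_object U C X' \<and> (\<exists>a\<in>Hom C X' V. \<exists>\<alpha>'\<in>Hom D X (FO F X'). \<alpha> = FA F a \<bullet>\<^bsub>D\<^esub> \<alpha>')"
begin

abbreviation VF where "VF \<equiv> FO F V"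
abbreviation vacF where "vacF \<equiv> FA F vac \<bullet>\<^bsub>D\<^esub> e"
abbreviation mF where "mF n \<equiv> FA F (m n) \<bullet>\<^bsub>D\<^esub> J V V"

lemma V_Obj: "V \<in> Obj C" by (rule V.V_Obj)
lemma VF_Obj: "VF \<in> Obj D" using FO_Obj[OF V_Obj] .
lemma vac_Hom: "vac \<in> Hom C \<one>\<^sub>o\<^bsub>C\<^esub> V" by (rule V.vac_Hom)
lemma T_Hom: "T \<in> Hom C V V" by (rule V.T_Hom)
lemma m_Hom: "m n \<in> Hom C (V \<odot>\<^bsub>C\<^esub> V) V" by (rule V.m_Hom)
lemma JV: "J V V \<in> Hom D (VF \<odot>\<^bsub>D\<^esub> VF) (FO F (V \<odot>\<^bsub>C\<^esub> V))" using J_Hom[OF V_Obj V_Obj] .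
lemma VV_Obj: "V \<odot>\<^bsub>C\<^esub> V \<in> Obj C" using C.TenO_Obj[OF V_Obj V_Obj] .
lemma idV: "Ident C V \<in> Hom C V V" using C.Ident_Hom[OF V_Obj] .
lemma F_idV: "FA F (Ident C V) = Ident D VF" using FA_Ident[OF V_Obj] .
lemma idVF: "Ident D VF \<in> Hom D VF VF" using D.Ident_Hom[OF VF_Obj] .

lemma pull_comp:
  assumes "f \<in> Hom C X Y" "g \<in> Hom C Y Z" "p \<in> Hom D W (FO F X)"
  shows "FA F g \<bullet>\<^bsub>D\<^esub> (FA F f \<bullet>\<^bsub>D\<^esub> p) = pull D F p (g \<bullet>\<^bsub>C\<^esub> f)"
  using FA_Comp[OF assms(1,2)] D.Comp_assoc[OF assms(3) FA_Hom[OF assms(1)] FA_Hom[OF assms(2)]]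
  by (simp add: pull_def)

lemma pull_Zero:
  assumes "p \<in> Hom D W (FO F X)" "X \<in> Obj C" "Y \<in> Obj C"
  shows "pull D F p (Zero C X Y) = Zero D W (FO F Y)"
  using group_hom.hom_one[OF pull_group_hom[OF C.preadditive_category_axioms
        D.preadditive_category_axioms additive assms]] by simp

lemma pull_arr_minus:
  assumes "p \<in> Hom D W (FO F X)" "f \<in> Hom C X Y" "g \<in> Hom C X Y"
  shows "pull D F p (arr_minus C X Y f g) = arr_minus D W (FO F Y) (pull D F p f) (pull D F p g)"
proof -
  have XY: "X \<in> Obj C" "Y \<in> Obj C" using C.Hom_Obj[OF assms(2)] by auto
  interpret H: group_hom "hom_group C X Y" "hom_group D W (FO F Y)" "pull D F p"
    by (rule pull_group_hom[OF C.preadditive_category_axioms D.preadditive_category_axioms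
          additive assms(1) XY])
  show ?thesis
    using assms(2,3) H.hom_mult[of f "inv\<^bsub>hom_group C X Y\<^esub> g"] H.hom_inv[of g] H.G.inv_closed[of g]
    by (simp add: arr_minus_def)
qed

lemma pull_arr_scale:
  assumes "p \<in> Hom D W (FO F X)" "f \<in> Hom C X Y"
  shows "pull D F p (arr_scale C X Y k f) = arr_scale D W (FO F Y) k (pull D F p f)"
proof -
  have XY: "X \<in> Obj C" "Y \<in> Obj C" using C.Hom_Obj[OF assms(2)] by auto
  interpret H: group_hom "hom_group C X Y" "hom_group D W (FO F Y)" "pull D F p"
    by (rule pull_group_hom[OF C.preadditive_category_axioms D.preadditive_category_axioms
          additive assms(1) XY])
  show ?thesis using assms(2) H.hom_int_pow[of f k] by (simp add: arr_scale_def)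
qed

lemma mF_Hom: "mF n \<in> Hom D (VF \<odot>\<^bsub>D\<^esub> VF) VF"
  using D.Comp_Hom[OF JV FA_Hom[OF m_Hom]] .

text \<open>Naturality of \<open>J\<close> moves \<open>FA F a\<close> and \<open>FA F b\<close>
  across \<open>J V V\<close>, where they merge with \<open>FA F (m n)\<close> into the image of one
  arrow of \<open>C\<close>. Truncation, both vacuum axioms and one term of the translation axiom
  are instances.\<close>

lemma mF_tensor:
  assumes a: "a \<in> Hom C X V" and b: "b \<in> Hom C X' V"
    and \<alpha>: "\<alpha> \<in> Hom D W (FO F X)" and \<beta>: "\<beta> \<in> Hom D W' (FO F X')"
  shows "mF n \<bullet>\<^bsub>D\<^esub> ((FA F a \<bullet>\<^bsub>D\<^esub> \<alpha>) \<star>\<^bsub>D\<^esub> (FA F b \<bullet>\<^bsub>D\<^esub> \<beta>)) =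
    pull D F (J X X' \<bullet>\<^bsub>D\<^esub> (\<alpha> \<star>\<^bsub>D\<^esub> \<beta>)) (m n \<bullet>\<^bsub>C\<^esub> (a \<star>\<^bsub>C\<^esub> b))"
proof -
  have X: "X \<in> Obj C" "X' \<in> Obj C" using C.Hom_Obj a b by blast+
  note JX = J_Hom[OF X] and ab = C.TenA_Hom[OF a b] and \<alpha>\<beta> = D.TenA_Hom[OF \<alpha> \<beta>]
    and Fab = D.TenA_Hom[OF FA_Hom[OF a] FA_Hom[OF b]]
  have "mF n \<bullet>\<^bsub>D\<^esub> ((FA F a \<bullet>\<^bsub>D\<^esub> \<alpha>) \<star>\<^bsub>D\<^esub> (FA F b \<bullet>\<^bsub>D\<^esub> \<beta>)) =
      mF n \<bullet>\<^bsub>D\<^esub> ((FA F a \<star>\<^bsub>D\<^esub> FA F b) \<bullet>\<^bsub>D\<^esub> (\<alpha> \<star>\<^bsub>D\<^esub> \<beta>))"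
    using D.TenA_Comp[OF \<alpha> FA_Hom[OF a] \<beta> FA_Hom[OF b]] by simp
  also have "\<dots> = FA F (m n) \<bullet>\<^bsub>D\<^esub> (J V V \<bullet>\<^bsub>D\<^esub> (FA F a \<star>\<^bsub>D\<^esub> FA F b)) \<bullet>\<^bsub>D\<^esub> (\<alpha> \<star>\<^bsub>D\<^esub> \<beta>)"
    using JV FA_Hom[OF m_Hom] \<alpha>\<beta> Fab by (auto simp: Hom_def D.seq_simps)
  also have "\<dots> = FA F (m n) \<bullet>\<^bsub>D\<^esub> (FA F (a \<star>\<^bsub>C\<^esub> b) \<bullet>\<^bsub>D\<^esub> (J X X' \<bullet>\<^bsub>D\<^esub> (\<alpha> \<star>\<^bsub>D\<^esub> \<beta>)))"
    using J_natural[OF a b] D.Comp_assoc[OF \<alpha>\<beta> JX FA_Hom[OF ab]] by simp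
  also have "\<dots> = pull D F (J X X' \<bullet>\<^bsub>D\<^esub> (\<alpha> \<star>\<^bsub>D\<^esub> \<beta>)) (m n \<bullet>\<^bsub>C\<^esub> (a \<star>\<^bsub>C\<^esub> b))"
    using pull_comp[OF ab m_Hom D.Comp_Hom[OF \<alpha>\<beta> JX]] .
  finally show ?thesis .
qed

section \<open>Truncation, vacuum and translation\<close>

lemma truncation:
  assumes "compact_object U D X" "compact_object U D X'" "\<alpha> \<in> Hom D X VF" "\<beta> \<in> Hom D X' VF"
  shows "\<exists>K. \<forall>n\<ge>K. mF n \<bullet>\<^bsub>D\<^esub> (\<alpha> \<star>\<^bsub>D\<^esub> \<beta>) = Zero D (X \<odot>\<^bsub>D\<^esub> X') VF"
proof -
  obtain Z a \<alpha>' where Z: "compact_object U C Z" and a: "a \<in> Hom C Z V"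
    and \<alpha>': "\<alpha>' \<in> Hom D X (FO F Z)" "\<alpha> = FA F a \<bullet>\<^bsub>D\<^esub> \<alpha>'"
    using factor[OF assms(1,3)] by blast
  obtain Z' b \<beta>' where Z': "compact_object U C Z'" and b: "b \<in> Hom C Z' V"
    and \<beta>': "\<beta>' \<in> Hom D X' (FO F Z')" "\<beta> = FA F b \<bullet>\<^bsub>D\<^esub> \<beta>'"
    using factor[OF assms(2,4)] by blast
  \<comment> \<open>The bound for the arrows \<open>a\<close> and \<open>b\<close> of
    \<open>C\<close> serves for \<alpha> and \<beta>, since the factors \<open>\<alpha>'\<close> and
    \<open>\<beta>'\<close> do not involve \<open>n\<close> and zero is pulled to zero.\<close>
  obtain K where K: "\<And>n. n \<ge> K \<Longrightarrow> m n \<bullet>\<^bsub>C\<^esub> (a \<star>\<^bsub>C\<^esub> b) = Zero C (Z \<odot>\<^bsub>C\<^esub> Z') V"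
    using V.truncation[OF Z Z' a b] by blast
  have ZO: "Z \<in> Obj C" "Z' \<in> Obj C" using C.Hom_Obj a b by blast+
  have "mF n \<bullet>\<^bsub>D\<^esub> (\<alpha> \<star>\<^bsub>D\<^esub> \<beta>) = Zero D (X \<odot>\<^bsub>D\<^esub> X') VF" if "n \<ge> K" for n
    unfolding \<alpha>'(2) \<beta>'(2) mF_tensor[OF a b \<alpha>'(1) \<beta>'(1)] K[OF that]
    using pull_Zero[OF D.Comp_Hom[OF D.TenA_Hom[OF \<alpha>'(1) \<beta>'(1)] J_Hom[OF ZO]] C.TenO_Obj[OF ZO] V_Obj] .
  then show ?thesis by blast
qed

lemma e_comp: "vacF \<in> Hom D \<one>\<^sub>o\<^bsub>D\<^esub> VF"
  using D.Comp_Hom[OF e_Hom FA_Hom[OF vac_Hom]] .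

text \<open>Brings the identity into the shape required of a tensor factor in
  \<open>mF_tensor\<close>.\<close>

lemma idVF_factor: "Ident D VF = FA F (Ident C V) \<bullet>\<^bsub>D\<^esub> Ident D VF"
  using F_idV D.Ident_left[OF idVF] by simp

text \<open>With \<open>e\<close> and the identity as outer factors in \<open>mF_tensor\<close>, all
  coefficients become pulls of those for \<open>V\<close>. At \<open>k = 0\<close> the left unit law
  of the lax functor turns the pull of \<open>LUnit C V\<close> into
  \<open>LUnit D VF\<close>.\<close>

lemma vacuum_left:
  "vertex_series mF k \<bullet>\<^bsub>D\<^esub> (vacF \<star>\<^bsub>D\<^esub> Ident D VF) =
    (if k = 0 then LUnit D VF else Zero D (\<one>\<^sub>o\<^bsub>D\<^esub> \<odot>\<^bsub>D\<^esub> VF) VF)"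
proof -
  let ?p = "J \<one>\<^sub>o\<^bsub>C\<^esub> V \<bullet>\<^bsub>D\<^esub> (e \<star>\<^bsub>D\<^esub> Ident D VF)"
  have p: "?p \<in> Hom D (\<one>\<^sub>o\<^bsub>D\<^esub> \<odot>\<^bsub>D\<^esub> VF) (FO F (\<one>\<^sub>o\<^bsub>C\<^esub> \<odot>\<^bsub>C\<^esub> V))"
    using D.Comp_Hom[OF D.TenA_Hom[OF e_Hom idVF] J_Hom[OF C.Unit_Obj V_Obj]] .
  have "vertex_series mF k \<bullet>\<^bsub>D\<^esub> (vacF \<star>\<^bsub>D\<^esub> Ident D VF) =
      pull D F ?p (vertex_series m k \<bullet>\<^bsub>C\<^esub> (vac \<star>\<^bsub>C\<^esub> Ident C V))"
    using mF_tensor[OF vac_Hom idV e_Hom idVF] idVF_factor by (simp add: vertex_series_def)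
  then show ?thesis
    using V.vacuum_left[of k] J_lunit[OF V_Obj]
      pull_Zero[OF p C.TenO_Obj[OF C.Unit_Obj V_Obj] V_Obj] by (simp add: pull_def)
qed

lemma mF_vac_right:
  "vertex_series mF k \<bullet>\<^bsub>D\<^esub> (Ident D VF \<star>\<^bsub>D\<^esub> vacF) =
    pull D F (J V \<one>\<^sub>o\<^bsub>C\<^esub> \<bullet>\<^bsub>D\<^esub> (Ident D VF \<star>\<^bsub>D\<^esub> e)) (vertex_series m k \<bullet>\<^bsub>C\<^esub> (Ident C V \<star>\<^bsub>C\<^esub> vac))"
  using mF_tensor[OF idV vac_Hom idVF e_Hom] idVF_factor by (simp add: vertex_series_def)

lemma vacuum_right:
  assumes "k < 0"
  shows "vertex_series mF k \<bullet>\<^bsub>D\<^esub> (Ident D VF \<star>\<^bsub>D\<^esub> vacF) = Zero D (VF \<odot>\<^bsub>D\<^esub> \<one>\<^sub>o\<^bsub>D\<^esub>) VF"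
  unfolding mF_vac_right V.vacuum_right[OF assms]
  using pull_Zero[OF D.Comp_Hom[OF D.TenA_Hom[OF idVF e_Hom] J_Hom[OF V_Obj C.Unit_Obj]]
      C.TenO_Obj[OF V_Obj C.Unit_Obj] V_Obj] .

lemma vacuum_right_0: "vertex_series mF 0 \<bullet>\<^bsub>D\<^esub> (Ident D VF \<star>\<^bsub>D\<^esub> vacF) = RUnit D VF"
  unfolding mF_vac_right V.vacuum_right_0 using J_runit[OF V_Obj] by (simp add: pull_def)

lemma translation_vac: "FA F T \<bullet>\<^bsub>D\<^esub> vacF = Zero D \<one>\<^sub>o\<^bsub>D\<^esub> VF"
  using pull_comp[OF vac_Hom T_Hom e_Hom] V.translation_vac pull_Zero[OF e_Hom C.Unit_Obj V_Obj] by simp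

lemma translation:
  "arr_minus D (VF \<odot>\<^bsub>D\<^esub> VF) VF (FA F T \<bullet>\<^bsub>D\<^esub> vertex_series mF k)
      (vertex_series mF k \<bullet>\<^bsub>D\<^esub> (Ident D VF \<star>\<^bsub>D\<^esub> FA F T)) =
    formal_deriv D (VF \<odot>\<^bsub>D\<^esub> VF) VF (vertex_series mF) k"
proof -
  let ?Y = "vertex_series m"
  have Y: "?Y k \<in> Hom C (V \<odot>\<^bsub>C\<^esub> V) V" for k using m_Hom by (simp add: vertex_series_def)
  have YF: "vertex_series mF k = pull D F (J V V) (?Y k)" for k
    by (simp add: vertex_series_def pull_def)
  have 1: "FA F T \<bullet>\<^bsub>D\<^esub> vertex_series mF k = pull D F (J V V) (T \<bullet>\<^bsub>C\<^esub> ?Y k)"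
    using pull_comp[OF Y T_Hom JV] by (simp add: YF pull_def)
  have "vertex_series mF k \<bullet>\<^bsub>D\<^esub> (Ident D VF \<star>\<^bsub>D\<^esub> FA F T) =
      pull D F (J V V \<bullet>\<^bsub>D\<^esub> (Ident D VF \<star>\<^bsub>D\<^esub> Ident D VF)) (?Y k \<bullet>\<^bsub>C\<^esub> (Ident C V \<star>\<^bsub>C\<^esub> T))"
    using mF_tensor[OF idV T_Hom idVF idVF] idVF_factor D.Ident_right[OF FA_Hom[OF T_Hom]]
    by (simp add: vertex_series_def)
  \<comment> \<open>The identities used as outer factors are absorbed, so that both terms of the
    difference are pulled along the same arrow \<open>J V V\<close>.\<close>
  also have "J V V \<bullet>\<^bsub>D\<^esub> (Ident D VF \<star>\<^bsub>D\<^esub> Ident D VF) = J V V"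
    using D.TenA_Ident[OF VF_Obj VF_Obj] D.Ident_right[OF JV] by simp
  finally have 2: "vertex_series mF k \<bullet>\<^bsub>D\<^esub> (Ident D VF \<star>\<^bsub>D\<^esub> FA F T) =
      pull D F (J V V) (?Y k \<bullet>\<^bsub>C\<^esub> (Ident C V \<star>\<^bsub>C\<^esub> T))" .
  have "arr_minus D (VF \<odot>\<^bsub>D\<^esub> VF) VF (FA F T \<bullet>\<^bsub>D\<^esub> vertex_series mF k)
      (vertex_series mF k \<bullet>\<^bsub>D\<^esub> (Ident D VF \<star>\<^bsub>D\<^esub> FA F T)) =
      pull D F (J V V) (formal_deriv C (V \<odot>\<^bsub>C\<^esub> V) V ?Y k)"
    unfolding 1 2 V.translation[symmetric]
    using pull_arr_minus[OF JV C.Comp_Hom[OF Y T_Hom] C.Comp_Hom[OF C.TenA_Hom[OF idV T_Hom] Y]] by simp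
  also have "\<dots> = formal_deriv D (VF \<odot>\<^bsub>D\<^esub> VF) VF (vertex_series mF) k"
    using pull_arr_scale[OF JV Y] by (simp add: formal_deriv_def YF)
  finally show ?thesis .
qed

section \<open>Triple products and locality\<close>

definition J3 :: "'o \<Rightarrow> 'o \<Rightarrow> 'b" where
  "J3 X X' = J (X \<odot>\<^bsub>C\<^esub> X') V \<bullet>\<^bsub>D\<^esub> (J X X' \<star>\<^bsub>D\<^esub> Ident D VF)"

lemma J3_Hom:
  assumes "X \<in> Obj C" "X' \<in> Obj C"
  shows "J3 X X' \<in> Hom D ((FO F X \<odot>\<^bsub>D\<^esub> FO F X') \<odot>\<^bsub>D\<^esub> VF) (FO F ((X \<odot>\<^bsub>C\<^esub> X') \<odot>\<^bsub>C\<^esub> V))"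
  unfolding J3_def
  using D.Comp_Hom[OF D.TenA_Hom[OF J_Hom[OF assms] idVF] J_Hom[OF C.TenO_Obj[OF assms] V_Obj]] .

text \<open>\<open>J3\<close> is the ternary structure map of \<open>F\<close> in the left
  bracketing, which is the bracketing of the source in locality. Its naturality follows from that of
  \<open>J\<close> at the inner and then at the outer product; the third factor stays the identity
  of \<open>VF\<close>.\<close>

lemma J3_tensor:
  assumes a: "a \<in> Hom C X V" and b: "b \<in> Hom C X' V"
    and \<alpha>: "\<alpha> \<in> Hom D W (FO F X)" and \<beta>: "\<beta> \<in> Hom D W' (FO F X')"
  shows "J3 V V \<bullet>\<^bsub>D\<^esub> (((FA F a \<bullet>\<^bsub>D\<^esub> \<alpha>) \<star>\<^bsub>D\<^esub> (FA F b \<bullet>\<^bsub>D\<^esub> \<beta>)) \<star>\<^bsub>D\<^esub> Ident D VF) =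
    FA F ((a \<star>\<^bsub>C\<^esub> b) \<star>\<^bsub>C\<^esub> Ident C V) \<bullet>\<^bsub>D\<^esub> (J3 X X' \<bullet>\<^bsub>D\<^esub> ((\<alpha> \<star>\<^bsub>D\<^esub> \<beta>) \<star>\<^bsub>D\<^esub> Ident D VF))"
proof -
  have X: "X \<in> Obj C" "X' \<in> Obj C" using C.Hom_Obj a b by blast+
  note JX = J_Hom[OF X] and ab = C.TenA_Hom[OF a b] and \<alpha>\<beta> = D.TenA_Hom[OF \<alpha> \<beta>]
    and Fa = FA_Hom[OF a] and Fb = FA_Hom[OF b]
  note Fab = D.TenA_Hom[OF Fa Fb] and id2 = D.Ident_left[OF idVF]
  note J1 = J_Hom[OF VV_Obj V_Obj] and J2 = J_Hom[OF C.TenO_Obj[OF X] V_Obj]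
  let ?\<gamma> = "(FA F a \<bullet>\<^bsub>D\<^esub> \<alpha>) \<star>\<^bsub>D\<^esub> (FA F b \<bullet>\<^bsub>D\<^esub> \<beta>)"
  have \<gamma>: "?\<gamma> \<in> Hom D (W \<odot>\<^bsub>D\<^esub> W') (VF \<odot>\<^bsub>D\<^esub> VF)"
    using D.TenA_Hom[OF D.Comp_Hom[OF \<alpha> Fa] D.Comp_Hom[OF \<beta> Fb]] .
  have J\<gamma>: "J V V \<bullet>\<^bsub>D\<^esub> ?\<gamma> = FA F (a \<star>\<^bsub>C\<^esub> b) \<bullet>\<^bsub>D\<^esub> (J X X' \<bullet>\<^bsub>D\<^esub> (\<alpha> \<star>\<^bsub>D\<^esub> \<beta>))"
    using D.TenA_Comp[OF \<alpha> Fa \<beta> Fb] D.Comp_assoc[OF \<alpha>\<beta> Fab JV] J_natural[OF a b]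
      D.Comp_assoc[OF \<alpha>\<beta> JX FA_Hom[OF ab]] by simp
  have "J3 V V \<bullet>\<^bsub>D\<^esub> (?\<gamma> \<star>\<^bsub>D\<^esub> Ident D VF) =
      J (V \<odot>\<^bsub>C\<^esub> V) V \<bullet>\<^bsub>D\<^esub> ((J V V \<star>\<^bsub>D\<^esub> Ident D VF) \<bullet>\<^bsub>D\<^esub> (?\<gamma> \<star>\<^bsub>D\<^esub> Ident D VF))"
    unfolding J3_def using D.Comp_assoc[OF D.TenA_Hom[OF \<gamma> idVF] D.TenA_Hom[OF JV idVF] J1] by simp
  also have "\<dots> = J (V \<odot>\<^bsub>C\<^esub> V) V \<bullet>\<^bsub>D\<^esub> ((FA F (a \<star>\<^bsub>C\<^esub> b) \<bullet>\<^bsub>D\<^esub> (J X X' \<bullet>\<^bsub>D\<^esub> (\<alpha> \<star>\<^bsub>D\<^esub> \<beta>))) \<star>\<^bsub>D\<^esub> Ident D VF)"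
    using D.TenA_Comp[OF \<gamma> JV idVF idVF] id2 J\<gamma> by simp
  also have "\<dots> = J (V \<odot>\<^bsub>C\<^esub> V) V \<bullet>\<^bsub>D\<^esub> ((FA F (a \<star>\<^bsub>C\<^esub> b) \<star>\<^bsub>D\<^esub> FA F (Ident C V)) \<bullet>\<^bsub>D\<^esub>
      ((J X X' \<bullet>\<^bsub>D\<^esub> (\<alpha> \<star>\<^bsub>D\<^esub> \<beta>)) \<star>\<^bsub>D\<^esub> Ident D VF))"
    using D.TenA_Comp[OF D.Comp_Hom[OF \<alpha>\<beta> JX] FA_Hom[OF ab] idVF idVF] id2 F_idV by simp
  also have "\<dots> = (J (V \<odot>\<^bsub>C\<^esub> V) V \<bullet>\<^bsub>D\<^esub> (FA F (a \<star>\<^bsub>C\<^esub> b) \<star>\<^bsub>D\<^esub> FA F (Ident C V))) \<bullet>\<^bsub>D\<^esub>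
      ((J X X' \<bullet>\<^bsub>D\<^esub> (\<alpha> \<star>\<^bsub>D\<^esub> \<beta>)) \<star>\<^bsub>D\<^esub> Ident D VF)"
    using D.Comp_assoc[OF D.TenA_Hom[OF D.Comp_Hom[OF \<alpha>\<beta> JX] idVF]
        D.TenA_Hom[OF FA_Hom[OF ab] FA_Hom[OF idV]] J1] by simp
  also have "\<dots> = (FA F ((a \<star>\<^bsub>C\<^esub> b) \<star>\<^bsub>C\<^esub> Ident C V) \<bullet>\<^bsub>D\<^esub> J (X \<odot>\<^bsub>C\<^esub> X') V) \<bullet>\<^bsub>D\<^esub>
      ((J X X' \<star>\<^bsub>D\<^esub> Ident D VF) \<bullet>\<^bsub>D\<^esub> ((\<alpha> \<star>\<^bsub>D\<^esub> \<beta>) \<star>\<^bsub>D\<^esub> Ident D VF))"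
    using J_natural[OF ab idV] D.TenA_Comp[OF \<alpha>\<beta> JX idVF idVF] id2 by simp
  also have "\<dots> = FA F ((a \<star>\<^bsub>C\<^esub> b) \<star>\<^bsub>C\<^esub> Ident C V) \<bullet>\<^bsub>D\<^esub> (J3 X X' \<bullet>\<^bsub>D\<^esub> ((\<alpha> \<star>\<^bsub>D\<^esub> \<beta>) \<star>\<^bsub>D\<^esub> Ident D VF))"
    unfolding J3_def
    using D.TenA_Hom[OF JX idVF] D.TenA_Hom[OF \<alpha>\<beta> idVF] J2 FA_Hom[OF C.TenA_Hom[OF ab idV]]
    by (auto simp: Hom_def D.seq_simps)
  finally show ?thesis .
qed

text \<open>Naturality of \<open>J\<close> brings \<open>z\<close> inside \<open>F\<close>; the
  associativity law then exchanges the associator of \<open>D\<close> for the image of that of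
  \<open>C\<close>, and the right bracketing for the left one of \<open>J3\<close>.\<close>

lemma iterated_product:
  assumes y: "y \<in> Hom C (V \<odot>\<^bsub>C\<^esub> V) V" and z: "z \<in> Hom C (V \<odot>\<^bsub>C\<^esub> V) V"
  shows "(FA F y \<bullet>\<^bsub>D\<^esub> J V V) \<bullet>\<^bsub>D\<^esub> (Ident D VF \<star>\<^bsub>D\<^esub> (FA F z \<bullet>\<^bsub>D\<^esub> J V V)) \<bullet>\<^bsub>D\<^esub> Assoc D VF VF VF =
    FA F (y \<bullet>\<^bsub>C\<^esub> (Ident C V \<star>\<^bsub>C\<^esub> z) \<bullet>\<^bsub>C\<^esub> Assoc C V V V) \<bullet>\<^bsub>D\<^esub> J3 V V"
proof -
  note Fy = FA_Hom[OF y] and Fz = FA_Hom[OF z] and id2 = D.Ident_left[OF idVF]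
  have as: "Assoc D VF VF VF \<in> Hom D ((VF \<odot>\<^bsub>D\<^esub> VF) \<odot>\<^bsub>D\<^esub> VF) (VF \<odot>\<^bsub>D\<^esub> (VF \<odot>\<^bsub>D\<^esub> VF))"
    using D.Assoc_Hom[OF VF_Obj VF_Obj VF_Obj] by simp
  have asC: "Assoc C V V V \<in> Hom C ((V \<odot>\<^bsub>C\<^esub> V) \<odot>\<^bsub>C\<^esub> V) (V \<odot>\<^bsub>C\<^esub> (V \<odot>\<^bsub>C\<^esub> V))"
    using C.Assoc_Hom[OF V_Obj V_Obj V_Obj] by simp
  note J1 = J_Hom[OF V_Obj VV_Obj] and idJ = D.TenA_Hom[OF idVF JV] and idFz = D.TenA_Hom[OF idVF Fz]
    and idz = C.TenA_Hom[OF idV z]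
  note Fidz = FA_Hom[OF idz] and Fas = FA_Hom[OF asC]
  have "(FA F y \<bullet>\<^bsub>D\<^esub> J V V) \<bullet>\<^bsub>D\<^esub> (Ident D VF \<star>\<^bsub>D\<^esub> (FA F z \<bullet>\<^bsub>D\<^esub> J V V)) \<bullet>\<^bsub>D\<^esub> Assoc D VF VF VF =
      (FA F y \<bullet>\<^bsub>D\<^esub> J V V) \<bullet>\<^bsub>D\<^esub> ((Ident D VF \<star>\<^bsub>D\<^esub> FA F z) \<bullet>\<^bsub>D\<^esub> (Ident D VF \<star>\<^bsub>D\<^esub> J V V)) \<bullet>\<^bsub>D\<^esub> Assoc D VF VF VF"
    using D.TenA_Comp[OF idVF idVF JV Fz] id2 by simp
  also have "\<dots> = FA F y \<bullet>\<^bsub>D\<^esub> (J V V \<bullet>\<^bsub>D\<^esub> (FA F (Ident C V) \<star>\<^bsub>D\<^esub> FA F z)) \<bullet>\<^bsub>D\<^esub>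
      (Ident D VF \<star>\<^bsub>D\<^esub> J V V) \<bullet>\<^bsub>D\<^esub> Assoc D VF VF VF"
    unfolding F_idV using Fy JV idFz idJ as by (auto simp: Hom_def D.seq_simps)
  also have "\<dots> = FA F y \<bullet>\<^bsub>D\<^esub> (FA F (Ident C V \<star>\<^bsub>C\<^esub> z) \<bullet>\<^bsub>D\<^esub> J V (V \<odot>\<^bsub>C\<^esub> V)) \<bullet>\<^bsub>D\<^esub>
      (Ident D VF \<star>\<^bsub>D\<^esub> J V V) \<bullet>\<^bsub>D\<^esub> Assoc D VF VF VF"
    using J_natural[OF idV z] by simp
  also have "\<dots> = (FA F y \<bullet>\<^bsub>D\<^esub> FA F (Ident C V \<star>\<^bsub>C\<^esub> z)) \<bullet>\<^bsub>D\<^esub>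
      (J V (V \<odot>\<^bsub>C\<^esub> V) \<bullet>\<^bsub>D\<^esub> (Ident D VF \<star>\<^bsub>D\<^esub> J V V) \<bullet>\<^bsub>D\<^esub> Assoc D VF VF VF)"
    using Fy Fidz J1 idJ as by (auto simp: Hom_def D.seq_simps)
  also have "\<dots> = (FA F y \<bullet>\<^bsub>D\<^esub> FA F (Ident C V \<star>\<^bsub>C\<^esub> z)) \<bullet>\<^bsub>D\<^esub> (FA F (Assoc C V V V) \<bullet>\<^bsub>D\<^esub> J3 V V)"
    using J_assoc[OF V_Obj V_Obj V_Obj] by (simp add: J3_def)
  also have "\<dots> = (FA F y \<bullet>\<^bsub>D\<^esub> FA F (Ident C V \<star>\<^bsub>C\<^esub> z) \<bullet>\<^bsub>D\<^esub> FA F (Assoc C V V V)) \<bullet>\<^bsub>D\<^esub> J3 V V"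
    using Fy Fidz Fas J3_Hom[OF V_Obj V_Obj] by (auto simp: Hom_def D.seq_simps)
  also have "FA F y \<bullet>\<^bsub>D\<^esub> FA F (Ident C V \<star>\<^bsub>C\<^esub> z) \<bullet>\<^bsub>D\<^esub> FA F (Assoc C V V V) =
      FA F (y \<bullet>\<^bsub>C\<^esub> (Ident C V \<star>\<^bsub>C\<^esub> z) \<bullet>\<^bsub>C\<^esub> Assoc C V V V)"
    using FA_Comp[OF asC idz] FA_Comp[OF C.Comp_Hom[OF asC idz] y] by simp
  finally show ?thesis .
qed

text \<open>The symmetry of the lax functor, tensored with the identity of \<open>VF\<close> and
  followed by naturality of the outer \<open>J\<close>.\<close>

lemma J3_braid:
  "J3 V V \<bullet>\<^bsub>D\<^esub> (Braid D VF VF \<star>\<^bsub>D\<^esub> Ident D VF) =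
    FA F (Braid C V V \<star>\<^bsub>C\<^esub> Ident C V) \<bullet>\<^bsub>D\<^esub> J3 V V"
proof -
  note id2 = D.Ident_left[OF idVF] and J1 = J_Hom[OF VV_Obj V_Obj]
    and br = D.Braid_Hom[OF VF_Obj VF_Obj] and brC = C.Braid_Hom[OF V_Obj V_Obj]
  have "J3 V V \<bullet>\<^bsub>D\<^esub> (Braid D VF VF \<star>\<^bsub>D\<^esub> Ident D VF) =
      J (V \<odot>\<^bsub>C\<^esub> V) V \<bullet>\<^bsub>D\<^esub> ((J V V \<bullet>\<^bsub>D\<^esub> Braid D VF VF) \<star>\<^bsub>D\<^esub> Ident D VF)"
    unfolding J3_def
    using D.Comp_assoc[OF D.TenA_Hom[OF br idVF] D.TenA_Hom[OF JV idVF] J1]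
      D.TenA_Comp[OF br JV idVF idVF] id2 by simp
  also have "\<dots> = J (V \<odot>\<^bsub>C\<^esub> V) V \<bullet>\<^bsub>D\<^esub> ((FA F (Braid C V V) \<star>\<^bsub>D\<^esub> FA F (Ident C V)) \<bullet>\<^bsub>D\<^esub> (J V V \<star>\<^bsub>D\<^esub> Ident D VF))"
    using J_braid[OF V_Obj V_Obj] D.TenA_Comp[OF JV FA_Hom[OF brC] idVF idVF] id2 F_idV by simp
  also have "\<dots> = (J (V \<odot>\<^bsub>C\<^esub> V) V \<bullet>\<^bsub>D\<^esub> (FA F (Braid C V V) \<star>\<^bsub>D\<^esub> FA F (Ident C V))) \<bullet>\<^bsub>D\<^esub> (J V V \<star>\<^bsub>D\<^esub> Ident D VF)"
    using D.Comp_assoc[OF D.TenA_Hom[OF JV idVF] D.TenA_Hom[OF FA_Hom[OF brC] FA_Hom[OF idV]] J1] by simp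
  also have "\<dots> = FA F (Braid C V V \<star>\<^bsub>C\<^esub> Ident C V) \<bullet>\<^bsub>D\<^esub> J3 V V"
    unfolding J3_def
    using J_natural[OF brC idV]
      D.Comp_assoc[OF D.TenA_Hom[OF JV idVF] J1 FA_Hom[OF C.TenA_Hom[OF brC idV]]] by simp
  finally show ?thesis .
qed

text \<open>Both terms of the commutator turn out to be pulls along one and the same arrow
  \<open>?p\<close>, so their difference is the pull of the difference.\<close>

lemma locality_commutator_pull:
  assumes a: "a \<in> Hom C X V" and b: "b \<in> Hom C X' V"
    and \<alpha>: "\<alpha> \<in> Hom D W (FO F X)" and \<beta>: "\<beta> \<in> Hom D W' (FO F X')"
  shows "locality_commutator D VF mF W W' (FA F a \<bullet>\<^bsub>D\<^esub> \<alpha>) (FA F b \<bullet>\<^bsub>D\<^esub> \<beta>) i j =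
      pull D F (J3 X X' \<bullet>\<^bsub>D\<^esub> ((\<alpha> \<star>\<^bsub>D\<^esub> \<beta>) \<star>\<^bsub>D\<^esub> Ident D VF)) (locality_commutator C V m X X' a b i j)"
    and "locality_commutator C V m X X' a b i j \<in> Hom C ((X \<odot>\<^bsub>C\<^esub> X') \<odot>\<^bsub>C\<^esub> V) V"
proof -
  have X: "X \<in> Obj C" "X' \<in> Obj C" using C.Hom_Obj a b by blast+
  let ?Y = "vertex_series m" and ?p = "J3 X X' \<bullet>\<^bsub>D\<^esub> ((\<alpha> \<star>\<^bsub>D\<^esub> \<beta>) \<star>\<^bsub>D\<^esub> Ident D VF)"
  let ?c = "(a \<star>\<^bsub>C\<^esub> b) \<star>\<^bsub>C\<^esub> Ident C V" and ?\<gamma> = "((FA F a \<bullet>\<^bsub>D\<^esub> \<alpha>) \<star>\<^bsub>D\<^esub> (FA F b \<bullet>\<^bsub>D\<^esub> \<beta>)) \<star>\<^bsub>D\<^esub> Ident D VF"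
  \<comment> \<open>The iterated product with coefficient \<open>i\<close> inside and
    \<open>j\<close> outside. The second term of the commutator is \<open>?R j i\<close> preceded by
    the braiding.\<close>
  let ?R = "\<lambda>i j. ?Y j \<bullet>\<^bsub>C\<^esub> (Ident C V \<star>\<^bsub>C\<^esub> ?Y i) \<bullet>\<^bsub>C\<^esub> Assoc C V V V"
  let ?s = "Braid C V V \<star>\<^bsub>C\<^esub> Ident C V" and ?\<sigma> = "Braid D VF VF \<star>\<^bsub>D\<^esub> Ident D VF"
  have Y: "?Y k \<in> Hom C (V \<odot>\<^bsub>C\<^esub> V) V" for k using m_Hom by (simp add: vertex_series_def)
  have YF: "vertex_series mF k = FA F (?Y k) \<bullet>\<^bsub>D\<^esub> J V V" for k by (simp add: vertex_series_def)
  have YF_Hom: "vertex_series mF k \<in> Hom D (VF \<odot>\<^bsub>D\<^esub> VF) VF" for k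
    using mF_Hom by (simp add: vertex_series_def)
  have p: "?p \<in> Hom D ((W \<odot>\<^bsub>D\<^esub> W') \<odot>\<^bsub>D\<^esub> VF) (FO F ((X \<odot>\<^bsub>C\<^esub> X') \<odot>\<^bsub>C\<^esub> V))"
    using D.Comp_Hom[OF D.TenA_Hom[OF D.TenA_Hom[OF \<alpha> \<beta>] idVF] J3_Hom[OF X]] .
  have \<gamma>: "?\<gamma> \<in> Hom D ((W \<odot>\<^bsub>D\<^esub> W') \<odot>\<^bsub>D\<^esub> VF) ((VF \<odot>\<^bsub>D\<^esub> VF) \<odot>\<^bsub>D\<^esub> VF)"
    using D.TenA_Hom[OF D.TenA_Hom[OF D.Comp_Hom[OF \<alpha> FA_Hom[OF a]] D.Comp_Hom[OF \<beta> FA_Hom[OF b]]] idVF] .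
  have c: "?c \<in> Hom C ((X \<odot>\<^bsub>C\<^esub> X') \<odot>\<^bsub>C\<^esub> V) ((V \<odot>\<^bsub>C\<^esub> V) \<odot>\<^bsub>C\<^esub> V)"
    using C.TenA_Hom[OF C.TenA_Hom[OF a b] idV] .
  have as: "Assoc D VF VF VF \<in> Hom D ((VF \<odot>\<^bsub>D\<^esub> VF) \<odot>\<^bsub>D\<^esub> VF) (VF \<odot>\<^bsub>D\<^esub> (VF \<odot>\<^bsub>D\<^esub> VF))"
    using D.Assoc_Hom[OF VF_Obj VF_Obj VF_Obj] by simp
  have asC: "Assoc C V V V \<in> Hom C ((V \<odot>\<^bsub>C\<^esub> V) \<odot>\<^bsub>C\<^esub> V) (V \<odot>\<^bsub>C\<^esub> (V \<odot>\<^bsub>C\<^esub> V))"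
    using C.Assoc_Hom[OF V_Obj V_Obj V_Obj] by simp
  have idYF: "Ident D VF \<star>\<^bsub>D\<^esub> vertex_series mF k \<in> Hom D (VF \<odot>\<^bsub>D\<^esub> (VF \<odot>\<^bsub>D\<^esub> VF)) (VF \<odot>\<^bsub>D\<^esub> VF)" for k
    using D.TenA_Hom[OF idVF YF_Hom] .
  have idY: "Ident C V \<star>\<^bsub>C\<^esub> ?Y k \<in> Hom C (V \<odot>\<^bsub>C\<^esub> (V \<odot>\<^bsub>C\<^esub> V)) (V \<odot>\<^bsub>C\<^esub> V)" for k
    using C.TenA_Hom[OF idV Y] .
  have s: "?s \<in> Hom C ((V \<odot>\<^bsub>C\<^esub> V) \<odot>\<^bsub>C\<^esub> V) ((V \<odot>\<^bsub>C\<^esub> V) \<odot>\<^bsub>C\<^esub> V)"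
    using C.TenA_Hom[OF C.Braid_Hom[OF V_Obj V_Obj] idV] .
  have \<sigma>: "?\<sigma> \<in> Hom D ((VF \<odot>\<^bsub>D\<^esub> VF) \<odot>\<^bsub>D\<^esub> VF) ((VF \<odot>\<^bsub>D\<^esub> VF) \<odot>\<^bsub>D\<^esub> VF)"
    using D.TenA_Hom[OF D.Braid_Hom[OF VF_Obj VF_Obj] idVF] .
  have R: "?R i j \<in> Hom C ((V \<odot>\<^bsub>C\<^esub> V) \<odot>\<^bsub>C\<^esub> V) V" for i j
    using C.Comp_Hom[OF C.Comp_Hom[OF asC idY] Y] .
  note J3V = J3_Hom[OF V_Obj V_Obj]
  note J\<gamma> = J3_tensor[OF a b \<alpha> \<beta>]
  have RF: "vertex_series mF j \<bullet>\<^bsub>D\<^esub> (Ident D VF \<star>\<^bsub>D\<^esub> vertex_series mF i) \<bullet>\<^bsub>D\<^esub> Assoc D VF VF VF =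
      FA F (?R i j) \<bullet>\<^bsub>D\<^esub> J3 V V" for i j
    using iterated_product[OF Y Y] by (simp add: YF)
  have 1: "vertex_series mF j \<bullet>\<^bsub>D\<^esub> (Ident D VF \<star>\<^bsub>D\<^esub> vertex_series mF i) \<bullet>\<^bsub>D\<^esub> Assoc D VF VF VF \<bullet>\<^bsub>D\<^esub> g =
      FA F (?R i j) \<bullet>\<^bsub>D\<^esub> (J3 V V \<bullet>\<^bsub>D\<^esub> g)" if g: "g \<in> Hom D Z ((VF \<odot>\<^bsub>D\<^esub> VF) \<odot>\<^bsub>D\<^esub> VF)" for g Z i j
  proof -
    have "vertex_series mF j \<bullet>\<^bsub>D\<^esub> (Ident D VF \<star>\<^bsub>D\<^esub> vertex_series mF i) \<bullet>\<^bsub>D\<^esub> Assoc D VF VF VF \<bullet>\<^bsub>D\<^esub> g =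
        (vertex_series mF j \<bullet>\<^bsub>D\<^esub> (Ident D VF \<star>\<^bsub>D\<^esub> vertex_series mF i) \<bullet>\<^bsub>D\<^esub> Assoc D VF VF VF) \<bullet>\<^bsub>D\<^esub> g"
      using YF_Hom[of j] idYF[of i] as g by (auto simp: Hom_def D.seq_simps)
    also have "\<dots> = FA F (?R i j) \<bullet>\<^bsub>D\<^esub> (J3 V V \<bullet>\<^bsub>D\<^esub> g)"
      unfolding RF using D.Comp_assoc[OF g J3V FA_Hom[OF R]] by simp
    finally show ?thesis .
  qed
  have RC: "?Y j \<bullet>\<^bsub>C\<^esub> (Ident C V \<star>\<^bsub>C\<^esub> ?Y i) \<bullet>\<^bsub>C\<^esub> Assoc C V V V \<bullet>\<^bsub>C\<^esub> g = ?R i j \<bullet>\<^bsub>C\<^esub> g"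
    if "g \<in> Hom C Z ((V \<odot>\<^bsub>C\<^esub> V) \<odot>\<^bsub>C\<^esub> V)" for g Z i j
    using Y[of j] idY[of i] asC that by (auto simp: Hom_def C.seq_simps)
  have 2: "FA F (?R i j) \<bullet>\<^bsub>D\<^esub> (J3 V V \<bullet>\<^bsub>D\<^esub> ?\<gamma>) = pull D F ?p (?R i j \<bullet>\<^bsub>C\<^esub> ?c)"
    unfolding J\<gamma> using pull_comp[OF c R p] .
  \<comment> \<open>The braiding acts on \<open>VF\<close> after \<alpha> and \<beta> have been
    applied, so it is brought inside \<open>F\<close> first and \<open>?\<gamma>\<close> afterwards;
    the outer arrow stays \<open>?p\<close>, as in the unbraided term.\<close>
  have "J3 V V \<bullet>\<^bsub>D\<^esub> (?\<sigma> \<bullet>\<^bsub>D\<^esub> ?\<gamma>) = FA F ?s \<bullet>\<^bsub>D\<^esub> (J3 V V \<bullet>\<^bsub>D\<^esub> ?\<gamma>)"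
    using D.Comp_assoc[OF \<gamma> \<sigma> J3V] D.Comp_assoc[OF \<gamma> J3V FA_Hom[OF s]] J3_braid by simp
  also have "\<dots> = FA F (?s \<bullet>\<^bsub>C\<^esub> ?c) \<bullet>\<^bsub>D\<^esub> ?p"
    unfolding J\<gamma> using pull_comp[OF c s p] by (simp add: pull_def)
  finally have 3: "FA F (?R j i) \<bullet>\<^bsub>D\<^esub> (J3 V V \<bullet>\<^bsub>D\<^esub> (?\<sigma> \<bullet>\<^bsub>D\<^esub> ?\<gamma>)) = pull D F ?p (?R j i \<bullet>\<^bsub>C\<^esub> (?s \<bullet>\<^bsub>C\<^esub> ?c))"
    using pull_comp[OF C.Comp_Hom[OF c s] R p] by simp
  have lcC: "locality_commutator C V m X X' a b i j =
      arr_minus C ((X \<odot>\<^bsub>C\<^esub> X') \<odot>\<^bsub>C\<^esub> V) V (?R i j \<bullet>\<^bsub>C\<^esub> ?c) (?R j i \<bullet>\<^bsub>C\<^esub> (?s \<bullet>\<^bsub>C\<^esub> ?c))"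
    unfolding locality_commutator_def Let_def RC[OF c] RC[OF C.Comp_Hom[OF c s]] ..
  have Rc: "?R i j \<bullet>\<^bsub>C\<^esub> ?c \<in> Hom C ((X \<odot>\<^bsub>C\<^esub> X') \<odot>\<^bsub>C\<^esub> V) V"
    "?R j i \<bullet>\<^bsub>C\<^esub> (?s \<bullet>\<^bsub>C\<^esub> ?c) \<in> Hom C ((X \<odot>\<^bsub>C\<^esub> X') \<odot>\<^bsub>C\<^esub> V) V"
    using C.Comp_Hom[OF c R] C.Comp_Hom[OF C.Comp_Hom[OF c s] R] by auto
  show "locality_commutator C V m X X' a b i j \<in> Hom C ((X \<odot>\<^bsub>C\<^esub> X') \<odot>\<^bsub>C\<^esub> V) V"
    unfolding lcC using C.arr_minus_Hom[OF Rc] .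
  show "locality_commutator D VF mF W W' (FA F a \<bullet>\<^bsub>D\<^esub> \<alpha>) (FA F b \<bullet>\<^bsub>D\<^esub> \<beta>) i j =
      pull D F ?p (locality_commutator C V m X X' a b i j)"
    unfolding lcC pull_arr_minus[OF p Rc]
    unfolding locality_commutator_def Let_def 1[OF \<gamma>] 1[OF D.Comp_Hom[OF \<gamma> \<sigma>]] 2 3 ..
qed

text \<open>As the whole commutator is a pull and multiplication by \<open>z - w\<close> commutes
  with pulling, the exponent for \<open>a\<close> and \<open>b\<close> also serves here.\<close>

lemma locality:
  assumes "compact_object U D X" "compact_object U D X'" "\<alpha> \<in> Hom D X VF" "\<beta> \<in> Hom D X' VF"
  shows "\<exists>K. \<forall>i j. (mult_z_minus_w D ((X \<odot>\<^bsub>D\<^esub> X') \<odot>\<^bsub>D\<^esub> VF) VF ^^ K)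
      (locality_commutator D VF mF X X' \<alpha> \<beta>) i j = Zero D ((X \<odot>\<^bsub>D\<^esub> X') \<odot>\<^bsub>D\<^esub> VF) VF"
proof -
  obtain Z a \<alpha>' where Z: "compact_object U C Z" and a: "a \<in> Hom C Z V"
    and \<alpha>': "\<alpha>' \<in> Hom D X (FO F Z)" "\<alpha> = FA F a \<bullet>\<^bsub>D\<^esub> \<alpha>'"
    using factor[OF assms(1,3)] by blast
  obtain Z' b \<beta>' where Z': "compact_object U C Z'" and b: "b \<in> Hom C Z' V"
    and \<beta>': "\<beta>' \<in> Hom D X' (FO F Z')" "\<beta> = FA F b \<bullet>\<^bsub>D\<^esub> \<beta>'"
    using factor[OF assms(2,4)] by blast
  have ZO: "Z \<in> Obj C" "Z' \<in> Obj C" using C.Hom_Obj a b by blast+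
  let ?A = "(Z \<odot>\<^bsub>C\<^esub> Z') \<odot>\<^bsub>C\<^esub> V" and ?B = "(X \<odot>\<^bsub>D\<^esub> X') \<odot>\<^bsub>D\<^esub> VF"
  let ?p = "J3 Z Z' \<bullet>\<^bsub>D\<^esub> ((\<alpha>' \<star>\<^bsub>D\<^esub> \<beta>') \<star>\<^bsub>D\<^esub> Ident D VF)"
  have p: "?p \<in> Hom D ?B (FO F ?A)"
    using D.Comp_Hom[OF D.TenA_Hom[OF D.TenA_Hom[OF \<alpha>'(1) \<beta>'(1)] idVF] J3_Hom[OF ZO]] .
  have A: "?A \<in> Obj C" using C.TenO_Obj[OF C.TenO_Obj[OF ZO] V_Obj] .
  note lc = locality_commutator_pull[OF a b \<alpha>'(1) \<beta>'(1)]
  obtain K where K: "\<And>i j. (mult_z_minus_w C ?A V ^^ K) (locality_commutator C V m Z Z' a b) i j = Zero C ?A V"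
    using V.locality[OF Z Z' a b] by blast
  have "locality_commutator D VF mF X X' \<alpha> \<beta> =
      (\<lambda>i j. pull D F ?p (locality_commutator C V m Z Z' a b i j))"
    unfolding \<alpha>'(2) \<beta>'(2) using lc(1) by (intro ext)
  then have "(mult_z_minus_w D ?B VF ^^ K) (locality_commutator D VF mF X X' \<alpha> \<beta>) =
      (\<lambda>i j. pull D F ?p (Zero C ?A V))"
    using mult_z_minus_w_pull[OF C.preadditive_category_axioms D.preadditive_category_axioms additive
        p A V_Obj lc(2), of K] K by simp
  then have "(mult_z_minus_w D ?B VF ^^ K) (locality_commutator D VF mF X X' \<alpha> \<beta>) i j = Zero D ?B VF" for i j
    using pull_Zero[OF p A V_Obj] by simp
  then show ?thesis by blast
qed

lemma vertex_algebra_image: "vertex_algebra U D VF vacF (FA F T) mF"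
  by unfold_locales
    (fact VF_Obj e_comp FA_Hom[OF T_Hom] mF_Hom truncation vacuum_left vacuum_right vacuum_right_0
      translation_vac translation locality)+

end

theorem proposition3p5:
  fixes C :: "('o, 'a) mon_cat" and C0 :: "('u, 'u) mon_cat"
    and D :: "('p, 'b) mon_cat" and D0 :: "('u, 'u) mon_cat"
    and F :: "('o, 'a, 'p, 'b) func" and J :: "'o \<Rightarrow> 'o \<Rightarrow> 'b" and e :: 'b
    and V :: 'o and vac :: 'a and T :: 'a and m :: "int \<Rightarrow> 'a"
  assumes "universe TYPE('u)"
    and "standing_assumptions C C0"
    and "standing_assumptions D D0"
    and "lax_symmetric_monoidal_functor C D F J e"
    and "additive_functor C D F"
    and "preserves_filtered_colimits TYPE('u) C D F"
    and "vertex_algebra TYPE('u) C V vac T m"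
  shows "vertex_algebra TYPE('u) D (FO F V) (FA F vac \<bullet>\<^bsub>D\<^esub> e) (FA F T)
           (\<lambda>n. FA F (m n) \<bullet>\<^bsub>D\<^esub> J V V)"
proof -
  interpret F: lax_symmetric_monoidal_functor C D F J e by fact
  interpret V: vertex_algebra "TYPE('u)" C V vac T m by fact
  obtain E where E: "equivalence_functor (ind_cat C0) C E"
    using assms(2) by (auto simp: standing_assumptions_def)
  interpret C0: small_presheaves C0
    using assms(1,2)
    by (simp add: standing_assumptions_def small_cat_def small_presheaves_def presheaves_def
        small_presheaves_axioms_def)
  obtain I :: "('u, 'u) cat" and G \<mu> where I: "small_cat I" "filtered I" and V: "is_colimit I C G V \<mu>"
    and G: "\<And>i. i \<in> Obj I \<Longrightarrow> compact_object TYPE('u) C (FO G i)"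
    using C0.colimit_of_compact_objects[OF E V.V_Obj] by metis
  have FV: "is_colimit I D (comp_func F G) (FO F V) (\<lambda>i. FA F (\<mu> i))"
    using assms(6) I V by (simp add: preserves_filtered_colimits_def)
  \<comment> \<open>Compactness of \<open>X\<close> in \<open>D\<close> is applied to the image
    under \<open>F\<close> of the presentation of \<open>V\<close>. The stage \<open>i\<close> so
    obtained provides \<open>X' = FO G i\<close> and \<open>a = \<mu> i\<close>.\<close>
  have "\<exists>X'. compact_object TYPE('u) C X' \<and>
      (\<exists>a\<in>Hom C X' V. \<exists>\<alpha>'\<in>Hom D X (FO F X'). \<alpha> = FA F a \<bullet>\<^bsub>D\<^esub> \<alpha>')"
    if X: "compact_object TYPE('u) D X" and \<alpha>: "\<alpha> \<in> Hom D X (FO F V)" for X \<alpha>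
  proof -
    obtain i \<alpha>' where i: "i \<in> Obj I" and \<alpha>': "\<alpha>' \<in> Hom D X (FO F (FO G i))" "\<alpha> = FA F (\<mu> i) \<bullet>\<^bsub>D\<^esub> \<alpha>'"
      using F.D.compact_object_factor[OF X I FV \<alpha>] by auto
    then show ?thesis using G[OF i] F.C.is_colimitD(4)[OF V i] by blast
  qed
  then interpret vertex_algebra_transport "TYPE('u)" C D F J e V vac T m
    using assms(2-5,7)
    by (simp add: vertex_algebra_transport_def vertex_algebra_transport_axioms_def standing_assumptions_def)
  show ?thesis by (rule vertex_algebra_image)
qed

end
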